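(* Let $(X^\circ,s)$ be an $A_1$ surface singularity, let $\tau\colon Y^\circ\to X^\circ$ be a minimal resolution, and let $m\ge1$. Then $$\chi(s,S^m\Omega^1_{Y^\circ})=\begin{cases}\frac14m(m+1)(m+2)&\text{if } m\equiv0\pmod2,\\ \frac14(m+1)(m^2+2m-1)&\text{if } m\equiv1\pmod2,\end{cases}$$ and $$\chi^1(s,S^m\Omega^1_{Y^\circ})=\begin{cases}\frac4{27}m^3+\frac49m^2+\frac13m&\text{if } m\equiv0\pmod3,\\ \frac4{27}m^3+\frac49m^2+\frac13m+\frac2{27}&\text{if } m\equiv1\pmod3,\\ \frac4{27}m^3+\frac49m^2+\frac19m-\frac5{27}&\text{if } m\equiv2\pmod3.\end{cases}$$
   Context: An $A_1$ singularity is modelled by the (complex) quadric cone $X^\circ=\{x_1x_3=x_2^2\}\subset\mathbb{A}^3$ with vertex $s=(0,0,0)$; the minimal resolution $Y^\circ$ is the blow-up of the vertex, with exceptional curve $E_s\simeq\mathbb{P}^1$, $E_s^2=-2$. For a locally free coherent sheaf $\mathcal{F}$ on $Y^\circ$ define the local Euler characteristic by $$\chi^0(s,\mathcal{F}):=\dim\big[H^0(Y^\circ-E_s,\mathcal{F})/H^0(Y^\circ,\mathcal{F})\big],\quad \chi^1(s,\mathcal{F}):=h^1(Y^\circ,\mathcal{F}),\quad \chi(s,\mathcal{F}):=\chi^0(s,\mathcal{F})+\chi^1(s,\mathcal{F}).$$ $S^m\Omega^1_{Y^\circ}$ is the $m$-th symmetric power of the cotangent sheaf. *)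

theory Defs
  imports "HOL-Analysis.Analysis"
begin

section \<open>Dimension of a quotient of complex function spaces\<close>

definition independent_modulo :: "('b \<Rightarrow> complex) set \<Rightarrow> ('b \<Rightarrow> complex) set \<Rightarrow> bool" where
  "independent_modulo W B \<longleftrightarrow>
     (\<forall>c. (\<lambda>x. \<Sum>b\<in>B. c b * b x) \<in> W \<longrightarrow> (\<forall>b\<in>B. c b = 0))"

text \<open>
  The dimension of \<open>V / W\<close> for linear subspaces \<open>W \<subseteq> V\<close>: the supremum of the sizes of finite
  families whose classes are linearly independent. The value is \<open>\<infinity>\<close> if the quotient is not
  finite dimensional.
\<close>

definition quotient_dim :: "('b \<Rightarrow> complex) set \<Rightarrow> ('b \<Rightarrow> complex) set \<Rightarrow> enat" where
  "quotient_dim V W =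
     (SUP B \<in> {B. finite B \<and> B \<subseteq> V \<and> independent_modulo W B}. enat (card B))"


section \<open>Cohomology and local Euler characteristic\<close>

text \<open>
  A sheaf of complex vector spaces on a topological space \<open>T\<close> is given by its sections: a section
  over \<open>U\<close> is a function of pairs \<open>(p, v)\<close>, where \<open>v\<close> is an auxiliary argument over the
  point \<open>p\<close> (below: a tangent vector), extended by \<open>0\<close> outside \<open>U\<close>. The sheaf operations are
  pointwise, and \<open>restrict_section\<close> is the restriction map.
\<close>

definition restrict_section :: "'a set \<Rightarrow> ('a \<times> 'v \<Rightarrow> complex) \<Rightarrow> 'a \<times> 'v \<Rightarrow> complex" where
  "restrict_section U \<sigma> = (\<lambda>(p, v). if p \<in> U then \<sigma> (p, v) else 0)"

text \<open>
  \<open>H\<^sup>1\<close> is Cech cohomology, i.e. the direct limit over all open covers; in degree one it agrees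
  with derived functor cohomology on every topological space. The covers
  \<open>(U p)\<close> indexed by the points of the space, with \<open>p \<in> U p\<close>, are cofinal among all covers and,
  ordered by \<open>V \<le> U \<longleftrightarrow> (\<forall>p. V p \<subseteq> U p)\<close>, form a directed system with canonical refinement maps
  (restriction, same indices), so the limit can be taken over them (Godement).

  A cochain is a function \<open>c\<close> with \<open>c (p, q, _)\<close> a section over \<open>U p \<inter> U q\<close>.
  In \<open>cech_cocycles\<close> and \<open>cech_coboundaries\<close> the values of \<open>c (p, q, _)\<close> off \<open>U p \<inter> U q\<close>, for
  some cover \<open>U\<close>, are left arbitrary. Hence two elements of \<open>cech_cocycles\<close> differ by an element of
  \<open>cech_coboundaries\<close> iff they become cohomologous after restriction to some common refinement,
  and the quotient of these two subspaces is exactly the direct limit.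
\<close>

definition point_cover :: "'a topology \<Rightarrow> ('a \<Rightarrow> 'a set) \<Rightarrow> bool" where
  "point_cover T U \<longleftrightarrow> (\<forall>p\<in>topspace T. openin T (U p) \<and> p \<in> U p)"

definition cech_cocycles ::
  "'a topology \<Rightarrow> ('a set \<Rightarrow> ('a \<times> 'v \<Rightarrow> complex) set) \<Rightarrow> ('a \<times> 'a \<times> 'a \<times> 'v \<Rightarrow> complex) set" where
  "cech_cocycles T F = {c. \<exists>U. point_cover T U \<and>
     (\<forall>p\<in>topspace T. \<forall>q\<in>topspace T.
        restrict_section (U p \<inter> U q) (\<lambda>z. c (p, q, z)) \<in> F (U p \<inter> U q)) \<and>
     (\<forall>p\<in>topspace T. \<forall>q\<in>topspace T. \<forall>r\<in>topspace T. \<forall>x \<in> U p \<inter> U q \<inter> U r. \<forall>v.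
        c (p, q, x, v) + c (q, r, x, v) = c (p, r, x, v))}"

definition cech_coboundaries ::
  "'a topology \<Rightarrow> ('a set \<Rightarrow> ('a \<times> 'v \<Rightarrow> complex) set) \<Rightarrow> ('a \<times> 'a \<times> 'a \<times> 'v \<Rightarrow> complex) set" where
  "cech_coboundaries T F = {c. \<exists>U b. point_cover T U \<and>
     (\<forall>p\<in>topspace T. b p \<in> F (U p)) \<and>
     (\<forall>p\<in>topspace T. \<forall>q\<in>topspace T. \<forall>x \<in> U p \<inter> U q. \<forall>v.
        c (p, q, x, v) = b q (x, v) - b p (x, v))}"

definition h1 :: "'a topology \<Rightarrow> ('a set \<Rightarrow> ('a \<times> 'v \<Rightarrow> complex) set) \<Rightarrow> enat" where
  "h1 T F = quotient_dim (cech_cocycles T F) (cech_coboundaries T F)"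

definition local_chi0 ::
  "'a topology \<Rightarrow> 'a set \<Rightarrow> ('a set \<Rightarrow> ('a \<times> 'v \<Rightarrow> complex) set) \<Rightarrow> enat" where
  "local_chi0 T E F =
     quotient_dim (F (topspace T - E)) (restrict_section (topspace T - E) ` F (topspace T))"

definition local_chi1 ::
  "'a topology \<Rightarrow> 'a set \<Rightarrow> ('a set \<Rightarrow> ('a \<times> 'v \<Rightarrow> complex) set) \<Rightarrow> enat" where
  "local_chi1 T E F = h1 T F"

definition local_chi ::
  "'a topology \<Rightarrow> 'a set \<Rightarrow> ('a set \<Rightarrow> ('a \<times> 'v \<Rightarrow> complex) set) \<Rightarrow> enat" where
  "local_chi T E F = local_chi0 T E F + local_chi1 T E F"


section \<open>Symmetric differentials\<close>

text \<open>
  \<open>\<O> U\<close> is the set of regular functions on the open set \<open>U\<close>, extended by \<open>0\<close>. A tangent vector at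
  \<open>p\<close> is a complex derivation at \<open>p\<close> of the local ring of germs at \<open>p\<close>. It is encoded
  as a function of representatives of germs (last clause: it depends on the germ only), with
  value \<open>0\<close> on functions that are not regular near \<open>p\<close>.
\<close>

definition tangent_vector ::
  "'a topology \<Rightarrow> ('a set \<Rightarrow> ('a \<Rightarrow> complex) set) \<Rightarrow> 'a \<Rightarrow> (('a \<Rightarrow> complex) \<Rightarrow> complex) \<Rightarrow> bool" where
  "tangent_vector T \<O> p D \<longleftrightarrow>
     (\<forall>f. (\<nexists>U. openin T U \<and> p \<in> U \<and> f \<in> \<O> U) \<longrightarrow> D f = 0) \<and>
     (\<forall>U f g. openin T U \<and> p \<in> U \<and> f \<in> \<O> U \<and> g \<in> \<O> U \<longrightarrow>
        D (\<lambda>q. f q + g q) = D f + D g \<and>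
        D (\<lambda>q. f q * g q) = f p * D g + g p * D f) \<and>
     (\<forall>U f a. openin T U \<and> p \<in> U \<and> f \<in> \<O> U \<longrightarrow> D (\<lambda>q. a * f q) = a * D f) \<and>
     (\<forall>U V W f g. openin T U \<and> openin T V \<and> openin T W \<and> p \<in> W \<and> W \<subseteq> U \<inter> V \<and>
        f \<in> \<O> U \<and> g \<in> \<O> V \<and> (\<forall>q\<in>W. f q = g q) \<longrightarrow> D f = D g)"

text \<open>
  Sections of \<open>S\<^sup>m \<Omega>\<^sup>1\<close> on a smooth variety over the complex numbers: a section assigns to each
  point \<open>q\<close> an element of the \<open>m\<close>-th symmetric power of the cotangent space at \<open>q\<close>, viewed as a
  homogeneous function of degree \<open>m\<close> on tangent vectors, and is locally a finite sum of
  terms \<open>g df\<^sub>1 \<dots> df\<^sub>m\<close> with \<open>g, f\<^sub>1, \<dots>, f\<^sub>m\<close> regular. Here \<open>df\<close> is the function \<open>D \<mapsto> D f\<close>.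
\<close>

definition symmetric_differentials ::
  "'a topology \<Rightarrow> ('a set \<Rightarrow> ('a \<Rightarrow> complex) set) \<Rightarrow> nat \<Rightarrow> 'a set \<Rightarrow>
     ('a \<times> (('a \<Rightarrow> complex) \<Rightarrow> complex) \<Rightarrow> complex) set" where
  "symmetric_differentials T \<O> m U = {\<omega>.
     (\<forall>q D. \<not> (q \<in> U \<and> tangent_vector T \<O> q D) \<longrightarrow> \<omega> (q, D) = 0) \<and>
     (\<forall>p\<in>U. \<exists>V (n::nat) g f. openin T V \<and> p \<in> V \<and> V \<subseteq> U \<and>
        (\<forall>i<n. g i \<in> \<O> V \<and> (\<forall>j<m. f i j \<in> \<O> V)) \<and>
        (\<forall>q\<in>V. \<forall>D. tangent_vector T \<O> q D \<longrightarrow>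
           \<omega> (q, D) = (\<Sum>i<n. g i q * (\<Prod>j<m. D (f i j)))))}"


section \<open>Blow-up of the origin\<close>

text \<open>
  Polynomials in \<open>x, y\<close> that are homogeneous of degree \<open>d\<close> in \<open>y\<close>, as functions.
\<close>

inductive fibre_homogeneous :: "nat \<Rightarrow> (complex^'n \<Rightarrow> complex^'n \<Rightarrow> complex) \<Rightarrow> bool" where
  const: "fibre_homogeneous 0 (\<lambda>x y. a)"
| base_coord: "fibre_homogeneous 0 (\<lambda>x y. x $ i)"
| fibre_coord: "fibre_homogeneous 1 (\<lambda>x y. y $ i)"
| add: "fibre_homogeneous d f \<Longrightarrow> fibre_homogeneous d g \<Longrightarrow>
          fibre_homogeneous d (\<lambda>x y. f x y + g x y)"
| mult: "fibre_homogeneous d f \<Longrightarrow> fibre_homogeneous e g \<Longrightarrow>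
          fibre_homogeneous (d + e) (\<lambda>x y. f x y * g x y)"

text \<open>
  The point of projective space with homogeneous coordinates \<open>y \<noteq> 0\<close> is the line through \<open>y\<close>.
\<close>

definition proj_point :: "complex^'n \<Rightarrow> (complex^'n) set" where
  "proj_point y = range (\<lambda>a. a *s y)"

text \<open>
  The Zariski topology on the product of affine and projective space. Taking \<open>f = 1\<close> shows that
  the whole space is the set of all \<open>(x, proj_point y)\<close> with \<open>y \<noteq> 0\<close>.
\<close>

definition nonvanishing ::
  "(complex^'n \<Rightarrow> complex^'n \<Rightarrow> complex) \<Rightarrow> ((complex^'n) \<times> (complex^'n) set) set" where
  "nonvanishing f = {(x, proj_point y) | x y. y \<noteq> 0 \<and> f x y \<noteq> 0}"

definition zariski :: "((complex^'n) \<times> (complex^'n) set) topology" where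
  "zariski = topology_generated_by {nonvanishing f | f d. fibre_homogeneous d f}"

text \<open>
  The blow-up at the origin of \<open>X\<close>: the closure of the graph of \<open>x \<mapsto> [x]\<close> on \<open>X - {0}\<close>.
\<close>

definition blowup_origin :: "(complex^'n) set \<Rightarrow> ((complex^'n) \<times> (complex^'n) set) topology" where
  "blowup_origin X =
     subtopology zariski (zariski closure_of {(x, proj_point x) | x. x \<in> X \<and> x \<noteq> 0})"

definition regular_functions ::
  "((complex^'n) \<times> (complex^'n) set) topology \<Rightarrow> ((complex^'n) \<times> (complex^'n) set) set \<Rightarrow>
     ((complex^'n) \<times> (complex^'n) set \<Rightarrow> complex) set" where
  "regular_functions T U = {\<phi>. (\<forall>p. p \<notin> U \<longrightarrow> \<phi> p = 0) \<and>
     (\<forall>p\<in>U. \<exists>V d g h. openin T V \<and> p \<in> V \<and> V \<subseteq> U \<and>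
        fibre_homogeneous d g \<and> fibre_homogeneous d h \<and>
        (\<forall>x y. y \<noteq> 0 \<and> (x, proj_point y) \<in> V \<longrightarrow>
           h x y \<noteq> 0 \<and> \<phi> (x, proj_point y) = g x y / h x y))}"


section \<open>The \<open>A\<^sub>1\<close> singularity and its minimal resolution\<close>

definition quadric_cone :: "(complex^3) set" where
  "quadric_cone = {x. x $ 1 * x $ 3 = (x $ 2)\<^sup>2}"

definition A1_resolution :: "((complex^3) \<times> (complex^3) set) topology" where
  "A1_resolution = blowup_origin quadric_cone"

text \<open>The resolution map \<open>\<tau>\<close> is \<open>fst\<close>, and the exceptional curve is its fibre over the vertex.\<close>

definition A1_exceptional :: "((complex^3) \<times> (complex^3) set) set" where
  "A1_exceptional = {p \<in> topspace A1_resolution. fst p = 0}"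

definition A1_sym_cotangent ::
  "nat \<Rightarrow> ((complex^3) \<times> (complex^3) set) set \<Rightarrow>
     (((complex^3) \<times> (complex^3) set) \<times> (((complex^3) \<times> (complex^3) set \<Rightarrow> complex) \<Rightarrow> complex)
        \<Rightarrow> complex) set" where
  "A1_sym_cotangent m =
     symmetric_differentials A1_resolution (regular_functions A1_resolution) m"

end

theory Submission
  imports Defs
    "HOL-Computational_Algebra.Fundamental_Theorem_Algebra"
begin

text \<open>
  The resolution is covered by two affine planes with coordinates \<open>(u, v)\<close> and
  \<open>(1/u, u\<^sup>2 v)\<close>, and \<open>v = 0\<close> is the exceptional curve. Since the first cohomology of a plane vanishes
  (partition of unity from the Nullstellensatz), \<open>H\<^sup>1\<close> consists of the forms on the
  overlap modulo the forms on the two planes. Split forms by their weight \<open>(i, j)\<close> under the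
  torus acting on \<open>u, v\<close>, and evaluate them at the tangent vectors \<open>u (1 - y) \<partial>\<^sub>u + 2 v y \<partial>\<^sub>v\<close>. The
  part of weight \<open>(i, j)\<close> becomes a polynomial \<open>q\<close> of degree at most \<open>m\<close> in \<open>y\<close>, and the form is regular
  along \<open>u = 0\<close> in the first plane iff \<open>y\<^sup>m\<^sup>-\<^sup>i\<close> divides \<open>q\<close>, along \<open>1/u = 0\<close> in the second plane iff
  \<open>deg q \<le> 2 j - i\<close>, and along the exceptional curve iff \<open>(1 - y)\<^sup>m\<^sup>-\<^sup>j\<close> divides \<open>q\<close>. With these
  conditions both quotients have monomial bases, which are counted.
\<close>

text \<open>The test vectors come from the fan of the resolution, whose rays \<open>(1, 0)\<close>,
  \<open>(0, 1)\<close>, \<open>(-1, 2)\<close> belong to the curves \<open>u = 0\<close>,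
  \<open>v = 0\<close> and \<open>1/u = 0\<close>. In the frame \<open>u d/du\<close>,
  \<open>v d/dv\<close> the vector \<open>(1 - y, 2 y)\<close> points along these rays at y = 0, y =
  1 and y = infinity. A form of weight \<open>(i, j)\<close> is \<open>u^i v^j\<close> times a
  polynomial of degree \<open>m\<close> in \<open>du/u\<close> and \<open>dv/v\<close>, which take
  the values \<open>1 - y\<close> and \<open>2 y\<close>; the logarithmic differentials of
  \<open>1/u\<close> and \<open>u^2 v\<close> take the values \<open>y - 1\<close> and
  \<open>2\<close>. Regularity along a curve bounds the number of factors with a pole there by the
  pairing of the weight with the ray, that is by \<open>i\<close>, \<open>j\<close> or
  \<open>2 j - i\<close>. This is a vanishing order at the matching point of the projective line.
  Since one of the three points lies at infinity, factoring out the condition at a second one leaves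
  a polynomial on which the third condition concerns low coefficients and the one at infinity is a
  degree bound; this is why monomial bases exist.\<close>

lemma nontrivial_relation:
  fixes a :: "'b \<Rightarrow> 'i \<Rightarrow> 'k::field"
  assumes "finite I" "finite B" "card I < card B"
  shows "\<exists>c. (\<exists>b\<in>B. c b \<noteq> 0) \<and> (\<forall>i\<in>I. (\<Sum>b\<in>B. c b * a b i) = 0)"
  using assms
proof (induction I arbitrary: B a rule: finite_induct)
  case empty
  then obtain b where "b \<in> B" by fastforce
  then show ?case by (intro exI[of _ "\<lambda>_. 1"]) auto
next
  case (insert i I)
  show ?case
  proof (cases "\<forall>b\<in>B. a b i = 0")
    case True
    have "card I < card B" using insert by simp
    from insert.IH[OF insert.prems(1) this, of a] obtain c where
      "\<exists>b\<in>B. c b \<noteq> 0" "\<forall>i\<in>I. (\<Sum>b\<in>B. c b * a b i) = 0"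
      by blast
    with True show ?thesis by (intro exI[of _ c]) auto
  next
    case False
    then obtain b0 where b0: "b0 \<in> B" "a b0 i \<noteq> 0" by auto
    \<comment> \<open>Elimination of the unknown \<open>b0\<close> by means of equation
      \<open>i\<close>: the new coefficients satisfy \<open>a' b i = 0\<close>, and
      \<open>- s\<close> below is the value that equation \<open>i\<close> then forces on
      \<open>b0\<close>.\<close>
    define a' where "a' = (\<lambda>b k. a b k - a b i / a b0 i * a b0 k)"
    have "card I < card (B - {b0})" using insert b0 by (simp add: card_insert_if)
    from insert.IH[OF _ this, of a'] insert obtain c where
      c: "\<exists>b\<in>B - {b0}. c b \<noteq> 0" "\<And>k. k \<in> I \<Longrightarrow> (\<Sum>b\<in>B - {b0}. c b * a' b k) = 0"
      by auto
    define s where "s = (\<Sum>b\<in>B - {b0}. c b * (a b i / a b0 i))"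
    define c' where "c' = c (b0 := - s)"
    have split: "(\<Sum>b\<in>B. c' b * a b k) = (\<Sum>b\<in>B - {b0}. c b * a b k) - s * a b0 k" for k
      unfolding sum.remove[OF \<open>finite B\<close> b0(1)]
      by (simp add: c'_def)
    have "(\<Sum>b\<in>B. c' b * a b k) = (\<Sum>b\<in>B - {b0}. c b * a' b k)" for k
      unfolding split s_def sum_distrib_right a'_def sum_subtractf[symmetric]
      by (rule sum.cong) (auto simp: algebra_simps)
    moreover have "a' b i = 0" for b using b0 by (simp add: a'_def)
    ultimately have "\<forall>k\<in>insert i I. (\<Sum>b\<in>B. c' b * a b k) = 0" using c(2) by auto
    moreover have "\<exists>b\<in>B. c' b \<noteq> 0" using c(1) by (auto simp: c'_def)
    ultimately show ?thesis by blast
  qed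
qed


section \<open>Polynomials in two variables\<close>

text \<open>The inner variable is the first one.\<close>

type_synonym poly2 = "complex poly poly"

definition ev :: "poly2 \<Rightarrow> complex \<times> complex \<Rightarrow> complex" where
  "ev P z = poly (poly P [:snd z:]) (fst z)"

definition pC :: "complex \<Rightarrow> poly2" where "pC c = [:[:c:]:]"
definition pU :: poly2 where "pU = [:[:0, 1:]:]"
definition pV :: poly2 where "pV = [:0, 1:]"

lemma ev_simps [simp]:
  "ev (P + Q) z = ev P z + ev Q z"
  "ev (P - Q) z = ev P z - ev Q z"
  "ev (- P) z = - ev P z"
  "ev (P * Q) z = ev P z * ev Q z"
  "ev (P ^ n) z = ev P z ^ n"
  "ev 0 z = 0" "ev 1 z = 1"
  "ev (pC c) z = c" "ev pU z = fst z" "ev pV z = snd z"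
  by (simp_all add: ev_def pC_def pU_def pV_def poly_power)

lemma ev_sum [simp]: "ev (\<Sum>i\<in>A. f i) z = (\<Sum>i\<in>A. ev (f i) z)"
  by (induction A rule: infinite_finite_induct) auto

lemma pC_simps: "pC (a + b) = pC a + pC b" "pC (a * b) = pC a * pC b" "pC 0 = 0" "pC 1 = 1"
  "pC (- a) = - pC a" "pC (a - b) = pC a - pC b"
  by (simp_all add: pC_def one_pCons)

lemma poly2_induct [case_names const fst snd add mult]:
  assumes "\<And>c. R (pC c)" "R pU" "R pV"
    "\<And>P Q. R P \<Longrightarrow> R Q \<Longrightarrow> R (P + Q)" "\<And>P Q. R P \<Longrightarrow> R Q \<Longrightarrow> R (P * Q)"
  shows "R P"
proof -
  have inner: "R [:p:]" for p
  proof (induction p)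
    case 0
    then show ?case using assms(1)[of 0] by (simp add: pC_def)
  next
    case (pCons a p)
    have "[:pCons a p:] = pC a + pU * [:p:]" by (simp add: pC_def pU_def)
    then show ?case using pCons assms by metis
  qed
  show ?thesis
  proof (induction P)
    case 0
    then show ?case using inner[of 0] by simp
  next
    case (pCons a P)
    have "pCons a P = [:a:] + pV * P" by (simp add: pV_def)
    then show ?case using pCons inner assms by metis
  qed
qed

text \<open>Setting the second variable to any \<open>v\<close> gives the zero polynomial, so
  \<open>P\<close>, read as a polynomial over the domain of polynomials in the first variable, has
  infinitely many roots \<open>[:v:]\<close>.\<close>

lemma ev_eq_0_imp: "P = 0" if "\<And>z. ev P z = 0"
proof (rule ccontr)
  assume "P \<noteq> 0"
  then have "finite {x. poly P x = 0}" by (rule poly_roots_finite)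
  moreover have "range (\<lambda>v. [:v:]) \<subseteq> {x. poly P x = 0}"
  proof safe
    fix v :: complex
    have "poly (poly P [:v:]) u = 0" for u using that[of "(u, v)"] by (simp add: ev_def)
    then show "poly P [:v:] = 0" by (metis poly_all_0_iff_0)
  qed
  moreover have "infinite (range (\<lambda>v::complex. [:v:]))"
    by (subst finite_image_iff) (auto simp: inj_on_def infinite_UNIV_char_0)
  ultimately show False by (meson finite_subset)
qed

text \<open>The product of \<open>D\<close> with the difference vanishes everywhere, and the
  polynomial ring is a domain. This is the algebraic form of the density of a nonempty principal
  open set.\<close>

lemma ev_eq_on_dense:
  assumes "D \<noteq> 0" "\<And>z. ev D z \<noteq> 0 \<Longrightarrow> ev P z = ev Q z"
  shows "P = Q"
proof -
  have "D * (P - Q) = 0" by (rule ev_eq_0_imp) (use assms(2) in auto)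
  then show ?thesis using assms(1) by simp
qed


section \<open>The Nullstellensatz in the plane\<close>

definition is_ideal :: "'r::comm_ring_1 set \<Rightarrow> bool" where
  "is_ideal J \<longleftrightarrow> 0 \<in> J \<and> (\<forall>a\<in>J. \<forall>b\<in>J. a + b \<in> J) \<and> (\<forall>a\<in>J. \<forall>r. r * a \<in> J)"

lemma is_idealD:
  assumes "is_ideal J"
  shows "0 \<in> J" "a \<in> J \<Longrightarrow> b \<in> J \<Longrightarrow> a + b \<in> J" "a \<in> J \<Longrightarrow> r * a \<in> J"
    "a \<in> J \<Longrightarrow> a * r \<in> J" "a \<in> J \<Longrightarrow> b \<in> J \<Longrightarrow> a - b \<in> J"
proof -
  show "0 \<in> J" "a \<in> J \<Longrightarrow> b \<in> J \<Longrightarrow> a + b \<in> J" "a \<in> J \<Longrightarrow> r * a \<in> J" for a b r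
    using assms by (auto simp: is_ideal_def)
  note * = this
  show "a \<in> J \<Longrightarrow> a * r \<in> J" using *(3)[of a r] by (simp add: mult.commute)
  show "a \<in> J \<Longrightarrow> b \<in> J \<Longrightarrow> a - b \<in> J" using *(2)[of a "- 1 * b"] *(3)[of b "- 1"] by simp
qed

lemma is_ideal_sum: "is_ideal J \<Longrightarrow> (\<And>i. i \<in> A \<Longrightarrow> f i \<in> J) \<Longrightarrow> sum f A \<in> J"
  by (induction A rule: infinite_finite_induct) (auto intro: is_idealD)

section \<open>Ideals that are maximal among those avoiding the powers of an element\<close>

text \<open>Such an \<open>M\<close> is the contraction of a maximal ideal of the localisation at
  \<open>f\<close>: by the last clause every \<open>g\<close> outside \<open>M\<close> becomes
  invertible modulo \<open>M\<close> once \<open>f\<close> is inverted. These ideals take the place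
  of the extra variable in the trick of Rabinowitsch.\<close>

definition max_avoiding :: "'r::comm_ring_1 \<Rightarrow> 'r set \<Rightarrow> bool" where
  "max_avoiding f M \<longleftrightarrow> is_ideal M \<and> (\<forall>n. f ^ n \<notin> M) \<and>
     (\<forall>g. g \<notin> M \<longrightarrow> (\<exists>n r m. m \<in> M \<and> f ^ n = m + r * g))"

lemma max_avoiding_exists:
  assumes J: "is_ideal J" and f: "\<And>n. f ^ n \<notin> J"
  shows "\<exists>M. J \<subseteq> M \<and> max_avoiding f M"
proof -
  define A where "A = {M. is_ideal M \<and> J \<subseteq> M \<and> (\<forall>n. f ^ n \<notin> M)}"
  have "\<exists>M\<in>A. \<forall>X\<in>A. M \<subseteq> X \<longrightarrow> X = M"
  proof (rule subset_Zorn_nonempty)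
    show "A \<noteq> {}" using J f by (auto simp: A_def)
    fix C assume C: "C \<noteq> {}" "subset.chain A C"
    then have CA: "C \<subseteq> A" and ch: "\<And>X Y. X \<in> C \<Longrightarrow> Y \<in> C \<Longrightarrow> X \<subseteq> Y \<or> Y \<subseteq> X"
      by (auto simp: subset.chain_def)
    have "is_ideal (\<Union>C)"
      unfolding is_ideal_def
    proof (intro conjI ballI allI)
      show "0 \<in> \<Union>C" using C(1) CA is_idealD(1) unfolding A_def by blast
      fix a assume a: "a \<in> \<Union>C"
      show "r * a \<in> \<Union>C" for r using a CA is_idealD(3) unfolding A_def by blast
      fix b assume b: "b \<in> \<Union>C"
      from a b obtain X Y where XY: "a \<in> X" "X \<in> C" "b \<in> Y" "Y \<in> C" by auto
      with ch[of X Y] obtain Z where "Z \<in> C" "a \<in> Z" "b \<in> Z" by auto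
      then show "a + b \<in> \<Union>C" using CA is_idealD(2) unfolding A_def by blast
    qed
    then show "\<Union>C \<in> A" using C(1) CA by (auto simp: A_def)
  qed
  then obtain M where M: "M \<in> A" and mx: "\<And>X. X \<in> A \<Longrightarrow> M \<subseteq> X \<Longrightarrow> X = M" by auto
  then have idM: "is_ideal M" by (simp add: A_def)
  have "\<exists>n r m. m \<in> M \<and> f ^ n = m + r * g" if g: "g \<notin> M" for g
  proof (rule ccontr)
    assume no: "\<not> ?thesis"
    \<comment> \<open>\<open>X\<close> is the ideal generated by \<open>M\<close> and
      \<open>g\<close>. If it contained no power of \<open>f\<close>, maximality would force
      \<open>X = M\<close> and hence \<open>g\<close> into \<open>M\<close>.\<close>
    define X where "X = {m + r * g |m r. m \<in> M}"
    have "is_ideal X"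
      unfolding is_ideal_def
    proof (intro conjI ballI allI)
      show "0 \<in> X" using is_idealD(1)[OF idM] by (auto simp: X_def intro!: exI[of _ 0])
      fix a assume "a \<in> X"
      then obtain m r where a: "a = m + r * g" "m \<in> M" by (auto simp: X_def)
      have "s * a = s * m + (s * r) * g" for s by (simp add: a algebra_simps)
      then show "s * a \<in> X" for s unfolding X_def using a is_idealD(3)[OF idM] by blast
      fix b assume "b \<in> X"
      then obtain m' r' where b: "b = m' + r' * g" "m' \<in> M" by (auto simp: X_def)
      have "a + b = (m + m') + (r + r') * g" by (simp add: a b algebra_simps)
      then show "a + b \<in> X" unfolding X_def using a b is_idealD(2)[OF idM] by blast
    qed
    moreover have "M \<subseteq> X" by (force simp: X_def intro: exI[of _ 0])
    moreover have "f ^ n \<notin> X" for n using no by (auto simp: X_def)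
    ultimately have "X = M" using mx[of X] M unfolding A_def by blast
    moreover have "g = 0 + 1 * g" by simp
    then have "g \<in> X" unfolding X_def using is_idealD(1)[OF idM] by blast
    ultimately show False using g by simp
  qed
  then show ?thesis using M by (auto simp: A_def max_avoiding_def)
qed

text \<open>If both factors lie outside \<open>M\<close>, some powers of \<open>f\<close> are
  multiples of \<open>a\<close> and of \<open>b\<close> modulo \<open>M\<close>. Their product is
  then a multiple of \<open>a * b\<close> modulo \<open>M\<close>, hence a power of \<open>f\<close>
  inside \<open>M\<close>.\<close>

lemma max_avoiding_prime:
  assumes M: "max_avoiding f M" and ab: "a * b \<in> M"
  shows "a \<in> M \<or> b \<in> M"
proof (rule ccontr)
  assume "\<not> ?thesis"
  with M obtain n r m k s m' where *: "m \<in> M" "f ^ n = m + r * a" "m' \<in> M" "f ^ k = m' + s * b"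
    unfolding max_avoiding_def by metis
  have id: "is_ideal M" using M by (simp add: max_avoiding_def)
  have "f ^ (n + k) = m * (m' + s * b) + (r * a) * m' + (r * s) * (a * b)"
    by (simp add: power_add *(2,4) algebra_simps)
  also have "\<dots> \<in> M"
    by (intro is_idealD(2)[OF id] is_idealD(4)[OF id *(1)] is_idealD(3)[OF id *(3)] is_idealD(3)[OF id ab])
  finally show False using M by (simp add: max_avoiding_def)
qed

definition subst2 :: "complex poly \<Rightarrow> poly2 \<Rightarrow> poly2" where
  "subst2 R w = poly (map_poly pC R) w"

lemma subst2_pCons: "subst2 (pCons c R) w = pC c + w * subst2 R w"
  by (simp add: subst2_def map_poly_pCons pC_simps)

lemma subst2_0: "subst2 0 w = 0"
  by (simp add: subst2_def)

lemma subst2_add: "subst2 (P + Q) w = subst2 P w + subst2 Q w"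
  by (induction P Q rule: poly_induct2) (simp_all add: subst2_pCons subst2_0 pC_simps algebra_simps)

lemma subst2_smult: "subst2 (smult c P) w = pC c * subst2 P w"
  by (induction P) (simp_all add: subst2_pCons subst2_0 pC_simps algebra_simps)

lemma subst2_linear: "subst2 ([:- a, 1:] * P) w = (w - pC a) * subst2 P w"
proof -
  have "[:- a, 1:] * P = smult (- a) P + pCons 0 P" by simp
  then show ?thesis by (simp only: subst2_add subst2_smult subst2_pCons pC_simps) (simp add: algebra_simps)
qed

lemma subst2_sum: "subst2 (\<Sum>i\<in>A. f i) w = (\<Sum>i\<in>A. subst2 (f i) w)"
  by (induction A rule: infinite_finite_induct) (simp_all add: subst2_add subst2_0)

lemma subst2_prod_linear: "subst2 (\<Prod>b\<in>B. [:- b, 1:]) w = (\<Prod>b\<in>B. w - pC b)"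
proof (induction B rule: infinite_finite_induct)
  case (insert x F)
  then show ?case by (simp add: subst2_linear del: mult_pCons_left)
qed (simp_all add: subst2_pCons subst2_0 pC_simps one_pCons)

lemma max_avoiding_const: "max_avoiding f M \<Longrightarrow> pC c \<in> M \<Longrightarrow> c = 0"
proof (rule ccontr)
  assume M: "max_avoiding f M" "pC c \<in> M" "c \<noteq> 0"
  then have "pC (1 / c) * pC c \<in> M" by (auto simp: max_avoiding_def intro: is_idealD)
  then have "f ^ 0 \<in> M" using M(3) by (simp flip: pC_simps(2) add: pC_simps)
  then show False using M unfolding max_avoiding_def by blast
qed

text \<open>Over the complex numbers \<open>R\<close> splits into linear factors, and since
  \<open>M\<close> is prime, a product of elements \<open>w - pC a\<close> and a nonzero constant
  stays outside \<open>M\<close>.\<close>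

lemma max_avoiding_subst2:
  assumes M: "max_avoiding f M" and w: "\<And>a. w - pC a \<notin> M" and "R \<noteq> 0"
  shows "subst2 R w \<notin> M"
  using \<open>R \<noteq> 0\<close>
proof (induction "degree R" arbitrary: R rule: less_induct)
  case less
  show ?case
  proof (cases "degree R = 0")
    case True
    then obtain c where "R = [:c:]" "c \<noteq> 0" using less.prems by (metis degree_eq_zeroE pCons_0_0)
    then show ?thesis using max_avoiding_const[OF M, of c] by (auto simp: subst2_pCons subst2_0)
  next
    case False
    then obtain a where "poly R a = 0"
      using fundamental_theorem_of_algebra[of R] by (auto simp: constant_degree)
    then obtain S where S: "R = [:- a, 1:] * S" by (metis dvdE poly_eq_0_iff_dvd)
    have "S \<noteq> 0" using S less.prems by auto
    then have "degree S < degree R" unfolding S by (subst degree_mult_eq) auto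
    with less.hyps[of S] \<open>S \<noteq> 0\<close> have "subst2 S w \<notin> M" by simp
    then show ?thesis using max_avoiding_prime[OF M] w[of a] by (auto simp: S subst2_linear simp del: mult_pCons_left)
  qed
qed

lemma poly2_eqI: "(\<And>i j. coeff (coeff P j) i = coeff (coeff Q j) i) \<Longrightarrow> P = (Q :: poly2)"
  by (intro poly_eqI) auto

lemma poly2_bounded: "\<exists>d. \<forall>i j. coeff (coeff (P::poly2) j) i \<noteq> 0 \<longrightarrow> i \<le> d \<and> j \<le> d"
proof -
  define d where "d = degree P + (\<Sum>j\<le>degree P. degree (coeff P j))"
  have "i \<le> d \<and> j \<le> d" if nz: "coeff (coeff P j) i \<noteq> 0" for i j
  proof -
    have j: "j \<le> degree P" using nz by (intro le_degree) auto
    have "i \<le> degree (coeff P j)" using nz by (intro le_degree) auto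
    also have "\<dots> \<le> (\<Sum>j\<le>degree P. degree (coeff P j))" using j by (intro member_le_sum) auto
    finally show ?thesis using j by (simp add: d_def)
  qed
  then show ?thesis by blast
qed

lemma infinite_fibre:
  fixes k :: "'a \<Rightarrow> 'b::countable"
  assumes "uncountable (UNIV :: 'a set)"
  shows "\<exists>y. infinite {x. k x = y}"
proof (rule ccontr)
  assume "\<not> ?thesis"
  then have "countable (\<Union>y. {x. k x = y})" by (intro countable_UN) (auto intro: countable_finite)
  moreover have "(\<Union>y. {x. k x = y}) = UNIV" by auto
  ultimately show False using assms by simp
qed

text \<open>Otherwise uncountably many elements \<open>1/(w - a)\<close> of the localised quotient would be linearly
  independent in a space of countable dimension.\<close>

lemma max_avoiding_linear:
  fixes f :: poly2
  assumes M: "max_avoiding f M"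
  shows "\<exists>a. w - pC a \<in> M"
proof (rule ccontr)
  assume no: "\<not> ?thesis"
  have id: "is_ideal M" using M by (simp add: max_avoiding_def)
  have "\<forall>a. \<exists>n g m. m \<in> M \<and> f ^ n = m + g * (w - pC a)" using M no by (simp add: max_avoiding_def)
  then obtain n g m where ngm: "\<And>a. m a \<in> M" "\<And>a. f ^ (n a) = m a + g a * (w - pC a)" by metis
  have "\<forall>a. \<exists>d. \<forall>i j. coeff (coeff (g a) j) i \<noteq> 0 \<longrightarrow> i \<le> d \<and> j \<le> d" using poly2_bounded by blast
  then obtain d where d: "\<And>a i j. coeff (coeff (g a) j) i \<noteq> 0 \<Longrightarrow> i \<le> d a \<and> j \<le> d a" by metis
  \<comment> \<open>There are uncountably many \<open>a\<close> but only countably many pairs of an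
    exponent of \<open>f\<close> and a degree bound of \<open>g a\<close>, so infinitely many
    \<open>a\<close> share one pair \<open>(N, D)\<close>. Their \<open>g a\<close> lie in a space
    of dimension \<open>card I\<close>.\<close>
  from infinite_fibre[OF uncountable_UNIV_complex, of "\<lambda>a. (n a, d a)"]
  obtain N D where inf: "infinite {a. (n a, d a) = (N, D)}" by (metis surj_pair)
  define I where "I = {..D} \<times> {..D}"
  from infinite_arbitrarily_large[OF inf, of "Suc (card I)"] obtain B where
    B: "finite B" "card B = Suc (card I)" "\<And>b. b \<in> B \<Longrightarrow> n b = N \<and> d b = D" by fast
  from nontrivial_relation[of I B "\<lambda>b (i, j). coeff (coeff (g b) j) i"] B(1,2)
  obtain c where c: "\<exists>b\<in>B. c b \<noteq> 0"
      "\<And>i j. (i, j) \<in> I \<Longrightarrow> (\<Sum>b\<in>B. c b * coeff (coeff (g b) j) i) = 0"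
    by (fastforce simp: I_def)
  have "(\<Sum>b\<in>B. pC (c b) * g b) = 0"
  proof (rule poly2_eqI)
    fix i j
    have "coeff (coeff (\<Sum>b\<in>B. pC (c b) * g b) j) i = (\<Sum>b\<in>B. c b * coeff (coeff (g b) j) i)"
      by (simp add: coeff_sum pC_def)
    also have "\<dots> = 0"
    proof (cases "(i, j) \<in> I")
      case False
      then have "coeff (coeff (g b) j) i = 0" if "b \<in> B" for b
        using d[of b j i] B(3)[OF that] by (auto simp: I_def)
      then show ?thesis by simp
    qed (use c in auto)
    finally show "coeff (coeff (\<Sum>b\<in>B. pC (c b) * g b) j) i = coeff (coeff 0 j) i" by simp
  qed
  note rel = this
  \<comment> \<open>\<open>R\<close> is the numerator of the sum of \<open>c b / (x - b)\<close>
    over \<open>B\<close> after clearing denominators. At a point \<open>b\<close> of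
    \<open>B\<close> only its own summand survives, so one nonzero \<open>c b\<close> makes
    \<open>R\<close> nonzero.\<close>
  define R where "R = (\<Sum>b\<in>B. smult (c b) (\<Prod>a\<in>B - {b}. [:- a, 1:]))"
  from c(1) obtain b where b: "b \<in> B" "c b \<noteq> 0" by auto
  have "poly R b = (\<Sum>b'\<in>B. if b' = b then c b * (\<Prod>a\<in>B - {b}. b - a) else 0)"
    unfolding R_def poly_sum
  proof (rule sum.cong)
    fix b' assume "b' \<in> B"
    show "poly (smult (c b') (\<Prod>a\<in>B - {b'}. [:- a, 1:])) b =
      (if b' = b then c b * (\<Prod>a\<in>B - {b}. b - a) else 0)"
      using b(1) B(1) by (auto simp: poly_prod)
  qed auto
  also have "\<dots> \<noteq> 0" using b B(1) by simp
  finally have "R \<noteq> 0" by auto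
  \<comment> \<open>Modulo \<open>M\<close> the factor \<open>f ^ N\<close> may be replaced by
    \<open>g b * (w - pC b)\<close> in the summand of \<open>b\<close>. This supplies the missing
    linear factor and leaves the relation \<open>rel\<close> times the full product.\<close>
  have "f ^ N * subst2 R w =
      (\<Sum>b\<in>B. m b * (pC (c b) * (\<Prod>a\<in>B - {b}. w - pC a))) +
      (\<Sum>b\<in>B. pC (c b) * g b) * (\<Prod>a\<in>B. w - pC a)"
    unfolding R_def subst2_sum subst2_smult subst2_prod_linear sum_distrib_left sum_distrib_right
      sum.distrib[symmetric]
  proof (rule sum.cong)
    fix b assume b: "b \<in> B"
    have "f ^ N = m b + g b * (w - pC b)" using ngm(2)[of b] B(3)[OF b] by simp
    then show "f ^ N * (pC (c b) * (\<Prod>a\<in>B - {b}. w - pC a)) =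
       m b * (pC (c b) * (\<Prod>a\<in>B - {b}. w - pC a)) + pC (c b) * g b * (\<Prod>a\<in>B. w - pC a)"
      unfolding prod.remove[OF B(1) b] by (simp only:) (simp only: distrib_left distrib_right mult_ac)
  qed auto
  also have "\<dots> \<in> M" unfolding rel
    by (auto intro!: is_ideal_sum[OF id] is_idealD(4)[OF id] ngm)
  finally have "f ^ N \<in> M \<or> subst2 R w \<in> M" by (rule max_avoiding_prime[OF M])
  then show False
    using max_avoiding_subst2[OF M _ \<open>R \<noteq> 0\<close>, of w] no M by (auto simp: max_avoiding_def)
qed

text \<open>If no power of \<open>f\<close> lies in \<open>J\<close>, some \<open>M\<close> above
  \<open>J\<close> contains \<open>pU - pC a\<close> and \<open>pV - pC b\<close>. Every polynomial
  is then congruent modulo \<open>M\<close> to its value at \<open>(a, b)\<close>, so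
  \<open>(a, b)\<close> is a zero of \<open>J\<close> and therefore of \<open>f\<close>, which puts
  \<open>f\<close> itself into \<open>M\<close>.\<close>

theorem nullstellensatz:
  assumes J: "is_ideal J" and van: "\<And>z. (\<And>P. P \<in> J \<Longrightarrow> ev P z = 0) \<Longrightarrow> ev f z = 0"
  shows "\<exists>n. f ^ n \<in> J"
proof (rule ccontr)
  assume "\<not> ?thesis"
  then obtain M where JM: "J \<subseteq> M" and M: "max_avoiding f M"
    using max_avoiding_exists[OF J, of f] by blast
  have id: "is_ideal M" using M by (simp add: max_avoiding_def)
  obtain a b where ab: "pU - pC a \<in> M" "pV - pC b \<in> M" using max_avoiding_linear[OF M] by metis
  have key: "P - pC (ev P (a, b)) \<in> M" for P
  proof (induction P rule: poly2_induct)
    case (add P Q)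
    have "P + Q - pC (ev (P + Q) (a, b)) = (P - pC (ev P (a, b))) + (Q - pC (ev Q (a, b)))"
      by (simp add: pC_simps)
    then show ?case using add is_idealD(2)[OF id] by metis
  next
    case (mult P Q)
    have "P * Q - pC (ev (P * Q) (a, b)) =
        P * (Q - pC (ev Q (a, b))) + pC (ev Q (a, b)) * (P - pC (ev P (a, b)))"
      by (simp add: pC_simps algebra_simps)
    then show ?case using mult is_idealD(2,3)[OF id] by metis
  qed (use ab is_idealD(1)[OF id] in auto)
  have "ev P (a, b) = 0" if "P \<in> M" for P
  proof -
    have "P - (P - pC (ev P (a, b))) \<in> M" using that key is_idealD(5)[OF id] by blast
    then show ?thesis using max_avoiding_const[OF M] by simp
  qed
  then have "ev f (a, b) = 0" using van JM by blast
  then have "f ^ 1 \<in> M" using key[of f] by (simp add: pC_simps)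
  then show False using M unfolding max_avoiding_def by blast
qed

section \<open>Regular functions on open subsets of the plane\<close>

definition zopen :: "(complex \<times> complex) set \<Rightarrow> bool" where
  "zopen S \<longleftrightarrow> (\<forall>z\<in>S. \<exists>Q. ev Q z \<noteq> 0 \<and> (\<forall>w. ev Q w \<noteq> 0 \<longrightarrow> w \<in> S))"

text \<open>The same \<open>Q\<close> is the denominator and cuts out the neighbourhood. Multiplying
  \<open>P\<close> and \<open>Q\<close> by a common factor shrinks the neighbourhood without
  changing the function; local representations are combined in this way throughout.\<close>

definition regular_on :: "(complex \<times> complex) set \<Rightarrow> (complex \<times> complex \<Rightarrow> complex) \<Rightarrow> bool" where
  "regular_on S \<phi> \<longleftrightarrow>
     (\<forall>z\<in>S. \<exists>P Q. ev Q z \<noteq> 0 \<and> (\<forall>w. ev Q w \<noteq> 0 \<longrightarrow> w \<in> S \<and> \<phi> w = ev P w / ev Q w))"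

lemma regular_onE:
  assumes "regular_on S \<phi>" "z \<in> S"
  obtains P Q where "ev Q z \<noteq> 0" "\<And>w. ev Q w \<noteq> 0 \<Longrightarrow> w \<in> S" "\<And>w. ev Q w \<noteq> 0 \<Longrightarrow> \<phi> w = ev P w / ev Q w"
  using assms unfolding regular_on_def by blast

lemma zopenD: "zopen S \<Longrightarrow> z \<in> S \<Longrightarrow> \<exists>Q. ev Q z \<noteq> 0 \<and> {w. ev Q w \<noteq> 0} \<subseteq> S"
  unfolding zopen_def by blast

lemma zopen_Int: "zopen S \<Longrightarrow> zopen S' \<Longrightarrow> zopen (S \<inter> S')"
  unfolding zopen_def
proof safe
  fix z assume *: "\<forall>z\<in>S. \<exists>Q. ev Q z \<noteq> 0 \<and> (\<forall>w. ev Q w \<noteq> 0 \<longrightarrow> w \<in> S)"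
    "\<forall>z\<in>S'. \<exists>Q. ev Q z \<noteq> 0 \<and> (\<forall>w. ev Q w \<noteq> 0 \<longrightarrow> w \<in> S')" "z \<in> S" "z \<in> S'"
  then obtain Q Q' where "ev Q z \<noteq> 0" "\<And>w. ev Q w \<noteq> 0 \<Longrightarrow> w \<in> S"
    "ev Q' z \<noteq> 0" "\<And>w. ev Q' w \<noteq> 0 \<Longrightarrow> w \<in> S'" by metis
  then show "\<exists>Q. ev Q z \<noteq> 0 \<and> (\<forall>w. ev Q w \<noteq> 0 \<longrightarrow> w \<in> S \<inter> S')"
    by (intro exI[of _ "Q * Q'"]) auto
qed

lemma zopen_principal: "zopen {z. ev f z \<noteq> 0}"
  unfolding zopen_def by auto

lemma zopen_UNIV: "zopen UNIV"
  unfolding zopen_def by (auto intro: exI[of _ 1])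

lemma regular_on_rational:
  assumes "zopen S" "\<And>z. z \<in> S \<Longrightarrow> ev Q z \<noteq> 0" "\<And>z. z \<in> S \<Longrightarrow> \<phi> z = ev P z / ev Q z"
  shows "regular_on S \<phi>"
  unfolding regular_on_def
proof
  fix z assume z: "z \<in> S"
  then obtain R where "ev R z \<noteq> 0" "\<And>w. ev R w \<noteq> 0 \<Longrightarrow> w \<in> S" using assms(1) by (auto simp: zopen_def)
  then show "\<exists>P Q. ev Q z \<noteq> 0 \<and> (\<forall>w. ev Q w \<noteq> 0 \<longrightarrow> w \<in> S \<and> \<phi> w = ev P w / ev Q w)"
    using assms(2,3) z by (intro exI[of _ "P * R"] exI[of _ "Q * R"]) auto
qed

lemma regular_on_ev: "zopen S \<Longrightarrow> regular_on S (ev P)"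
  by (rule regular_on_rational[of _ 1]) auto

lemma regular_on_const: "zopen S \<Longrightarrow> regular_on S (\<lambda>_. c)"
  by (rule regular_on_rational[of _ 1 _ "pC c"]) auto

lemma regular_on_subset:
  assumes "regular_on S \<phi>" "zopen S'" "S' \<subseteq> S"
  shows "regular_on S' \<phi>"
  unfolding regular_on_def
proof
  fix z assume z: "z \<in> S'"
  then obtain R where R: "ev R z \<noteq> 0" "\<And>w. ev R w \<noteq> 0 \<Longrightarrow> w \<in> S'" using assms(2) by (auto simp: zopen_def)
  obtain P Q where "ev Q z \<noteq> 0" "\<And>w. ev Q w \<noteq> 0 \<Longrightarrow> \<phi> w = ev P w / ev Q w"
    using regular_onE[OF assms(1)] assms(3) z by (metis subsetD)
  then show "\<exists>P Q. ev Q z \<noteq> 0 \<and> (\<forall>w. ev Q w \<noteq> 0 \<longrightarrow> w \<in> S' \<and> \<phi> w = ev P w / ev Q w)"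
    using R by (intro exI[of _ "P * R"] exI[of _ "Q * R"]) auto
qed

lemma regular_on_local:
  assumes "\<And>z. z \<in> S \<Longrightarrow> \<exists>S'. z \<in> S' \<and> S' \<subseteq> S \<and> regular_on S' \<phi>"
  shows "regular_on S \<phi>"
  unfolding regular_on_def
proof
  fix z assume "z \<in> S"
  from assms[OF this] obtain S' where S': "z \<in> S'" "S' \<subseteq> S" "regular_on S' \<phi>" by blast
  then obtain P Q where "ev Q z \<noteq> 0" "\<And>w. ev Q w \<noteq> 0 \<Longrightarrow> w \<in> S' \<and> \<phi> w = ev P w / ev Q w"
    by (metis regular_onE)
  then show "\<exists>P Q. ev Q z \<noteq> 0 \<and> (\<forall>w. ev Q w \<noteq> 0 \<longrightarrow> w \<in> S \<and> \<phi> w = ev P w / ev Q w)"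
    using S'(2) by blast
qed

lemma regular_on_cong:
  assumes "\<And>z. z \<in> S \<Longrightarrow> \<phi> z = \<psi> z"
  shows "regular_on S \<phi> \<longleftrightarrow> regular_on S \<psi>"
proof -
  have "regular_on S \<psi>" if "regular_on S \<phi>" "\<And>z. z \<in> S \<Longrightarrow> \<phi> z = \<psi> z" for \<phi> \<psi>
    unfolding regular_on_def
  proof
    fix z assume "z \<in> S"
    with that(1) obtain P Q where "ev Q z \<noteq> 0" "\<And>w. ev Q w \<noteq> 0 \<Longrightarrow> w \<in> S" "\<And>w. ev Q w \<noteq> 0 \<Longrightarrow> \<phi> w = ev P w / ev Q w"
      by (rule regular_onE) blast
    with that(2) show "\<exists>P Q. ev Q z \<noteq> 0 \<and> (\<forall>w. ev Q w \<noteq> 0 \<longrightarrow> w \<in> S \<and> \<psi> w = ev P w / ev Q w)"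
      by metis
  qed
  then show ?thesis using assms by metis
qed

lemma regular_on_binary:
  assumes "regular_on S \<phi>" "regular_on S \<psi>"
    and op: "\<And>P Q P' Q'. \<exists>R. \<forall>w. ev Q w \<noteq> 0 \<longrightarrow> ev Q' w \<noteq> 0 \<longrightarrow>
      f (ev P w / ev Q w) (ev P' w / ev Q' w) = ev R w / (ev Q w * ev Q' w)"
  shows "regular_on S (\<lambda>z. f (\<phi> z) (\<psi> z))"
  unfolding regular_on_def
proof
  fix z assume "z \<in> S"
  obtain P Q where
    "ev Q z \<noteq> 0" "\<And>w. ev Q w \<noteq> 0 \<Longrightarrow> w \<in> S \<and> \<phi> w = ev P w / ev Q w"
    using regular_onE[OF assms(1) \<open>z \<in> S\<close>] by metis
  moreover obtain P' Q' where
    "ev Q' z \<noteq> 0" "\<And>w. ev Q' w \<noteq> 0 \<Longrightarrow> \<psi> w = ev P' w / ev Q' w"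
    using regular_onE[OF assms(2) \<open>z \<in> S\<close>] by metis
  moreover obtain R where "\<And>w. ev Q w \<noteq> 0 \<Longrightarrow> ev Q' w \<noteq> 0 \<Longrightarrow>
      f (ev P w / ev Q w) (ev P' w / ev Q' w) = ev R w / (ev Q w * ev Q' w)" using op by metis
  ultimately show "\<exists>P Q. ev Q z \<noteq> 0 \<and>
      (\<forall>w. ev Q w \<noteq> 0 \<longrightarrow> w \<in> S \<and> f (\<phi> w) (\<psi> w) = ev P w / ev Q w)"
    by (intro exI[of _ R] exI[of _ "Q * Q'"]) auto
qed

lemma regular_on_add: "regular_on S \<phi> \<Longrightarrow> regular_on S \<psi> \<Longrightarrow> regular_on S (\<lambda>z. \<phi> z + \<psi> z)"
  by (rule regular_on_binary, assumption+)
    (rule_tac x = "P * Q' + P' * Q" in exI, auto simp: field_simps)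

lemma regular_on_diff: "regular_on S \<phi> \<Longrightarrow> regular_on S \<psi> \<Longrightarrow> regular_on S (\<lambda>z. \<phi> z - \<psi> z)"
  by (rule regular_on_binary, assumption+)
    (rule_tac x = "P * Q' - P' * Q" in exI, auto simp: field_simps)

lemma regular_on_mult: "regular_on S \<phi> \<Longrightarrow> regular_on S \<psi> \<Longrightarrow> regular_on S (\<lambda>z. \<phi> z * \<psi> z)"
  by (rule regular_on_binary, assumption+) (rule_tac x = "P * P'" in exI, auto simp: field_simps)

lemma regular_on_sum:
  "zopen S \<Longrightarrow> (\<And>i. i \<in> A \<Longrightarrow> regular_on S (\<phi> i)) \<Longrightarrow> regular_on S (\<lambda>z. \<Sum>i\<in>A. \<phi> i z)"
  by (induction A rule: infinite_finite_induct) (auto intro: regular_on_const regular_on_add)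

text \<open>The numerator of a local representation vanishes wherever \<open>Q * D\<close> does not,
  hence is the zero polynomial.\<close>

lemma regular_on_eq_0_dense:
  assumes "regular_on S \<phi>" "D \<noteq> 0" "\<And>w. w \<in> S \<Longrightarrow> ev D w \<noteq> 0 \<Longrightarrow> \<phi> w = 0" "z \<in> S"
  shows "\<phi> z = 0"
proof -
  obtain P Q where PQ: "ev Q z \<noteq> 0" "\<And>w. ev Q w \<noteq> 0 \<Longrightarrow> w \<in> S \<and> \<phi> w = ev P w / ev Q w"
    using regular_onE[OF assms(1,4)] by metis
  have "P = 0"
  proof (rule ev_eq_on_dense)
    show "Q * D \<noteq> 0" using PQ(1) assms(2) by auto
    fix w assume "ev (Q * D) w \<noteq> 0"
    then show "ev P w = ev 0 w" using PQ(2)[of w] assms(3)[of w] by auto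
  qed
  then show ?thesis using PQ by auto
qed

text \<open>The polynomials \<open>h\<close> for which \<open>h * \<phi>\<close> is a polynomial on
  this set form an ideal. It contains every local denominator, so its common zeros lie in
  \<open>f = 0\<close>, and the Nullstellensatz puts a power of \<open>f\<close> into it.\<close>

lemma regular_on_principal:
  assumes "regular_on {z. ev f z \<noteq> 0} \<phi>"
  shows "\<exists>P n. \<forall>z. ev f z \<noteq> 0 \<longrightarrow> \<phi> z = ev P z / ev f z ^ n"
proof -
  define J where "J = {h. \<exists>P. \<forall>z. ev f z \<noteq> 0 \<longrightarrow> ev h z * \<phi> z = ev P z}"
  have "is_ideal J"
    unfolding is_ideal_def
  proof (intro conjI ballI allI)
    show "0 \<in> J" by (auto simp: J_def intro: exI[of _ 0])
    fix a assume "a \<in> J"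
    then obtain P where P: "\<And>z. ev f z \<noteq> 0 \<Longrightarrow> ev a z * \<phi> z = ev P z" by (auto simp: J_def)
    show "r * a \<in> J" for r using P by (auto simp: J_def algebra_simps intro!: exI[of _ "r * P"])
    fix b assume "b \<in> J"
    then obtain P' where "\<And>z. ev f z \<noteq> 0 \<Longrightarrow> ev b z * \<phi> z = ev P' z" by (auto simp: J_def)
    with P show "a + b \<in> J" by (auto simp: J_def algebra_simps intro!: exI[of _ "P + P'"])
  qed
  moreover have "ev f z = 0" if van: "\<And>P. P \<in> J \<Longrightarrow> ev P z = 0" for z
  proof (rule ccontr)
    assume "ev f z \<noteq> 0"
    then have "z \<in> {z. ev f z \<noteq> 0}" by simp
    from assms this obtain P Q where PQ: "ev Q z \<noteq> 0" "\<And>w. ev Q w \<noteq> 0 \<Longrightarrow> \<phi> w = ev P w / ev Q w"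
      by (rule regular_onE) blast
    \<comment> \<open>At a point \<open>w\<close> where \<open>Q\<close> may vanish a second
      representation \<open>P' / Q'\<close> is valid. Cross multiplication gives a polynomial
      identity on a dense set, which therefore holds at \<open>w\<close> as well.\<close>
    have "Q \<in> J"
      unfolding J_def
    proof (intro CollectI exI allI impI)
      fix w assume "ev f w \<noteq> 0"
      then have "w \<in> {z. ev f z \<noteq> 0}" by simp
      from assms this obtain P' Q' where PQ': "ev Q' w \<noteq> 0" "\<And>w. ev Q' w \<noteq> 0 \<Longrightarrow> \<phi> w = ev P' w / ev Q' w"
        by (rule regular_onE) blast
      have "P * Q' = P' * Q"
      proof (rule ev_eq_on_dense)
        show "Q * Q' \<noteq> 0" using PQ PQ' by auto
        fix x assume "ev (Q * Q') x \<noteq> 0"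
        then show "ev (P * Q') x = ev (P' * Q) x" using PQ(2)[of x] PQ'(2)[of x]
          by (auto simp: field_simps)
      qed
      from arg_cong[OF this, of "\<lambda>p. ev p w"] have "ev Q w * \<phi> w * ev Q' w = ev P w * ev Q' w"
        using PQ'(1) PQ'(2)[of w] by (simp add: mult_ac)
      then show "ev Q w * \<phi> w = ev P w" using PQ'(1) by simp
    qed
    then show False using van PQ(1) by blast
  qed
  ultimately obtain n where "f ^ n \<in> J" using nullstellensatz[of J f] by blast
  then obtain P where P: "\<And>z. ev f z \<noteq> 0 \<Longrightarrow> ev f z ^ n * \<phi> z = ev P z" by (auto simp: J_def)
  have "\<phi> z = ev P z / ev f z ^ n" if "ev f z \<noteq> 0" for z using P[OF that] that by (simp add: field_simps)
  then show ?thesis by blast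
qed

section \<open>Partitions of unity and vanishing of first cohomology on the plane\<close>

text \<open>The ideal generated by the \<open>n\<close>-th powers has no common zero, so the
  Nullstellensatz for the polynomial \<open>1\<close> applies to it.\<close>

lemma partition_of_unity:
  assumes "\<And>z. \<exists>f\<in>F. ev f z \<noteq> 0"
  shows "\<exists>A g. finite A \<and> A \<subseteq> F \<and> (\<Sum>f\<in>A. g f * f ^ n) = 1"
proof -
  define J where "J = {h. \<exists>A g. finite A \<and> A \<subseteq> F \<and> h = (\<Sum>f\<in>A. g f * f ^ n)}"
  have "is_ideal J"
    unfolding is_ideal_def
  proof (intro conjI ballI allI)
    show "0 \<in> J" unfolding J_def by (intro CollectI exI[of _ "{}"]) auto
    fix a assume "a \<in> J"
    then obtain A g where A: "finite A" "A \<subseteq> F" "a = (\<Sum>f\<in>A. g f * f ^ n)" by (auto simp: J_def)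
    have "r * a = (\<Sum>f\<in>A. (r * g f) * f ^ n)" for r by (simp add: A sum_distrib_left mult.assoc)
    then show "r * a \<in> J" for r using A unfolding J_def
      by (intro CollectI exI[of _ A] exI[of _ "\<lambda>f. r * g f"]) simp
    fix b assume "b \<in> J"
    then obtain B h where B: "finite B" "B \<subseteq> F" "b = (\<Sum>f\<in>B. h f * f ^ n)" by (auto simp: J_def)
    have "a = (\<Sum>f\<in>A \<union> B. (if f \<in> A then g f else 0) * f ^ n)"
      unfolding A(3) using A B by (intro sum.mono_neutral_cong_left) auto
    moreover have "b = (\<Sum>f\<in>A \<union> B. (if f \<in> B then h f else 0) * f ^ n)"
      unfolding B(3) using A B by (intro sum.mono_neutral_cong_left) auto
    ultimately have "a + b = (\<Sum>f\<in>A \<union> B. ((if f \<in> A then g f else 0) + (if f \<in> B then h f else 0)) * f ^ n)"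
      by (simp only: sum.distrib[symmetric] distrib_right)
    moreover have "finite (A \<union> B)" "A \<union> B \<subseteq> F" using A B by auto
    ultimately show "a + b \<in> J" unfolding J_def by (intro CollectI exI conjI)
  qed
  moreover have "ev 1 z = 0" if van: "\<And>P. P \<in> J \<Longrightarrow> ev P z = 0" for z
  proof -
    obtain f where f: "f \<in> F" "ev f z \<noteq> 0" using assms by blast
    have "f ^ n \<in> J" unfolding J_def using f by (intro CollectI exI[of _ "{f}"] exI[of _ "\<lambda>_. 1"]) auto
    then show ?thesis using van[of "f ^ n"] f(2) by simp
  qed
  ultimately obtain k where "1 ^ k \<in> J" using nullstellensatz[of J 1] by blast
  then have "1 \<in> J" by simp
  then show ?thesis by (auto simp: J_def)
qed

text \<open>For a finite cover by principal open sets: \<open>b\<^sub>j = \<Sum>\<^sub>k g\<^sub>k f\<^sub>k\<^sup>N c\<^sub>k\<^sub>j\<close>, where \<open>\<Sum>\<^sub>k g\<^sub>k f\<^sub>k\<^sup>N = 1\<close>.\<close>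

lemma cech_vanishing_finite:
  assumes fin: "finite A" and cov: "\<And>z. \<exists>f\<in>A. ev f z \<noteq> 0"
    and reg: "\<And>f h. f \<in> A \<Longrightarrow> h \<in> A \<Longrightarrow> regular_on {z. ev (f * h) z \<noteq> 0} (c f h)"
    and coc: "\<And>f h k z. f \<in> A \<Longrightarrow> h \<in> A \<Longrightarrow> k \<in> A \<Longrightarrow> ev f z \<noteq> 0 \<Longrightarrow> ev h z \<noteq> 0 \<Longrightarrow> ev k z \<noteq> 0 \<Longrightarrow>
       c f h z + c h k z = c f k z"
  shows "\<exists>b. (\<forall>f\<in>A. regular_on {z. ev f z \<noteq> 0} (b f)) \<and>
     (\<forall>f\<in>A. \<forall>h\<in>A. \<forall>z. ev f z \<noteq> 0 \<longrightarrow> ev h z \<noteq> 0 \<longrightarrow> c f h z = b h z - b f z)"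
proof -
  have "\<forall>f\<in>A. \<forall>h\<in>A. \<exists>P n. \<forall>z. ev (f * h) z \<noteq> 0 \<longrightarrow> c f h z = ev P z / ev (f * h) z ^ n"
    by (intro ballI regular_on_principal reg)
  then obtain P n where Pn: "\<forall>f\<in>A. \<forall>h\<in>A. \<forall>z. ev (f * h) z \<noteq> 0 \<longrightarrow>
      c f h z = ev (P f h) z / ev (f * h) z ^ n f h" by metis
  \<comment> \<open>The common exponent strictly exceeds every \<open>n f h\<close>. The numerator
    \<open>H f h\<close> of \<open>f ^ N * h ^ N * c f h\<close> thus keeps a factor
    \<open>f * h\<close> and vanishes where \<open>f\<close> does.\<close>
  define N where "N = Suc (\<Sum>f\<in>A. \<Sum>h\<in>A. n f h)"
  have nN: "n f h < N" if "f \<in> A" "h \<in> A" for f h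
  proof -
    have "n f h \<le> (\<Sum>h\<in>A. n f h)" using that fin by (intro member_le_sum) auto
    also have "\<dots> \<le> (\<Sum>f\<in>A. \<Sum>h\<in>A. n f h)" using that fin by (intro member_le_sum) auto
    finally show ?thesis by (simp add: N_def)
  qed
  define H where "H = (\<lambda>f h. P f h * (f * h) ^ (N - n f h))"
  have H: "ev f z ^ N * ev h z ^ N * c f h z = ev (H f h) z"
    if "f \<in> A" "h \<in> A" "ev f z \<noteq> 0" "ev h z \<noteq> 0" for f h z
  proof -
    have "(ev f z * ev h z) ^ N = (ev f z * ev h z) ^ n f h * (ev f z * ev h z) ^ (N - n f h)"
      using nN[OF that(1,2)] by (simp flip: power_add)
    then show ?thesis using Pn[rule_format, OF that(1,2), of z] that(3,4) by (simp add: H_def power_mult_distrib)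
  qed
  have H0: "ev (H f h) z = 0" if "f \<in> A" "h \<in> A" "ev f z = 0" for f h z
    using nN[OF that(1,2)] that(3) by (simp add: H_def)
  from partition_of_unity[of A N] cov obtain B g where
    B: "B \<subseteq> A" "(\<Sum>f\<in>B. g f * f ^ N) = 1" by blast
  have pu: "(\<Sum>f\<in>B. ev (g f) z * ev f z ^ N) = 1" for z
    using arg_cong[OF B(2), of "\<lambda>p. ev p z"] by simp
  define b where "b = (\<lambda>h z. ev (\<Sum>k\<in>B. g k * H k h) z / ev (h ^ N) z)"
  have "regular_on {z. ev f z \<noteq> 0} (b f)" for f
    by (rule regular_on_rational[OF zopen_principal, of _ "f ^ N" _ "\<Sum>k\<in>B. g k * H k f"]) (auto simp: b_def)
  moreover have "c f h z = b h z - b f z"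
    if fh: "f \<in> A" "h \<in> A" "ev f z \<noteq> 0" "ev h z \<noteq> 0" for f h z
  proof -
    have "b h z - b f z = (\<Sum>k\<in>B. ev (g k) z * (ev (H k h) z / ev h z ^ N - ev (H k f) z / ev f z ^ N))"
      by (simp add: b_def sum_divide_distrib sum_subtractf[symmetric] algebra_simps)
    also have "\<dots> = (\<Sum>k\<in>B. ev (g k) z * ev k z ^ N * c f h z)"
    proof (rule sum.cong[OF refl])
      fix k assume "k \<in> B"
      then have k: "k \<in> A" using B by auto
      show "ev (g k) z * (ev (H k h) z / ev h z ^ N - ev (H k f) z / ev f z ^ N) =
        ev (g k) z * ev k z ^ N * c f h z"
      proof (cases "ev k z = 0")
        case True
        then show ?thesis using H0 k fh by (simp add: N_def)
      next
        case False
        have "c k f z + c f h z = c k h z" using coc k fh False by blast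
        then have e: "c f h z = c k h z - c k f z" by (simp add: algebra_simps)
        then show ?thesis
          unfolding H[OF k fh(1) False fh(3), symmetric] H[OF k fh(2) False fh(4), symmetric]
          unfolding e using fh by (simp add: field_simps)
      qed
    qed
    also have "\<dots> = c f h z" by (simp add: sum_distrib_right[symmetric] pu)
    finally show ?thesis by simp
  qed
  ultimately show ?thesis by blast
qed

text \<open>Finitely many principal open sets, each inside a member \<open>S (\<pi> f)\<close> of
  the cover, already cover the plane. The solution \<open>b\<close> found for them is carried back
  as \<open>b f + c (\<pi> f) q\<close>, which by the cocycle relation does not depend on
  \<open>f\<close>.\<close>

theorem cech_vanishing_plane:
  assumes cov: "\<And>z. \<exists>p\<in>I. z \<in> S p" and op: "\<And>p. p \<in> I \<Longrightarrow> zopen (S p)"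
    and reg: "\<And>p q. p \<in> I \<Longrightarrow> q \<in> I \<Longrightarrow> regular_on (S p \<inter> S q) (c p q)"
    and coc: "\<And>p q r z. p \<in> I \<Longrightarrow> q \<in> I \<Longrightarrow> r \<in> I \<Longrightarrow> z \<in> S p \<inter> S q \<inter> S r \<Longrightarrow>
       c p q z + c q r z = c p r z"
  shows "\<exists>b. (\<forall>p\<in>I. regular_on (S p) (b p)) \<and>
     (\<forall>p\<in>I. \<forall>q\<in>I. \<forall>z\<in>S p \<inter> S q. c p q z = b q z - b p z)"
proof -
  define F where "F = {f. \<exists>p\<in>I. {z. ev f z \<noteq> 0} \<subseteq> S p}"
  have "\<exists>f\<in>F. ev f z \<noteq> 0" for z
  proof -
    from cov[of z] obtain p where p: "p \<in> I" "z \<in> S p" by (elim bexE)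
    from zopenD[OF op[OF p(1)] p(2)] obtain f where f: "ev f z \<noteq> 0" "{w. ev f w \<noteq> 0} \<subseteq> S p" by (elim exE conjE)
    from p(1) f(2) have "f \<in> F" unfolding F_def by (intro CollectI bexI)
    with f(1) show ?thesis by (intro bexI)
  qed
  from partition_of_unity[OF this, of 1] obtain A g where
    A: "finite A" "A \<subseteq> F" "(\<Sum>f\<in>A. g f * f ^ 1) = 1" by blast
  have covA: "\<exists>f\<in>A. ev f z \<noteq> 0" for z
  proof (rule ccontr)
    assume "\<not> ?thesis"
    then have "ev (\<Sum>f\<in>A. g f * f ^ 1) z = 0" by simp
    then have "ev 1 z = 0" unfolding A(3) .
    then show False by simp
  qed
  have "\<exists>p. p \<in> I \<and> {z. ev f z \<noteq> 0} \<subseteq> S p" if "f \<in> A" for f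
    using subsetD[OF A(2) that] unfolding F_def by (elim CollectE bexE) (intro exI conjI)
  then have "\<forall>f\<in>A. \<exists>p. p \<in> I \<and> {z. ev f z \<noteq> 0} \<subseteq> S p" by (intro ballI)
  then obtain \<pi> where "\<forall>f\<in>A. \<pi> f \<in> I \<and> {z. ev f z \<noteq> 0} \<subseteq> S (\<pi> f)" by (rule bchoice[THEN exE])
  then have \<pi>1: "\<And>f. f \<in> A \<Longrightarrow> \<pi> f \<in> I" and \<pi>2': "\<And>f. f \<in> A \<Longrightarrow> {z. ev f z \<noteq> 0} \<subseteq> S (\<pi> f)"
    by simp_all
  have \<pi>2: "z \<in> S (\<pi> f)" if "f \<in> A" "ev f z \<noteq> 0" for f z
    by (rule subsetD[OF \<pi>2'[OF that(1)]]) (simp add: that(2))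
  have "\<exists>b. (\<forall>f\<in>A. regular_on {z. ev f z \<noteq> 0} (b f)) \<and>
     (\<forall>f\<in>A. \<forall>h\<in>A. \<forall>z. ev f z \<noteq> 0 \<longrightarrow> ev h z \<noteq> 0 \<longrightarrow> c (\<pi> f) (\<pi> h) z = b h z - b f z)"
  proof (rule cech_vanishing_finite[OF A(1) covA])
    fix f h assume fh: "f \<in> A" "h \<in> A"
    show "regular_on {z. ev (f * h) z \<noteq> 0} (c (\<pi> f) (\<pi> h))"
      by (rule regular_on_subset[OF reg zopen_principal]) (auto intro: fh \<pi>1 \<pi>2)
  next
    fix f h k z assume "f \<in> A" "h \<in> A" "k \<in> A" "ev f z \<noteq> 0" "ev h z \<noteq> 0" "ev k z \<noteq> 0"
    then show "c (\<pi> f) (\<pi> h) z + c (\<pi> h) (\<pi> k) z = c (\<pi> f) (\<pi> k) z"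
      by (intro coc \<pi>1 IntI \<pi>2)
  qed
  then obtain b where b: "\<forall>f\<in>A. regular_on {z. ev f z \<noteq> 0} (b f)"
    "\<forall>f\<in>A. \<forall>h\<in>A. \<forall>z. ev f z \<noteq> 0 \<longrightarrow> ev h z \<noteq> 0 \<longrightarrow> c (\<pi> f) (\<pi> h) z = b h z - b f z"
    by (elim exE conjE)
  obtain \<alpha> where \<alpha>: "\<And>z. \<alpha> z \<in> A" "\<And>z. ev (\<alpha> z) z \<noteq> 0" using covA by metis
  \<comment> \<open>\<open>\<alpha> z\<close> is an arbitrary choice at each point. Regularity
    survives because near \<open>z\<close> the fixed member \<open>\<alpha> z\<close> gives the same
    values by \<open>indep\<close>.\<close>
  define b' where "b' = (\<lambda>q z. b (\<alpha> z) z + c (\<pi> (\<alpha> z)) q z)"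
  have indep: "b' q z = b f z + c (\<pi> f) q z" if "q \<in> I" "z \<in> S q" "f \<in> A" "ev f z \<noteq> 0" for q z f
  proof -
    have "c (\<pi> f) (\<pi> (\<alpha> z)) z + c (\<pi> (\<alpha> z)) q z = c (\<pi> f) q z"
      by (intro coc IntI that \<pi>1 \<pi>2 \<alpha>)
    moreover have "c (\<pi> f) (\<pi> (\<alpha> z)) z = b (\<alpha> z) z - b f z" using b(2) that \<alpha> by metis
    ultimately show ?thesis by (simp add: b'_def algebra_simps)
  qed
  have "regular_on (S q) (b' q)" if q: "q \<in> I" for q
  proof (rule regular_on_local)
    fix z assume z: "z \<in> S q"
    define S' where "S' = {w. ev (\<alpha> z) w \<noteq> 0} \<inter> S q"
    have S': "zopen S'" unfolding S'_def by (intro zopen_Int zopen_principal op q)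
    have sub: "S' \<subseteq> {w. ev (\<alpha> z) w \<noteq> 0}" "S' \<subseteq> S (\<pi> (\<alpha> z)) \<inter> S q"
      using \<pi>2'[OF \<alpha>(1)[of z]] unfolding S'_def by blast+
    have "regular_on S' (\<lambda>w. b (\<alpha> z) w + c (\<pi> (\<alpha> z)) q w)"
      by (intro regular_on_add regular_on_subset[OF b(1)[rule_format] S']
          regular_on_subset[OF reg S'] \<alpha> \<pi>1 q sub)
    moreover have "b' q w = b (\<alpha> z) w + c (\<pi> (\<alpha> z)) q w" if "w \<in> S'" for w
      using that unfolding S'_def by (intro indep q \<alpha>(1)) simp_all
    ultimately have "regular_on S' (b' q)" by (subst regular_on_cong)
    moreover have "z \<in> S'" using z \<alpha>(2)[of z] unfolding S'_def by simp
    moreover have "S' \<subseteq> S q" using sub by simp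
    ultimately show "\<exists>S'. z \<in> S' \<and> S' \<subseteq> S q \<and> regular_on S' (b' q)"
      by (intro exI[of _ S'] conjI)
  qed
  moreover have "c p q z = b' q z - b' p z" if "p \<in> I" "q \<in> I" "z \<in> S p \<inter> S q" for p q z
  proof -
    have "c (\<pi> (\<alpha> z)) p z + c p q z = c (\<pi> (\<alpha> z)) q z"
      using that by (intro coc IntI \<pi>1 \<pi>2 \<alpha>) simp_all
    then show ?thesis by (simp add: b'_def algebra_simps)
  qed
  ultimately show ?thesis by (intro exI[of _ b'] conjI ballI)
qed

section \<open>Charts of the resolution\<close>

text \<open>The conic of lines on the cone, parametrised by \<open>(1, u, u^2)\<close>; the reversed
  vector reaches the one remaining line. The Boolean names the chart from here on.\<close>

definition dir :: "bool \<Rightarrow> complex \<Rightarrow> complex^3" where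
  "dir b u = (if b then vector [u\<^sup>2, u, 1] else vector [1, u, u\<^sup>2])"

text \<open>The blow-up of the cone is the tautological line bundle over the conic: the first
  coordinate is the point of the conic, the second the coordinate along the line with respect to the
  generator \<open>dir b u\<close>.\<close>

definition psi :: "bool \<Rightarrow> complex \<times> complex \<Rightarrow> (complex^3) \<times> (complex^3) set" where
  "psi b z = (snd z *s dir b (fst z), proj_point (dir b (fst z)))"

definition lead :: "bool \<Rightarrow> 3" where "lead b = (if b then 3 else 1)"

abbreviation "Y \<equiv> topspace A1_resolution"

lemma dir_nth [simp]:
  "dir b u $ 2 = u" "dir b u $ lead b = 1"
  "dir False u $ 1 = 1" "dir False u $ 3 = u\<^sup>2" "dir True u $ 1 = u\<^sup>2" "dir True u $ 3 = 1"
  by (simp_all add: dir_def lead_def)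

lemma dir_nonzero [simp]: "dir b u \<noteq> 0"
  using dir_nth(2)[of b u] by (metis zero_index zero_neq_one)

lemma dir_flip: "u \<noteq> 0 \<Longrightarrow> dir b u = u\<^sup>2 *s dir (\<not> b) (1 / u)"
  by (cases b) (simp_all add: vec_eq_iff forall_3 power2_eq_square)

lemma proj_point_smult: "a \<noteq> 0 \<Longrightarrow> proj_point (a *s y) = proj_point y"
  unfolding proj_point_def
proof safe
  fix c
  show "c *s (a *s y) \<in> range (\<lambda>a. a *s y)" unfolding vector_smult_assoc by (rule rangeI)
  assume "a \<noteq> 0"
  then have "c *s y = (c / a) *s (a *s y)" by (simp add: vector_smult_assoc)
  then show "c *s y \<in> range (\<lambda>c. c *s (a *s y))" by blast
qed

lemma proj_point_eqD:
  assumes "proj_point y = proj_point y'" "y' \<noteq> 0"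
  shows "\<exists>a. a \<noteq> 0 \<and> y' = a *s y"
proof -
  have "y' = 1 *s y'" by simp
  then have "y' \<in> proj_point y'" unfolding proj_point_def by blast
  then obtain a where "y' = a *s y" using assms(1) unfolding proj_point_def by auto
  then show ?thesis using assms(2) by (intro exI[of _ a]) auto
qed

text \<open>The generator of the line changes by the factor \<open>u^2\<close>
  (\<open>dir_flip\<close>), so the coordinate along the line is multiplied by it. The exponent 2 is
  the degree of the conic.\<close>

lemma psi_flip: "fst z \<noteq> 0 \<Longrightarrow> psi b z = psi (\<not> b) (1 / fst z, (fst z)\<^sup>2 * snd z)"
  by (simp add: psi_def dir_flip[of "fst z" b] proj_point_smult vector_smult_assoc mult.commute)

lemma psi_inj: "psi b z = psi b w \<longleftrightarrow> z = w"
proof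
  assume eq: "psi b z = psi b w"
  then obtain a where a: "dir b (fst w) = a *s dir b (fst z)"
    using proj_point_eqD[of "dir b (fst z)" "dir b (fst w)"] by (auto simp: psi_def)
  from arg_cong[OF this, of "\<lambda>x. x $ lead b"] have "a = 1" by simp
  with arg_cong[OF a, of "\<lambda>x. x $ 2"] have "fst w = fst z" by simp
  moreover have "snd z *s dir b (fst z) = snd w *s dir b (fst w)" using eq by (simp add: psi_def)
  from arg_cong[OF this, of "\<lambda>x. x $ lead b"] have "snd z = snd w" by simp
  ultimately show "z = w" by (simp add: prod_eq_iff)
qed simp

lemma psi_overlap: "psi b z \<in> range (psi (\<not> b)) \<longleftrightarrow> fst z \<noteq> 0"
proof
  assume "psi b z \<in> range (psi (\<not> b))"
  then obtain w where "psi b z = psi (\<not> b) w" by blast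
  then obtain a where a: "dir (\<not> b) (fst w) = a *s dir b (fst z)"
    using proj_point_eqD[of "dir b (fst z)" "dir (\<not> b) (fst w)"] by (auto simp: psi_def)
  show "fst z \<noteq> 0"
  proof
    assume "fst z = 0"
    with a have "dir (\<not> b) (fst w) $ lead (\<not> b) = 0"
      unfolding a by (cases b) (simp_all add: lead_def)
    then show False by simp
  qed
next
  assume "fst z \<noteq> 0"
  then show "psi b z \<in> range (psi (\<not> b))" using psi_flip by blast
qed

section \<open>Fibrewise homogeneous polynomials and their nonvanishing sets\<close>

lemma fibre_homogeneous_scale: "fibre_homogeneous d f \<Longrightarrow> f x (a *s y) = a ^ d * f x y"
  by (induction rule: fibre_homogeneous.induct) (simp_all add: algebra_simps power_add)

lemma fibre_homogeneous_power: "fibre_homogeneous n (\<lambda>x y. (y $ i) ^ n)"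
proof (induction n)
  case 0
  then show ?case using fibre_homogeneous.const[of 1] by simp
next
  case (Suc n)
  from fibre_homogeneous.mult[OF fibre_homogeneous.fibre_coord[of i] Suc] show ?case by simp
qed

lemma nonvanishing_iff:
  assumes "fibre_homogeneous d f" "y \<noteq> 0"
  shows "(x, proj_point y) \<in> nonvanishing f \<longleftrightarrow> f x y \<noteq> 0"
proof
  assume "(x, proj_point y) \<in> nonvanishing f"
  then obtain y' where "proj_point y = proj_point y'" "y' \<noteq> 0" "f x y' \<noteq> 0"
    unfolding nonvanishing_def by auto
  moreover from this obtain a where "y' = a *s y" using proj_point_eqD by blast
  ultimately show "f x y \<noteq> 0" using fibre_homogeneous_scale[OF assms(1)] by auto
qed (use assms in \<open>auto simp: nonvanishing_def\<close>)

lemma openin_nonvanishing: "fibre_homogeneous d f \<Longrightarrow> openin zariski (nonvanishing f)"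
  unfolding zariski_def by (rule topology_generated_by_Basis) blast

text \<open>A product of fibrewise homogeneous polynomials is again fibrewise homogeneous, so the
  generating sets are closed under intersection and form a base, not merely a subbase.\<close>

lemma zariski_base:
  assumes "openin zariski W" "p \<in> W"
  shows "\<exists>f d. fibre_homogeneous d f \<and> p \<in> nonvanishing f \<and> nonvanishing f \<subseteq> W"
proof -
  have "generate_topology_on {nonvanishing f | f d. fibre_homogeneous d f} W"
    using assms(1) unfolding zariski_def by (rule openin_topology_generated_by)
  then show ?thesis using assms(2)
  proof (induction)
    case (Int a b)
    then have "p \<in> a" "p \<in> b" by simp_all
    from Int.IH(1)[OF this(1)] Int.IH(2)[OF this(2)] obtain f d g e where
      fg: "fibre_homogeneous d f" "p \<in> nonvanishing f" "nonvanishing f \<subseteq> a"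
      "fibre_homogeneous e g" "p \<in> nonvanishing g" "nonvanishing g \<subseteq> b" by (elim exE conjE)
    have hom: "fibre_homogeneous (d + e) (\<lambda>x y. f x y * g x y)" using fg by (intro fibre_homogeneous.mult)
    have eq: "nonvanishing (\<lambda>x y. f x y * g x y) = nonvanishing f \<inter> nonvanishing g"
    proof (rule set_eqI)
      fix q :: "(complex^'a) \<times> (complex^'a) set"
      obtain x L where q: "q = (x, L)" by (cases q)
      show "q \<in> nonvanishing (\<lambda>x y. f x y * g x y) \<longleftrightarrow> q \<in> nonvanishing f \<inter> nonvanishing g"
      proof (cases "\<exists>y. y \<noteq> 0 \<and> L = proj_point y")
        case True
        then obtain y where y: "y \<noteq> 0" "L = proj_point y" by blast
        show ?thesis unfolding q y(2) Int_iff
          nonvanishing_iff[OF hom y(1)] nonvanishing_iff[OF fg(1) y(1)] nonvanishing_iff[OF fg(4) y(1)] by simp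
      next
        case False
        then show ?thesis unfolding q nonvanishing_def by blast
      qed
    qed
    show ?case
      by (intro exI[of _ "\<lambda>x y. f x y * g x y"] exI[of _ "d + e"] conjI hom) (use eq fg in blast)+
  next
    case (UN K)
    from UN.prems obtain k where k: "k \<in> K" "p \<in> k" by blast
    from UN.IH[OF this] obtain f d where "fibre_homogeneous d f" "p \<in> nonvanishing f" "nonvanishing f \<subseteq> k"
      by (elim exE conjE)
    with k(1) show ?case by (intro exI[of _ f] exI[of _ d] conjI) blast+
  next
    case (Basis s)
    then obtain f d where "s = nonvanishing f" "fibre_homogeneous d f" by blast
    with Basis.prems show ?case by (intro exI[of _ f] exI[of _ d] conjI) simp_all
  qed simp
qed

lemma fibre_homogeneous_chart:
  assumes "fibre_homogeneous d f"
  shows "\<exists>P. \<forall>z. f (snd z *s dir b (fst z)) (dir b (fst z)) = ev P z"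
proof -
  have coord: "\<exists>P. \<forall>z. dir b (fst z) $ i = ev P z" for i
  proof -
    consider "i = 1" | "i = 2" | "i = 3" using exhaust_3 by blast
    then show ?thesis
    proof cases
      case 1
      then show ?thesis by (cases b) (auto intro: exI[of _ "pU * pU"] exI[of _ 1] simp: power2_eq_square)
    next
      case 2
      then show ?thesis by (auto intro: exI[of _ pU])
    next
      case 3
      then show ?thesis by (cases b) (auto intro: exI[of _ "pU * pU"] exI[of _ 1] simp: power2_eq_square)
    qed
  qed
  show ?thesis using assms
  proof (induction)
    case (const a)
    then show ?case by (auto intro: exI[of _ "pC a"])
  next
    case (base_coord i)
    from coord[of i] obtain P where "\<And>z. dir b (fst z) $ i = ev P z" by blast
    then show ?case by (intro exI[of _ "pV * P"]) simp
  next
    case (fibre_coord i)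
    then show ?case using coord by simp
  next
    case (add d f g)
    then obtain P Q where "\<And>z. f (snd z *s dir b (fst z)) (dir b (fst z)) = ev P z"
      "\<And>z. g (snd z *s dir b (fst z)) (dir b (fst z)) = ev Q z" by metis
    then show ?case by (intro exI[of _ "P + Q"]) simp
  next
    case (mult d f e g)
    then obtain P Q where "\<And>z. f (snd z *s dir b (fst z)) (dir b (fst z)) = ev P z"
      "\<And>z. g (snd z *s dir b (fst z)) (dir b (fst z)) = ev Q z" by metis
    then show ?case by (intro exI[of _ "P * Q"]) simp
  qed
qed

text \<open>The inverse of restricting to a chart: \<open>y $ 2 / y $ lead b\<close> and
  \<open>x $ lead b\<close> are the two coordinates there, and the power of
  \<open>y $ lead b\<close> clears the denominators.\<close>

lemma homogenization:
  "\<exists>d f. fibre_homogeneous d f \<and>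
     (\<forall>x y. y $ lead b \<noteq> 0 \<longrightarrow> f x y = (y $ lead b) ^ d * ev P (y $ 2 / y $ lead b, x $ lead b))"
proof (induction P rule: poly2_induct)
  case (const c)
  show ?case by (intro exI[of _ 0] exI[of _ "\<lambda>x y. c"]) (simp add: fibre_homogeneous.const)
next
  case fst
  show ?case by (intro exI[of _ 1] exI[of _ "\<lambda>x y. y $ 2"]) (use fibre_homogeneous.fibre_coord in simp)
next
  case snd
  show ?case by (intro exI[of _ 0] exI[of _ "\<lambda>x y. x $ lead b"]) (simp add: fibre_homogeneous.base_coord)
next
  case (add P Q)
  then obtain d f e g where fg: "fibre_homogeneous d f" "fibre_homogeneous e g"
    "\<And>x y. y $ lead b \<noteq> 0 \<Longrightarrow> f x y = (y $ lead b) ^ d * ev P (y $ 2 / y $ lead b, x $ lead b)"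
    "\<And>x y. y $ lead b \<noteq> 0 \<Longrightarrow> g x y = (y $ lead b) ^ e * ev Q (y $ 2 / y $ lead b, x $ lead b)" by metis
  \<comment> \<open>Two summands of different degrees are brought to the same degree by powers of
    the leading coordinate.\<close>
  have "fibre_homogeneous (d + e) (\<lambda>x y. (y $ lead b) ^ d * g x y)"
    "fibre_homogeneous (e + d) (\<lambda>x y. (y $ lead b) ^ e * f x y)"
    by (intro fibre_homogeneous.mult fibre_homogeneous_power fg)+
  then have "fibre_homogeneous (d + e) (\<lambda>x y. (y $ lead b) ^ e * f x y + (y $ lead b) ^ d * g x y)"
    by (intro fibre_homogeneous.add) (simp_all add: add.commute)
  then show ?case
    by (intro exI[of _ "d + e"] exI[of _ "\<lambda>x y. (y $ lead b) ^ e * f x y + (y $ lead b) ^ d * g x y"])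
      (simp add: fg(3,4) power_add algebra_simps)
next
  case (mult P Q)
  then obtain d f e g where fg: "fibre_homogeneous d f" "fibre_homogeneous e g"
    "\<And>x y. y $ lead b \<noteq> 0 \<Longrightarrow> f x y = (y $ lead b) ^ d * ev P (y $ 2 / y $ lead b, x $ lead b)"
    "\<And>x y. y $ lead b \<noteq> 0 \<Longrightarrow> g x y = (y $ lead b) ^ e * ev Q (y $ 2 / y $ lead b, x $ lead b)" by metis
  from fibre_homogeneous.mult[OF fg(1,2)] show ?case
    by (intro exI[of _ "d + e"] exI[of _ "\<lambda>x y. f x y * g x y"]) (simp add: fg(3,4) power_add algebra_simps)
qed

lemma continuous_ev: "continuous_on UNIV (ev P)"
proof (induction P rule: poly2_induct)
  case (add P Q)
  then show ?case by (subst continuous_on_cong[of _ _ _ "\<lambda>z. ev P z + ev Q z"]) (auto intro: continuous_intros)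
next
  case (mult P Q)
  then show ?case by (subst continuous_on_cong[of _ _ _ "\<lambda>z. ev P z * ev Q z"]) (auto intro: continuous_intros)
next
  case (const c)
  then show ?case by (subst continuous_on_cong[of _ _ _ "\<lambda>z. c"]) auto
next
  case fst
  then show ?case by (subst continuous_on_cong[of _ _ _ fst]) (auto intro: continuous_intros)
next
  case snd
  then show ?case by (subst continuous_on_cong[of _ _ _ snd]) (auto intro: continuous_intros)
qed

text \<open>The Euclidean topology enters here as a tool: a complex line through a point of a
  Zariski open set stays in it for small parameters. This gives the density needed for the closure
  and allows derivations to be computed as analytic derivatives.\<close>

lemma ev_nonzero_along_line:
  assumes "ev P z \<noteq> 0"
  shows "\<forall>\<^sub>F t in nhds 0. ev P (fst z + t * \<alpha>, snd z + t * \<beta>) \<noteq> 0"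
proof -
  have "continuous_on UNIV (\<lambda>t. ev P (fst z + t * \<alpha>, snd z + t * \<beta>))"
    by (rule continuous_on_compose2[OF continuous_ev]) (auto intro!: continuous_intros)
  then have "isCont (\<lambda>t. ev P (fst z + t * \<alpha>, snd z + t * \<beta>)) 0"
    by (simp add: continuous_on_eq_continuous_at)
  then have "((\<lambda>t. ev P (fst z + t * \<alpha>, snd z + t * \<beta>)) \<longlongrightarrow> ev P z) (at 0)"
    by (simp add: isCont_def)
  from tendsto_imp_eventually_ne[OF this assms] show ?thesis
    using assms by (simp add: eventually_nhds_conv_at)
qed

section \<open>Points and equations of the blow-up\<close>

lemma conic_dir:
  assumes "y \<noteq> 0" "y $ 1 * y $ 3 = (y $ 2)\<^sup>2"
  shows "\<exists>b u a. a \<noteq> 0 \<and> y = a *s dir b u"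
proof (cases "y $ 1 = 0")
  case True
  then have "y $ 2 = 0" "y $ 3 \<noteq> 0" using assms by (auto simp: vec_eq_iff forall_3)
  with True show ?thesis
    by (intro exI[of _ True] exI[of _ 0] exI[of _ "y $ 3"]) (auto simp: vec_eq_iff forall_3)
next
  case False
  then show ?thesis using assms(2)
    by (intro exI[of _ False] exI[of _ "y $ 2 / y $ 1"] exI[of _ "y $ 1"])
      (auto simp: vec_eq_iff forall_3 field_simps power2_eq_square)
qed

lemma dir_conic: "dir b u $ 1 * dir b u $ 3 = (dir b u $ 2)\<^sup>2"
  by (cases b) auto

lemma Y_closure: "Y = zariski closure_of {(x, proj_point x) | x. x \<in> quadric_cone \<and> x \<noteq> 0}"
  unfolding A1_resolution_def blowup_origin_def
  by (rule topspace_subtopology_subset[OF closure_of_subset_topspace])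

text \<open>Moving the second coordinate to a nonzero value \<open>snd z + t\<close> gives a point
  of the graph, and for small \<open>t\<close> it still lies in a given basic neighbourhood. This
  also reaches the exceptional curve, where \<open>snd z = 0\<close>.\<close>

lemma psi_in_Y: "psi b z \<in> Y"
proof -
  let ?G = "{(x, proj_point x) | x. x \<in> quadric_cone \<and> x \<noteq> 0}"
  have G: "(t *s dir b (fst z), proj_point (dir b (fst z))) \<in> ?G" if "t \<noteq> 0" for t
  proof -
    have "t *s dir b (fst z) \<in> quadric_cone"
      using dir_conic[of b "fst z"] by (simp add: quadric_cone_def power2_eq_square algebra_simps)
    moreover have "t *s dir b (fst z) \<noteq> 0" using that by (simp add: vector_mul_eq_0)
    ultimately show ?thesis using proj_point_smult[OF that] by force
  qed
  have "\<exists>p\<in>?G. p \<in> W" if W: "psi b z \<in> W" "openin zariski W" for W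
  proof -
    from zariski_base[OF W(2,1)] obtain f d where
      f: "fibre_homogeneous d f" "psi b z \<in> nonvanishing f" "nonvanishing f \<subseteq> W" by blast
    from fibre_homogeneous_chart[OF f(1), of b] obtain P where
      P: "\<And>z. f (snd z *s dir b (fst z)) (dir b (fst z)) = ev P z" by blast
    have "ev P z \<noteq> 0" using f(2) by (simp add: psi_def nonvanishing_iff[OF f(1)] P)
    from ev_nonzero_along_line[OF this, of 0 1] have
      "\<forall>\<^sub>F t in nhds 0. ev P (fst z, snd z + t) \<noteq> 0" by simp
    then have "\<forall>\<^sub>F t in at 0. ev P (fst z, snd z + t) \<noteq> 0"
      by (rule eventually_nhds_conv_at[THEN iffD1, THEN conjunct1])
    moreover have "\<forall>\<^sub>F t in at 0. snd z + t \<noteq> 0"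
    proof -
      have "((\<lambda>t. snd z + t) \<longlongrightarrow> snd z + 0) (at 0)" by (intro tendsto_intros)
      show ?thesis
      proof (cases "snd z = 0")
        case True
        then show ?thesis by (simp add: eventually_at_filter)
      next
        case False
        have "((\<lambda>t. snd z + t) \<longlongrightarrow> snd z + 0) (at 0)" by (intro tendsto_intros)
        from tendsto_imp_eventually_ne[OF this, of 0] False show ?thesis by simp
      qed
    qed
    ultimately have "\<forall>\<^sub>F t in at 0. ev P (fst z, snd z + t) \<noteq> 0 \<and> snd z + t \<noteq> 0" by eventually_elim simp
    then obtain t where "ev P (fst z, snd z + t) \<noteq> 0" "snd z + t \<noteq> 0"
      using eventually_happens by fastforce
    then have "((snd z + t) *s dir b (fst z), proj_point (dir b (fst z))) \<in> nonvanishing f"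
      using P[of "(fst z, snd z + t)"] by (simp add: nonvanishing_iff[OF f(1)])
    then show ?thesis using f(3) G[OF \<open>snd z + t \<noteq> 0\<close>] by blast
  qed
  moreover have "psi b z \<in> topspace zariski"
  proof -
    have hom: "fibre_homogeneous 0 (\<lambda>(x::complex^3) y. 1)" by (rule fibre_homogeneous.const)
    have "psi b z \<in> nonvanishing (\<lambda>x y. 1)" by (simp add: psi_def nonvanishing_iff[OF hom])
    then show ?thesis using openin_subset[OF openin_nonvanishing[OF hom]] by blast
  qed
  ultimately show ?thesis unfolding Y_closure in_closure_of by blast
qed

text \<open>A fibrewise homogeneous polynomial vanishing on the graph vanishes on its closure. This
  is applied to the equation of the conic in \<open>y\<close> and to the minors
  \<open>x $ i * y $ j - x $ j * y $ i\<close>.\<close>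

lemma Y_eqD:
  assumes "(x, proj_point y) \<in> Y" "y \<noteq> 0"
  shows "y $ 1 * y $ 3 = (y $ 2)\<^sup>2" "\<exists>c. x = c *s y"
proof -
  have van: "f x y = 0" if f: "fibre_homogeneous d f"
    and z: "\<And>x. x \<in> quadric_cone \<Longrightarrow> f x x = 0" for f d
  proof (rule ccontr)
    assume "f x y \<noteq> 0"
    then have "(x, proj_point y) \<in> nonvanishing f" by (simp add: nonvanishing_iff[OF f assms(2)])
    moreover have "(x, proj_point y) \<in> zariski closure_of {(x, proj_point x) | x. x \<in> quadric_cone \<and> x \<noteq> 0}"
      using assms(1) by (simp add: Y_closure)
    ultimately obtain w where "w \<in> quadric_cone" "w \<noteq> 0" "(w, proj_point w) \<in> nonvanishing f"
      unfolding in_closure_of using openin_nonvanishing[OF f] by blast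
    then show False using z[of w] by (simp add: nonvanishing_iff[OF f])
  qed
  have neg: "fibre_homogeneous d f \<Longrightarrow> fibre_homogeneous d (\<lambda>x y. (- 1) * f x y)" for f :: "complex^3 \<Rightarrow> complex^3 \<Rightarrow> complex" and d
    using fibre_homogeneous.mult[OF fibre_homogeneous.const[of "- 1"], of d f] by simp
  have mul: "fibre_homogeneous 2 (\<lambda>x (y::complex^3). y $ i * y $ j)" for i j
    using fibre_homogeneous.mult[OF fibre_homogeneous.fibre_coord[of i] fibre_homogeneous.fibre_coord[of j]]
    by (simp add: numeral_2_eq_2)
  have "y $ 1 * y $ 3 + (- 1) * (y $ 2 * y $ 2) = 0"
    by (rule van[OF fibre_homogeneous.add[OF mul neg[OF mul]]]) (simp add: quadric_cone_def power2_eq_square)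
  then show conic: "y $ 1 * y $ 3 = (y $ 2)\<^sup>2" by (simp add: power2_eq_square)
  have mul': "fibre_homogeneous 1 (\<lambda>x (y::complex^3). x $ i * y $ j)" for i j
    using fibre_homogeneous.mult[OF fibre_homogeneous.base_coord[of i] fibre_homogeneous.fibre_coord[of j]] by simp
  have cross: "x $ i * y $ j = x $ j * y $ i" for i j
  proof -
    have "x $ i * y $ j + (- 1) * (x $ j * y $ i) = 0"
      by (rule van[OF fibre_homogeneous.add[OF mul' neg[OF mul']]]) simp
    then show ?thesis by simp
  qed
  from assms(2) obtain j where j: "y $ j \<noteq> 0" by (auto simp: vec_eq_iff)
  have "x = (x $ j / y $ j) *s y"
    unfolding vec_eq_iff vector_smult_component using j cross[of _ j] by (simp add: field_simps)
  then show "\<exists>c. x = c *s y" by blast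
qed

lemma Y_chart:
  assumes "(x, proj_point y) \<in> Y" "y $ lead b \<noteq> 0"
  shows "(x, proj_point y) = psi b (y $ 2 / y $ lead b, x $ lead b)"
proof -
  have y: "y \<noteq> 0" using assms(2) by auto
  note * = Y_eqD[OF assms(1) y]
  have "y = y $ lead b *s dir b (y $ 2 / y $ lead b)"
    using *(1) assms(2)
    by (cases b) (auto simp: vec_eq_iff forall_3 lead_def field_simps power2_eq_square)
  moreover from *(2) obtain c where c: "x = c *s y" by blast
  ultimately have "x = x $ lead b *s dir b (y $ 2 / y $ lead b)"
    by (metis vector_smult_assoc vector_smult_component)
  then show ?thesis
    unfolding psi_def fst_conv snd_conv prod.inject
    using proj_point_smult[OF assms(2), of "dir b (y $ 2 / y $ lead b)"]
      \<open>y = y $ lead b *s dir b (y $ 2 / y $ lead b)\<close> by metis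
qed

lemma Y_cases:
  assumes "p \<in> Y"
  obtains b z where "p = psi b z"
proof -
  have "p \<in> topspace zariski" using assms unfolding Y_closure by (rule subsetD[OF closure_of_subset_topspace])
  then obtain f d where fd: "fibre_homogeneous d f" "p \<in> nonvanishing f"
    using zariski_base[OF openin_topspace] by blast
  then obtain x y where p: "p = (x, proj_point y)" "y \<noteq> 0" unfolding nonvanishing_def by blast
  from conic_dir[OF p(2) Y_eqD(1)] assms p obtain b u a where *: "a \<noteq> 0" "y = a *s dir b u" by metis
  then have "y $ lead b \<noteq> 0" by simp
  with Y_chart[of x y b] assms p(1) that show thesis by metis
qed

section \<open>Topology and regular functions read off in the charts\<close>

lemma openin_A1_image: "openin A1_resolution (psi b ` {z. ev Q z \<noteq> 0})"
proof -
  from homogenization[of b Q] obtain d f where hom: "fibre_homogeneous d f" and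
    f: "\<And>x y. y $ lead b \<noteq> 0 \<Longrightarrow> f x y = (y $ lead b) ^ d * ev Q (y $ 2 / y $ lead b, x $ lead b)" by blast
  \<comment> \<open>The extra factor \<open>y $ lead b\<close> confines the nonvanishing set to the
    chart, where the formula for \<open>f\<close> is valid.\<close>
  define g where "g = (\<lambda>x y. y $ lead b * f x y)"
  have homg: "fibre_homogeneous (1 + d) g"
    unfolding g_def by (intro fibre_homogeneous.mult fibre_homogeneous.fibre_coord hom)
  have "psi b ` {z. ev Q z \<noteq> 0} = nonvanishing g \<inter> Y"
  proof (rule set_eqI, rule iffI)
    fix p assume "p \<in> psi b ` {z. ev Q z \<noteq> 0}"
    then obtain z where z: "p = psi b z" "ev Q z \<noteq> 0" by blast
    then have "g (snd z *s dir b (fst z)) (dir b (fst z)) \<noteq> 0" unfolding g_def by (simp add: f)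
    with z(1) show "p \<in> nonvanishing g \<inter> Y"
      using psi_in_Y[of b z] by (simp add: psi_def nonvanishing_iff[OF homg])
  next
    fix p assume p: "p \<in> nonvanishing g \<inter> Y"
    then obtain x y where y: "p = (x, proj_point y)" "y \<noteq> 0" "g x y \<noteq> 0" unfolding nonvanishing_def by blast
    then have l: "y $ lead b \<noteq> 0" by (auto simp: g_def)
    have "p = psi b (y $ 2 / y $ lead b, x $ lead b)" using Y_chart[OF _ l] p y(1) by blast
    moreover have "ev Q (y $ 2 / y $ lead b, x $ lead b) \<noteq> 0" using y(3) by (auto simp: g_def f[OF l])
    ultimately show "p \<in> psi b ` {z. ev Q z \<noteq> 0}" by blast
  qed
  moreover have "openin A1_resolution (Y \<inter> nonvanishing g)"
    using openin_nonvanishing[OF homg] unfolding Y_closure unfolding A1_resolution_def blowup_origin_def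
    by (intro openin_subtopology_Int2)
  ultimately show ?thesis by (simp add: Int_commute)
qed

text \<open>Basic open sets pull back to principal open sets of the planes by
  \<open>fibre_homogeneous_chart\<close>, and principal open sets of the planes have open images by
  \<open>openin_A1_image\<close>.\<close>

lemma openin_A1_iff: "openin A1_resolution V \<longleftrightarrow> V \<subseteq> Y \<and> (\<forall>b. zopen (psi b -` V))"
proof (intro iffI conjI allI)
  assume V: "openin A1_resolution V"
  then show "V \<subseteq> Y" by (rule openin_subset)
  fix b
  from V obtain W where W: "openin zariski W" "V = W \<inter> Y"
    unfolding Y_closure unfolding A1_resolution_def blowup_origin_def openin_subtopology by blast
  show "zopen (psi b -` V)"
    unfolding zopen_def
  proof
    fix z assume "z \<in> psi b -` V"
    then have "psi b z \<in> W" using W(2) by simp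
    from zariski_base[OF W(1) this] obtain f d where
      f: "fibre_homogeneous d f" "psi b z \<in> nonvanishing f" "nonvanishing f \<subseteq> W" by blast
    from fibre_homogeneous_chart[OF f(1), of b] obtain P where
      P: "\<And>z. f (snd z *s dir b (fst z)) (dir b (fst z)) = ev P z" by blast
    have iff: "psi b w \<in> nonvanishing f \<longleftrightarrow> ev P w \<noteq> 0" for w
      by (simp add: psi_def nonvanishing_iff[OF f(1)] P)
    have "w \<in> psi b -` V" if "ev P w \<noteq> 0" for w
      using that iff f(3) W(2) psi_in_Y by blast
    then show "\<exists>Q. ev Q z \<noteq> 0 \<and> (\<forall>w. ev Q w \<noteq> 0 \<longrightarrow> w \<in> psi b -` V)"
      using f(2) iff by (intro exI[of _ P] conjI allI impI) simp_all
  qed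
next
  assume V: "V \<subseteq> Y \<and> (\<forall>b. zopen (psi b -` V))"
  show "openin A1_resolution V"
  proof (subst openin_subopen, intro ballI)
    fix p assume p: "p \<in> V"
    with V have "p \<in> Y" by blast
    then obtain b z where z: "p = psi b z" by (rule Y_cases)
    with p have "z \<in> psi b -` V" by simp
    with zopenD[of "psi b -` V" z] V obtain Q where Q: "ev Q z \<noteq> 0" "{w. ev Q w \<noteq> 0} \<subseteq> psi b -` V" by blast
    show "\<exists>T. openin A1_resolution T \<and> p \<in> T \<and> T \<subseteq> V"
      by (intro exI[of _ "psi b ` {z. ev Q z \<noteq> 0}"] conjI openin_A1_image) (use z Q in auto)
  qed
qed

abbreviation "\<O> \<equiv> regular_functions A1_resolution"

lemma regular_functions_A1_iff:
  assumes V: "openin A1_resolution V"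
  shows "\<phi> \<in> \<O> V \<longleftrightarrow> (\<forall>p. p \<notin> V \<longrightarrow> \<phi> p = 0) \<and> (\<forall>b. regular_on (psi b -` V) (\<lambda>z. \<phi> (psi b z)))"
proof (intro iffI conjI allI)
  assume \<phi>: "\<phi> \<in> \<O> V"
  then show "p \<notin> V \<longrightarrow> \<phi> p = 0" for p unfolding regular_functions_def by blast
  fix b
  show "regular_on (psi b -` V) (\<lambda>z. \<phi> (psi b z))"
    unfolding regular_on_def
  proof
    fix z assume "z \<in> psi b -` V"
    with \<phi> obtain W d g h where W: "openin A1_resolution W" "psi b z \<in> W" "W \<subseteq> V"
      and gh: "fibre_homogeneous d g" "fibre_homogeneous d h"
      and \<phi>gh: "\<forall>x y. y \<noteq> 0 \<and> (x, proj_point y) \<in> W \<longrightarrow> h x y \<noteq> 0 \<and> \<phi> (x, proj_point y) = g x y / h x y"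
      unfolding regular_functions_def by blast
    from W(1) have "zopen (psi b -` W)" unfolding openin_A1_iff by blast
    with zopenD[of "psi b -` W" z] W(2) obtain R where R: "ev R z \<noteq> 0" "{w. ev R w \<noteq> 0} \<subseteq> psi b -` W" by blast
    from fibre_homogeneous_chart[OF gh(1), of b] obtain G where
      G: "\<And>z. g (snd z *s dir b (fst z)) (dir b (fst z)) = ev G z" by blast
    from fibre_homogeneous_chart[OF gh(2), of b] obtain H where
      H: "\<And>z. h (snd z *s dir b (fst z)) (dir b (fst z)) = ev H z" by blast
    have *: "psi b w \<in> V \<and> ev H w \<noteq> 0 \<and> \<phi> (psi b w) = ev G w / ev H w" if "ev R w \<noteq> 0" for w
    proof -
      have "psi b w \<in> W" using that R(2) by blast
      then show ?thesis using \<phi>gh[rule_format, of "dir b (fst w)" "snd w *s dir b (fst w)"] W(3)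
        by (auto simp: psi_def G H)
    qed
    show "\<exists>P Q. ev Q z \<noteq> 0 \<and> (\<forall>w. ev Q w \<noteq> 0 \<longrightarrow> w \<in> psi b -` V \<and> \<phi> (psi b w) = ev P w / ev Q w)"
      by (intro exI[of _ "G * R"] exI[of _ "H * R"] conjI allI impI) (use * R(1) in auto)
  qed
next
  assume *: "(\<forall>p. p \<notin> V \<longrightarrow> \<phi> p = 0) \<and> (\<forall>b. regular_on (psi b -` V) (\<lambda>z. \<phi> (psi b z)))"
  show "\<phi> \<in> \<O> V"
    unfolding regular_functions_def
  proof (intro CollectI conjI ballI)
    show "\<forall>p. p \<notin> V \<longrightarrow> \<phi> p = 0" using * by blast
    fix p assume p: "p \<in> V"
    with openin_subset[OF V] have "p \<in> Y" by blast
    then obtain b z where z: "p = psi b z" by (rule Y_cases)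
    have "regular_on (psi b -` V) (\<lambda>z. \<phi> (psi b z))" "z \<in> psi b -` V" using * p z by auto
    then obtain P Q where PQ: "ev Q z \<noteq> 0" "\<forall>w. ev Q w \<noteq> 0 \<longrightarrow> w \<in> psi b -` V \<and> \<phi> (psi b w) = ev P w / ev Q w"
      unfolding regular_on_def by blast
    from homogenization[of b P] obtain d f where f: "fibre_homogeneous d f"
      "\<And>x y. y $ lead b \<noteq> 0 \<Longrightarrow> f x y = (y $ lead b) ^ d * ev P (y $ 2 / y $ lead b, x $ lead b)" by blast
    from homogenization[of b Q] obtain e h where h: "fibre_homogeneous e h"
      "\<And>x y. y $ lead b \<noteq> 0 \<Longrightarrow> h x y = (y $ lead b) ^ e * ev Q (y $ 2 / y $ lead b, x $ lead b)" by blast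
    let ?W = "psi b ` {z. ev Q z \<noteq> 0}"
    \<comment> \<open>Numerator and denominator come with different degrees \<open>d\<close> and
      \<open>e\<close>. Crosswise powers of the leading coordinate bring both to degree
      \<open>e + d\<close> and cancel in the quotient.\<close>
    let ?g = "\<lambda>x y. (y $ lead b) ^ e * f x y" and ?h = "\<lambda>x y. (y $ lead b) ^ d * h x y"
    have hom: "fibre_homogeneous (e + d) ?g" "fibre_homogeneous (e + d) ?h"
      using fibre_homogeneous.mult[OF fibre_homogeneous_power f(1), of e "lead b"]
        fibre_homogeneous.mult[OF fibre_homogeneous_power h(1), of d "lead b"] by (simp_all add: add.commute)
    have val: "?h x y \<noteq> 0 \<and> \<phi> (x, proj_point y) = ?g x y / ?h x y" if xy: "y \<noteq> 0" "(x, proj_point y) \<in> ?W" for x y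
    proof -
      from xy(2) obtain w where w: "ev Q w \<noteq> 0" "(x, proj_point y) = psi b w" by blast
      then have x: "x = snd w *s dir b (fst w)" and "proj_point (dir b (fst w)) = proj_point y"
        by (simp_all add: psi_def)
      with proj_point_eqD xy(1) obtain a where a: "a \<noteq> 0" "y = a *s dir b (fst w)" by metis
      then have "(y $ 2 / y $ lead b, x $ lead b) = w" "y $ lead b \<noteq> 0" by (simp_all add: x)
      then show ?thesis using PQ(2)[rule_format, OF w(1)] w by (simp add: f(2) h(2))
    qed
    have W: "openin A1_resolution ?W" "p \<in> ?W" "?W \<subseteq> V"
      using openin_A1_image PQ z by blast+
    show "\<exists>V' d g h. openin A1_resolution V' \<and> p \<in> V' \<and> V' \<subseteq> V \<and> fibre_homogeneous d g \<and>
        fibre_homogeneous d h \<and> (\<forall>x y. y \<noteq> 0 \<and> (x, proj_point y) \<in> V' \<longrightarrow>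
           h x y \<noteq> 0 \<and> \<phi> (x, proj_point y) = g x y / h x y)"
      by (rule exI[of _ ?W], rule exI[of _ "e + d"], rule exI[of _ ?g], rule exI[of _ ?h])
        (simp only: W hom simp_thms, use val in blast)
  qed
qed

section \<open>Tangent vectors of the resolution\<close>

abbreviation tangent :: "(complex^3) \<times> (complex^3) set \<Rightarrow> (((complex^3) \<times> (complex^3) set \<Rightarrow> complex) \<Rightarrow> complex) \<Rightarrow> bool" where
  "tangent \<equiv> tangent_vector A1_resolution \<O>"

definition unpsi :: "bool \<Rightarrow> (complex^3) \<times> (complex^3) set \<Rightarrow> complex \<times> complex" where
  "unpsi b = inv (psi b)"

text \<open>\<open>crd b pU\<close> and \<open>crd b pV\<close> are the coordinate functions of the
  chart. The value 0 off the chart makes these functions sections over it in the sense of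
  \<open>regular_functions\<close>.\<close>

definition crd :: "bool \<Rightarrow> poly2 \<Rightarrow> (complex^3) \<times> (complex^3) set \<Rightarrow> complex" where
  "crd b P p = (if p \<in> range (psi b) then ev P (unpsi b p) else 0)"

definition restr :: "'a set \<Rightarrow> ('a \<Rightarrow> complex) \<Rightarrow> 'a \<Rightarrow> complex" where
  "restr W f = (\<lambda>p. if p \<in> W then f p else 0)"

lemma unpsi_psi [simp]: "unpsi b (psi b z) = z"
  unfolding unpsi_def by (rule inv_f_f) (simp add: inj_def psi_inj)

lemma crd_psi [simp]: "crd b P (psi b z) = ev P z"
  by (simp add: crd_def)

lemma openin_range_psi: "openin A1_resolution (range (psi b))"
  using openin_A1_image[of b 1] by simp

lemma vimage_psi_same: "psi b -` psi b ` S = S"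
  by (auto simp: psi_inj)

lemma vimage_psi_flip: "psi (\<not> b) -` range (psi b) = {z. fst z \<noteq> 0}"
  unfolding vimage_def using psi_overlap[of "\<not> b"] by (simp only: not_not)

lemma zopen_vimage_psi: "openin A1_resolution V \<Longrightarrow> zopen (psi b -` V)"
  by (simp add: openin_A1_iff)

lemma zopen_fst_nonzero: "zopen {z. fst z \<noteq> 0}"
  using zopen_principal[of pU] by simp

lemma regular_on_divide:
  assumes "regular_on S \<phi>" "regular_on S \<psi>" "\<And>z. z \<in> S \<Longrightarrow> \<psi> z \<noteq> 0"
  shows "regular_on S (\<lambda>z. \<phi> z / \<psi> z)"
  unfolding regular_on_def
proof
  fix z assume z: "z \<in> S"
  obtain P Q where PQ: "ev Q z \<noteq> 0" "\<And>w. ev Q w \<noteq> 0 \<Longrightarrow> w \<in> S \<and> \<phi> w = ev P w / ev Q w"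
    using regular_onE[OF assms(1) z] by metis
  obtain P' Q' where PQ': "ev Q' z \<noteq> 0" "\<And>w. ev Q' w \<noteq> 0 \<Longrightarrow> \<psi> w = ev P' w / ev Q' w"
    using regular_onE[OF assms(2) z] by metis
  have "ev P' z \<noteq> 0" using assms(3)[OF z] PQ'(2)[OF PQ'(1)] by auto
  \<comment> \<open>The common factor \<open>Q'\<close> keeps the neighbourhood inside the set where
    the fraction for \<open>\<psi>\<close> is valid.\<close>
  moreover have "w \<in> S \<and> \<phi> w / \<psi> w = ev (P * Q' * Q') w / ev (Q * Q' * P') w"
    if "ev (Q * Q' * P') w \<noteq> 0" for w
    using PQ(2)[of w] PQ'(2)[of w] that by simp
  ultimately show "\<exists>P Q. ev Q z \<noteq> 0 \<and> (\<forall>w. ev Q w \<noteq> 0 \<longrightarrow> w \<in> S \<and> \<phi> w / \<psi> w = ev P w / ev Q w)"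
    using PQ(1) PQ'(1) by (intro exI[of _ "P * Q' * Q'"] exI[of _ "Q * Q' * P'"] conjI allI impI) simp_all
qed

lemma regular_on_flip: "regular_on {z. fst z \<noteq> 0} (\<lambda>z. ev P (1 / fst z, (fst z)\<^sup>2 * snd z))"
proof (induction P rule: poly2_induct)
  case (const c)
  then show ?case using regular_on_const[OF zopen_fst_nonzero] by simp
next
  case fst
  have "regular_on {z. fst z \<noteq> 0} (\<lambda>z. 1 / fst z)"
    by (rule regular_on_rational[OF zopen_fst_nonzero, of pU _ 1]) auto
  then show ?case by simp
next
  case snd
  have "regular_on {z. fst z \<noteq> 0} (\<lambda>z. (fst z)\<^sup>2 * snd z)"
    by (rule regular_on_rational[OF zopen_fst_nonzero, of 1 _ "pU ^ 2 * pV"]) auto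
  then show ?case by simp
next
  case (add P Q)
  from regular_on_add[OF this] show ?case by simp
next
  case (mult P Q)
  from regular_on_mult[OF this] show ?case by simp
qed

lemma crd_regular: "crd b P \<in> \<O> (range (psi b))"
  unfolding regular_functions_A1_iff[OF openin_range_psi]
proof (intro conjI allI impI)
  show "p \<notin> range (psi b) \<Longrightarrow> crd b P p = 0" for p by (simp add: crd_def)
  fix b'
  show "regular_on (psi b' -` range (psi b)) (\<lambda>z. crd b P (psi b' z))"
  proof (cases "b' = b")
    case True
    then show ?thesis using regular_on_ev[OF zopen_UNIV, of P] by (simp add: vimage_psi_same)
  next
    case False
    then have b': "b' = (\<not> b)" by simp
    show ?thesis unfolding b' vimage_psi_flip
      by (subst regular_on_cong[of _ _ "\<lambda>z. ev P (1 / fst z, (fst z)\<^sup>2 * snd z)"])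
        (simp_all add: regular_on_flip psi_flip[of _ "\<not> b"])
  qed
qed

lemma O_intros:
  assumes U: "openin A1_resolution U"
  shows O_add: "f \<in> \<O> U \<Longrightarrow> g \<in> \<O> U \<Longrightarrow> (\<lambda>q. f q + g q) \<in> \<O> U"
    and O_mult: "f \<in> \<O> U \<Longrightarrow> g \<in> \<O> U \<Longrightarrow> (\<lambda>q. f q * g q) \<in> \<O> U"
    and O_scale: "f \<in> \<O> U \<Longrightarrow> (\<lambda>q. a * f q) \<in> \<O> U"
    and O_divide: "f \<in> \<O> U \<Longrightarrow> g \<in> \<O> U \<Longrightarrow> (\<And>p. p \<in> U \<Longrightarrow> g p \<noteq> 0) \<Longrightarrow> (\<lambda>q. f q / g q) \<in> \<O> U"
    and O_restr: "openin A1_resolution W \<Longrightarrow> W \<subseteq> U \<Longrightarrow> f \<in> \<O> U \<Longrightarrow> restr W f \<in> \<O> W"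
proof -
  show "f \<in> \<O> U \<Longrightarrow> g \<in> \<O> U \<Longrightarrow> (\<lambda>q. f q + g q) \<in> \<O> U"
    by (simp add: regular_functions_A1_iff[OF U] regular_on_add)
  show "f \<in> \<O> U \<Longrightarrow> g \<in> \<O> U \<Longrightarrow> (\<lambda>q. f q * g q) \<in> \<O> U"
    by (simp add: regular_functions_A1_iff[OF U] regular_on_mult)
  show "f \<in> \<O> U \<Longrightarrow> (\<lambda>q. a * f q) \<in> \<O> U"
    by (simp add: regular_functions_A1_iff[OF U] regular_on_mult regular_on_const zopen_vimage_psi[OF U])
  show "(\<lambda>q. f q / g q) \<in> \<O> U" if fg: "f \<in> \<O> U" "g \<in> \<O> U" and nz: "\<And>p. p \<in> U \<Longrightarrow> g p \<noteq> 0"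
  proof -
    have "regular_on (psi b -` U) (\<lambda>z. f (psi b z) / g (psi b z))" for b
      using fg by (intro regular_on_divide nz) (simp_all add: regular_functions_A1_iff[OF U])
    then show ?thesis using fg(1) by (simp add: regular_functions_A1_iff[OF U])
  qed
  assume W: "openin A1_resolution W" "W \<subseteq> U" and f: "f \<in> \<O> U"
  show "restr W f \<in> \<O> W"
    unfolding regular_functions_A1_iff[OF W(1)]
  proof (intro conjI allI impI)
    fix b
    have "regular_on (psi b -` U) (\<lambda>z. f (psi b z))" using f by (simp add: regular_functions_A1_iff[OF U])
    then have "regular_on (psi b -` W) (\<lambda>z. f (psi b z))"
      by (rule regular_on_subset[OF _ zopen_vimage_psi[OF W(1)] vimage_mono[OF W(2)]])
    then show "regular_on (psi b -` W) (\<lambda>z. restr W f (psi b z))"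
      by (subst regular_on_cong[of _ _ "\<lambda>z. f (psi b z)"]) (simp_all add: restr_def)
  qed (simp add: restr_def)
qed

section \<open>Differentiation of regular functions along lines\<close>

lemma ev_has_derivative_along_line:
  "\<exists>Pu Pv. \<forall>z \<alpha> \<beta>. ((\<lambda>t. ev P (fst z + t * \<alpha>, snd z + t * \<beta>)) has_field_derivative
     ev Pu z * \<alpha> + ev Pv z * \<beta>) (at 0)"
proof (induction P rule: poly2_induct)
  case (const c)
  show ?case by (intro exI[of _ 0]) (auto intro!: derivative_eq_intros)
next
  case fst
  show ?case by (rule exI[of _ 1], rule exI[of _ 0]) (auto intro!: derivative_eq_intros)
next
  case snd
  show ?case by (rule exI[of _ 0], rule exI[of _ 1]) (auto intro!: derivative_eq_intros)
next
  case (add P Q)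
  then obtain Pu Pv Qu Qv where
    *: "\<forall>z \<alpha> \<beta>. ((\<lambda>t. ev P (fst z + t * \<alpha>, snd z + t * \<beta>)) has_field_derivative ev Pu z * \<alpha> + ev Pv z * \<beta>) (at 0)"
     "\<forall>z \<alpha> \<beta>. ((\<lambda>t. ev Q (fst z + t * \<alpha>, snd z + t * \<beta>)) has_field_derivative ev Qu z * \<alpha> + ev Qv z * \<beta>) (at 0)"
    by (elim exE)
  show ?case
  proof (rule exI[of _ "Pu + Qu"], rule exI[of _ "Pv + Qv"], intro allI)
    fix z \<alpha> \<beta>
    show "((\<lambda>t. ev (P + Q) (fst z + t * \<alpha>, snd z + t * \<beta>)) has_field_derivative
        ev (Pu + Qu) z * \<alpha> + ev (Pv + Qv) z * \<beta>) (at 0)"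
      using DERIV_add[OF *(1)[rule_format, of z \<alpha> \<beta>] *(2)[rule_format, of z \<alpha> \<beta>]]
      by (simp add: algebra_simps)
  qed
next
  case (mult P Q)
  then obtain Pu Pv Qu Qv where
    *: "\<forall>z \<alpha> \<beta>. ((\<lambda>t. ev P (fst z + t * \<alpha>, snd z + t * \<beta>)) has_field_derivative ev Pu z * \<alpha> + ev Pv z * \<beta>) (at 0)"
     "\<forall>z \<alpha> \<beta>. ((\<lambda>t. ev Q (fst z + t * \<alpha>, snd z + t * \<beta>)) has_field_derivative ev Qu z * \<alpha> + ev Qv z * \<beta>) (at 0)"
    by (elim exE)
  show ?case
  proof (rule exI[of _ "Pu * Q + P * Qu"], rule exI[of _ "Pv * Q + P * Qv"], intro allI)
    fix z \<alpha> \<beta>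
    show "((\<lambda>t. ev (P * Q) (fst z + t * \<alpha>, snd z + t * \<beta>)) has_field_derivative
        ev (Pu * Q + P * Qu) z * \<alpha> + ev (Pv * Q + P * Qv) z * \<beta>) (at 0)"
      using DERIV_mult[OF *(1)[rule_format, of z \<alpha> \<beta>] *(2)[rule_format, of z \<alpha> \<beta>]]
      by (simp add: algebra_simps)
  qed
qed

text \<open>The quotient rule for a local fraction: the derivative is a linear form in the
  direction, and its two coefficients share the squared denominator.\<close>

lemma O_has_derivative:
  assumes U: "openin A1_resolution U" and z: "psi b z \<in> U" and f: "f \<in> \<O> U"
  shows "\<exists>A B Q. ev Q z \<noteq> 0 \<and> (\<forall>w. ev Q w \<noteq> 0 \<longrightarrow> psi b w \<in> U \<and> (\<forall>\<alpha> \<beta>.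
     ((\<lambda>t. f (psi b (fst w + t * \<alpha>, snd w + t * \<beta>))) has_field_derivative
       (ev A w * \<alpha> + ev B w * \<beta>) / ev Q w) (at 0)))"
proof -
  have "regular_on (psi b -` U) (\<lambda>z. f (psi b z))" "z \<in> psi b -` U"
    using f z by (simp_all add: regular_functions_A1_iff[OF U])
  then obtain P Q where PQ: "ev Q z \<noteq> 0" "\<And>w. ev Q w \<noteq> 0 \<Longrightarrow> psi b w \<in> U \<and> f (psi b w) = ev P w / ev Q w"
    using regular_onE[of "psi b -` U" "\<lambda>z. f (psi b z)" z] by (metis vimageE)
  from ev_has_derivative_along_line[of P] ev_has_derivative_along_line[of Q] obtain Pu Pv Qu Qv where
    D: "\<forall>z \<alpha> \<beta>. ((\<lambda>t. ev P (fst z + t * \<alpha>, snd z + t * \<beta>)) has_field_derivative ev Pu z * \<alpha> + ev Pv z * \<beta>) (at 0)"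
     "\<forall>z \<alpha> \<beta>. ((\<lambda>t. ev Q (fst z + t * \<alpha>, snd z + t * \<beta>)) has_field_derivative ev Qu z * \<alpha> + ev Qv z * \<beta>) (at 0)"
    by (elim exE)
  have "((\<lambda>t. f (psi b (fst w + t * \<alpha>, snd w + t * \<beta>))) has_field_derivative
       (ev (Pu * Q - P * Qu) w * \<alpha> + ev (Pv * Q - P * Qv) w * \<beta>) / ev (Q * Q) w) (at 0)"
    if w: "ev Q w \<noteq> 0" for w \<alpha> \<beta>
  proof -
    let ?l = "\<lambda>t. (fst w + t * \<alpha>, snd w + t * \<beta>)"
    have "((\<lambda>t. ev P (?l t) / ev Q (?l t)) has_field_derivative
       (ev (Pu * Q - P * Qu) w * \<alpha> + ev (Pv * Q - P * Qv) w * \<beta>) / ev (Q * Q) w) (at 0)"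
      using DERIV_divide[OF D(1)[rule_format, of w \<alpha> \<beta>] D(2)[rule_format, of w \<alpha> \<beta>]] w
      by (simp add: algebra_simps)
    moreover have "\<forall>\<^sub>F t in nhds 0. f (psi b (?l t)) = ev P (?l t) / ev Q (?l t)"
      using ev_nonzero_along_line[OF w, of \<alpha> \<beta>] by eventually_elim (use PQ(2) in blast)
    ultimately show ?thesis by (subst DERIV_cong_ev[OF refl _ refl])
  qed
  then show ?thesis
    by (rule_tac exI[of _ "Pu * Q - P * Qu"], rule_tac exI[of _ "Pv * Q - P * Qv"], rule_tac exI[of _ "Q * Q"])
      (use PQ in simp)
qed

text \<open>The tangent vector with components \<open>\<alpha>\<close>, \<open>\<beta>\<close> in
  the coordinates of chart \<open>b\<close>, realised as a directional derivative. The value 0 on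
  functions not regular near the point is demanded by \<open>tangent_vector\<close>.\<close>

definition tv :: "bool \<Rightarrow> complex \<times> complex \<Rightarrow> complex \<Rightarrow> complex \<Rightarrow>
    ((complex^3) \<times> (complex^3) set \<Rightarrow> complex) \<Rightarrow> complex" where
  "tv b z \<alpha> \<beta> f = (if \<exists>U. openin A1_resolution U \<and> psi b z \<in> U \<and> f \<in> \<O> U
     then deriv (\<lambda>t. f (psi b (fst z + t * \<alpha>, snd z + t * \<beta>))) 0 else 0)"

lemma tv_has_derivative:
  assumes "openin A1_resolution U" "psi b z \<in> U" "f \<in> \<O> U"
  shows "((\<lambda>t. f (psi b (fst z + t * \<alpha>, snd z + t * \<beta>))) has_field_derivative tv b z \<alpha> \<beta> f) (at 0)"
proof -
  from O_has_derivative[OF assms] obtain A B Q where Q: "ev Q z \<noteq> 0" and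
    D: "\<forall>w. ev Q w \<noteq> 0 \<longrightarrow> psi b w \<in> U \<and> (\<forall>\<alpha> \<beta>.
     ((\<lambda>t. f (psi b (fst w + t * \<alpha>, snd w + t * \<beta>))) has_field_derivative
       (ev A w * \<alpha> + ev B w * \<beta>) / ev Q w) (at 0))" by (elim exE conjE)
  have "((\<lambda>t. f (psi b (fst z + t * \<alpha>, snd z + t * \<beta>))) has_field_derivative
       (ev A z * \<alpha> + ev B z * \<beta>) / ev Q z) (at 0)"
    using D[THEN spec[of _ z], THEN mp, OF Q, THEN conjunct2, THEN spec[of _ \<alpha>], THEN spec[of _ \<beta>]] .
  then have "((\<lambda>t. f (psi b (fst z + t * \<alpha>, snd z + t * \<beta>))) has_field_derivative
       deriv (\<lambda>t. f (psi b (fst z + t * \<alpha>, snd z + t * \<beta>))) 0) (at 0)"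
    by (simp add: DERIV_imp_deriv)
  moreover have "\<exists>U. openin A1_resolution U \<and> psi b z \<in> U \<and> f \<in> \<O> U" using assms by blast
  ultimately show ?thesis unfolding tv_def by simp
qed

lemma tv_eqI:
  assumes "openin A1_resolution U" "psi b z \<in> U" "f \<in> \<O> U"
    "((\<lambda>t. f (psi b (fst z + t * \<alpha>, snd z + t * \<beta>))) has_field_derivative d) (at 0)"
  shows "tv b z \<alpha> \<beta> f = d"
  using DERIV_unique[OF tv_has_derivative[OF assms(1-3)] assms(4)] .

lemma eventually_line_in:
  assumes "openin A1_resolution W" "psi b z \<in> W"
  shows "\<forall>\<^sub>F t in nhds 0. psi b (fst z + t * \<alpha>, snd z + t * \<beta>) \<in> W"
proof -
  obtain Q where Q: "ev Q z \<noteq> 0" "{w. ev Q w \<noteq> 0} \<subseteq> psi b -` W"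
    using zopenD[OF zopen_vimage_psi[OF assms(1)], of z b] assms(2) by blast
  from ev_nonzero_along_line[OF Q(1), of \<alpha> \<beta>] show ?thesis by eventually_elim (use Q(2) in blast)
qed

lemma tangent_tv: "tangent (psi b z) (tv b z \<alpha> \<beta>)"
  unfolding tangent_vector_def
proof (intro conjI allI impI)
  fix f assume "\<nexists>U. openin A1_resolution U \<and> psi b z \<in> U \<and> f \<in> \<O> U"
  then show "tv b z \<alpha> \<beta> f = 0" by (simp only: tv_def if_False)
next
  fix U f g assume *: "openin A1_resolution U \<and> psi b z \<in> U \<and> f \<in> \<O> U \<and> g \<in> \<O> U"
  then have U: "openin A1_resolution U" "psi b z \<in> U" by simp_all
  note f = tv_has_derivative[OF U, of f \<alpha> \<beta>] and g = tv_has_derivative[OF U, of g \<alpha> \<beta>]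
  show "tv b z \<alpha> \<beta> (\<lambda>q. f q + g q) = tv b z \<alpha> \<beta> f + tv b z \<alpha> \<beta> g"
    by (rule tv_eqI[OF U O_add[OF U(1)]]) (use * f g in \<open>auto intro: DERIV_add\<close>)
  show "tv b z \<alpha> \<beta> (\<lambda>q. f q * g q) = f (psi b z) * tv b z \<alpha> \<beta> g + g (psi b z) * tv b z \<alpha> \<beta> f"
    by (rule tv_eqI[OF U O_mult[OF U(1)]]) (use * DERIV_mult[OF f g] in \<open>auto simp: algebra_simps\<close>)
next
  fix U f a assume *: "openin A1_resolution U \<and> psi b z \<in> U \<and> f \<in> \<O> U"
  then have U: "openin A1_resolution U" "psi b z \<in> U" by simp_all
  show "tv b z \<alpha> \<beta> (\<lambda>q. a * f q) = a * tv b z \<alpha> \<beta> f"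
    by (rule tv_eqI[OF U O_scale[OF U(1)]]) (use * DERIV_cmult[OF tv_has_derivative[OF U]] in auto)
next
  fix U V W f g assume *: "openin A1_resolution U \<and> openin A1_resolution V \<and> openin A1_resolution W \<and>
     psi b z \<in> W \<and> W \<subseteq> U \<inter> V \<and> f \<in> \<O> U \<and> g \<in> \<O> V \<and> (\<forall>q\<in>W. f q = g q)"
  then have op: "openin A1_resolution U" "openin A1_resolution V" "openin A1_resolution W"
    and z: "psi b z \<in> U" "psi b z \<in> V" "psi b z \<in> W" and fg: "f \<in> \<O> U" "g \<in> \<O> V"
    and eq': "\<forall>q\<in>W. f q = g q" by blast+
  show "tv b z \<alpha> \<beta> f = tv b z \<alpha> \<beta> g"
  proof (rule tv_eqI[OF op(1) z(1) fg(1)])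
    have "\<forall>\<^sub>F t in nhds 0. f (psi b (fst z + t * \<alpha>, snd z + t * \<beta>)) = g (psi b (fst z + t * \<alpha>, snd z + t * \<beta>))"
      using eventually_line_in[OF op(3) z(3), of \<alpha> \<beta>] by eventually_elim (rule bspec[OF eq'])
    then show "((\<lambda>t. f (psi b (fst z + t * \<alpha>, snd z + t * \<beta>))) has_field_derivative tv b z \<alpha> \<beta> g) (at 0)"
      using tv_has_derivative[OF op(2) z(2) fg(2), of \<alpha> \<beta>] by (subst DERIV_cong_ev[OF refl _ refl])
  qed
qed

lemma tangent_rules:
  assumes "tangent p D" "openin A1_resolution U" "p \<in> U" "f \<in> \<O> U"
  shows tangent_add: "g \<in> \<O> U \<Longrightarrow> D (\<lambda>q. f q + g q) = D f + D g"
    and tangent_mult: "g \<in> \<O> U \<Longrightarrow> D (\<lambda>q. f q * g q) = f p * D g + g p * D f"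
    and tangent_scale: "D (\<lambda>q. a * f q) = a * D f"
    and tangent_germ: "openin A1_resolution V \<Longrightarrow> openin A1_resolution W \<Longrightarrow> p \<in> W \<Longrightarrow> W \<subseteq> U \<inter> V \<Longrightarrow>
      g \<in> \<O> V \<Longrightarrow> (\<And>q. q \<in> W \<Longrightarrow> f q = g q) \<Longrightarrow> D f = D g"
proof -
  note t = assms(1)[unfolded tangent_vector_def, THEN conjunct2]
  note U = assms(2-4)
  show "g \<in> \<O> U \<Longrightarrow> D (\<lambda>q. f q + g q) = D f + D g"
    "g \<in> \<O> U \<Longrightarrow> D (\<lambda>q. f q * g q) = f p * D g + g p * D f"
    using t[THEN conjunct1, rule_format, of U f g] U by simp_all
  show "D (\<lambda>q. a * f q) = a * D f"
    using t[THEN conjunct2, THEN conjunct1, rule_format, of U f a] U by simp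
  assume "openin A1_resolution V" "openin A1_resolution W" "p \<in> W" "W \<subseteq> U \<inter> V" "g \<in> \<O> V"
    and eq: "\<And>q. q \<in> W \<Longrightarrow> f q = g q"
  moreover have "\<forall>q\<in>W. f q = g q" using eq by (rule ballI)
  ultimately show "D f = D g"
    using t[THEN conjunct2, THEN conjunct2, THEN spec[of _ U], THEN spec[of _ V], THEN spec[of _ W],
        THEN spec[of _ f], THEN spec[of _ g], THEN mp] U by (simp only: simp_thms)
qed

lemma tangent_restr:
  assumes "tangent p D" "openin A1_resolution U" "f \<in> \<O> U" "openin A1_resolution W" "p \<in> W" "W \<subseteq> U"
  shows "D (restr W f) = D f"
proof (rule sym, rule tangent_germ[OF assms(1,2) _ assms(3,4,4,5)])
  show "p \<in> U" "W \<subseteq> U \<inter> W" using assms by blast+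
  show "restr W f \<in> \<O> W" using O_restr assms by blast
qed (simp add: restr_def)

lemma tv_coordinates [simp]:
  "tv b z \<alpha> \<beta> (crd b pU) = \<alpha>" "tv b z \<alpha> \<beta> (crd b pV) = \<beta>"
  by (rule tv_eqI[OF openin_range_psi rangeI crd_regular];
      auto intro!: derivative_eq_intros)+

text \<open>A derivation kills constants because \<open>1 * 1 = 1\<close>, is determined on
  polynomials by the Leibniz rule, and on a local fraction \<open>f = P / Q\<close> by applying it
  to \<open>f * Q = P\<close> and dividing by the nonzero value of \<open>Q\<close>.\<close>

lemma tangent_unique:
  assumes D: "tangent (psi b z) D"
  shows "D = tv b z (D (crd b pU)) (D (crd b pV))" (is "D = ?D")
proof
  fix f
  note D' = tangent_tv[of b z "D (crd b pU)" "D (crd b pV)"]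
  note V = openin_range_psi[of b] rangeI[of "psi b" z]
  have one: "E (crd b 1) = 0" if E: "tangent (psi b z) E" for E
  proof -
    have "crd b 1 = (\<lambda>q. crd b 1 q * crd b 1 q)" by (auto simp: crd_def)
    then have "E (crd b 1) = E (\<lambda>q. crd b 1 q * crd b 1 q)" by simp
    also have "\<dots> = E (crd b 1) + E (crd b 1)"
      by (simp add: tangent_mult[OF E V crd_regular crd_regular])
    finally show ?thesis by simp
  qed
  have poly: "D (crd b P) = ?D (crd b P)" for P
  proof (induction P rule: poly2_induct)
    case (const c)
    have h: "E (crd b (pC c)) = 0" if E: "tangent (psi b z) E" for E
    proof -
      have "crd b (pC c) = (\<lambda>q. c * crd b 1 q)" by (auto simp: crd_def)
      then show ?thesis using tangent_scale[OF E V crd_regular, of c 1] one[OF E] by simp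
    qed
    show ?case by (simp only: h[OF D] h[OF D'])
  next
    case (add P Q)
    have h: "E (crd b (P + Q)) = E (crd b P) + E (crd b Q)" if E: "tangent (psi b z) E" for E
    proof -
      have "crd b (P + Q) = (\<lambda>q. crd b P q + crd b Q q)" by (auto simp: crd_def)
      then show ?thesis using tangent_add[OF E V crd_regular crd_regular] by simp
    qed
    show ?case by (simp only: h[OF D] h[OF D'] add)
  next
    case (mult P Q)
    have h: "E (crd b (P * Q)) = ev P z * E (crd b Q) + ev Q z * E (crd b P)" if E: "tangent (psi b z) E" for E
    proof -
      have "crd b (P * Q) = (\<lambda>q. crd b P q * crd b Q q)" by (auto simp: crd_def)
      then show ?thesis using tangent_mult[OF E V crd_regular crd_regular] by simp
    qed
    show ?case by (simp only: h[OF D] h[OF D'] mult)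
  qed simp_all
  show "D f = ?D f"
  proof (cases "\<exists>U. openin A1_resolution U \<and> psi b z \<in> U \<and> f \<in> \<O> U")
    case False
    have "E f = 0" if E: "tangent (psi b z) E" for E
      using E[unfolded tangent_vector_def, THEN conjunct1, THEN spec[of _ f], THEN mp] False by simp
    from this[OF D] this[OF D'] show ?thesis by simp
  next
    case True
    then obtain U where U: "openin A1_resolution U" "psi b z \<in> U" "f \<in> \<O> U" by blast
    then have "regular_on (psi b -` U) (\<lambda>z. f (psi b z))" "z \<in> psi b -` U"
      by (simp_all add: regular_functions_A1_iff[OF U(1)])
    from bspec[OF this(1)[unfolded regular_on_def] this(2)] obtain P Q where PQ: "ev Q z \<noteq> 0" and
      q: "\<forall>w. ev Q w \<noteq> 0 \<longrightarrow> w \<in> psi b -` U \<and> f (psi b w) = ev P w / ev Q w" by (elim exE conjE)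
    have PQ2: "psi b w \<in> U" "f (psi b w) = ev P w / ev Q w" if "ev Q w \<noteq> 0" for w
      using q[rule_format, OF that] by simp_all
    let ?W = "psi b ` {w. ev Q w \<noteq> 0}"
    have W: "openin A1_resolution ?W" "psi b z \<in> ?W" "?W \<subseteq> U" "?W \<subseteq> range (psi b)"
      using openin_A1_image PQ by (blast, blast, use PQ2(1) in blast, blast)
    have key: "E (crd b P) = f (psi b z) * E (crd b Q) + ev Q z * E f" if E: "tangent (psi b z) E" for E
    proof -
      have r: "restr ?W (crd b P) \<in> \<O> ?W" for P by (rule O_restr[OF V(1) W(1,4) crd_regular])
      have rf: "restr ?W f \<in> \<O> ?W" by (rule O_restr[OF U(1) W(1,3) U(3)])
      \<comment> \<open>\<open>P = f * Q\<close> is known only on \<open>?W\<close>. After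
        restriction both sides are 0 elsewhere, so this is an equality of functions to which the
        Leibniz rule applies.\<close>
      have "restr ?W (crd b P) = (\<lambda>q. restr ?W f q * restr ?W (crd b Q) q)"
        by (auto simp: restr_def fun_eq_iff PQ2)
      then have 1: "E (restr ?W (crd b P)) =
          restr ?W f (psi b z) * E (restr ?W (crd b Q)) + restr ?W (crd b Q) (psi b z) * E (restr ?W f)"
        using tangent_mult[OF E W(1,2) rf r] by simp
      have 2: "E (restr ?W (crd b P)) = E (crd b P)" for P
        by (rule tangent_restr[OF E V(1) crd_regular W(1,2,4)])
      have 3: "E (restr ?W f) = E f" by (rule tangent_restr[OF E U(1,3) W(1,2,3)])
      have 4: "restr ?W f (psi b z) = f (psi b z)" "restr ?W (crd b Q) (psi b z) = ev Q z"
        using W(2) by (simp_all add: restr_def)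
      from 1 show ?thesis unfolding 2 3 4 .
    qed
    have "f (psi b z) * ?D (crd b Q) + ev Q z * D f = f (psi b z) * ?D (crd b Q) + ev Q z * ?D f"
      using key[OF D, unfolded poly[of P] poly[of Q]] key[OF D'] by (rule trans[OF sym])
    then show ?thesis using PQ by simp
  qed
qed

text \<open>The chain rule: by \<open>tangent_unique\<close> in the other chart it suffices to
  differentiate \<open>1/u\<close> and \<open>u^2 v\<close> along the line.\<close>

lemma tv_flip:
  assumes u: "fst z \<noteq> 0"
  shows "tv b z \<alpha> \<beta> = tv (\<not> b) (1 / fst z, (fst z)\<^sup>2 * snd z)
    (- \<alpha> / (fst z)\<^sup>2) (2 * fst z * snd z * \<alpha> + (fst z)\<^sup>2 * \<beta>)"
proof -
  note flip = psi_flip[OF u, of b]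
  have "tangent (psi (\<not> b) (1 / fst z, (fst z)\<^sup>2 * snd z)) (tv b z \<alpha> \<beta>)"
    using tangent_tv[of b z \<alpha> \<beta>] unfolding flip .
  note eq = tangent_unique[OF this]
  have mem: "psi b z \<in> range (psi (\<not> b))" using flip by blast
  have ev: "\<forall>\<^sub>F t in nhds 0. crd (\<not> b) P (psi b (fst z + t * \<alpha>, snd z + t * \<beta>)) =
      ev P (1 / (fst z + t * \<alpha>), (fst z + t * \<alpha>)\<^sup>2 * (snd z + t * \<beta>))" for P
  proof -
    have "ev pU z \<noteq> 0" using u by simp
    from ev_nonzero_along_line[OF this, of \<alpha> \<beta>] show ?thesis
      by eventually_elim (simp add: psi_flip[of _ b])
  qed
  have "tv b z \<alpha> \<beta> (crd (\<not> b) pU) = - \<alpha> / (fst z)\<^sup>2"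
  proof (rule tv_eqI[OF openin_range_psi mem crd_regular])
    have "((\<lambda>t. 1 / (fst z + t * \<alpha>)) has_field_derivative - \<alpha> / (fst z)\<^sup>2) (at 0)"
      using u by (auto intro!: derivative_eq_intros simp: power2_eq_square)
    then show "((\<lambda>t. crd (\<not> b) pU (psi b (fst z + t * \<alpha>, snd z + t * \<beta>)))
        has_field_derivative - \<alpha> / (fst z)\<^sup>2) (at 0)"
      using ev[of pU] by (subst DERIV_cong_ev[OF refl _ refl]) simp_all
  qed
  moreover have "tv b z \<alpha> \<beta> (crd (\<not> b) pV) = 2 * fst z * snd z * \<alpha> + (fst z)\<^sup>2 * \<beta>"
  proof (rule tv_eqI[OF openin_range_psi mem crd_regular])
    have "((\<lambda>t. (fst z + t * \<alpha>)\<^sup>2 * (snd z + t * \<beta>)) has_field_derivative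
        2 * fst z * snd z * \<alpha> + (fst z)\<^sup>2 * \<beta>) (at 0)"
      by (auto intro!: derivative_eq_intros simp: power2_eq_square algebra_simps)
    then show "((\<lambda>t. crd (\<not> b) pV (psi b (fst z + t * \<alpha>, snd z + t * \<beta>)))
        has_field_derivative 2 * fst z * snd z * \<alpha> + (fst z)\<^sup>2 * \<beta>) (at 0)"
      using ev[of pV] by (subst DERIV_cong_ev[OF refl _ refl]) simp_all
  qed
  ultimately show ?thesis using eq by simp
qed

section \<open>Symmetric differentials in the charts\<close>

text \<open>The value on the tangent vector \<open>(\<alpha>, \<beta>)\<close> of the symmetric form
  whose coefficient at \<open>du^(m-l) dv^l\<close> is \<open>a l\<close>.\<close>

definition homf :: "nat \<Rightarrow> (nat \<Rightarrow> complex) \<Rightarrow> complex \<Rightarrow> complex \<Rightarrow> complex" where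
  "homf m a \<alpha> \<beta> = (\<Sum>l\<le>m. a l * \<alpha> ^ (m - l) * \<beta> ^ l)"

lemma homf_cong: "(\<And>l. l \<le> m \<Longrightarrow> a l = a' l) \<Longrightarrow> homf m a \<alpha> \<beta> = homf m a' \<alpha> \<beta>"
  unfolding homf_def by (intro sum.cong) auto

lemma homf_add: "homf m a \<alpha> \<beta> + homf m a' \<alpha> \<beta> = homf m (\<lambda>l. a l + a' l) \<alpha> \<beta>"
  unfolding homf_def by (simp add: sum.distrib[symmetric] algebra_simps)

lemma homf_diff: "homf m a \<alpha> \<beta> - homf m a' \<alpha> \<beta> = homf m (\<lambda>l. a l - a' l) \<alpha> \<beta>"
  unfolding homf_def by (simp add: sum_subtractf[symmetric] algebra_simps)

lemma homf_scale: "c * homf m a \<alpha> \<beta> = homf m (\<lambda>l. c * a l) \<alpha> \<beta>"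
  unfolding homf_def by (simp add: sum_distrib_left algebra_simps)

lemma homf_unique:
  assumes "\<And>\<alpha> \<beta>. homf m a \<alpha> \<beta> = homf m a' \<alpha> \<beta>" "l \<le> m"
  shows "a l = a' l"
proof -
  have "\<forall>x. (\<Sum>i\<le>m. a i * x ^ i) = (\<Sum>i\<le>m. a' i * x ^ i)"
    using assms(1)[of 1] by (simp add: homf_def)
  then show ?thesis using assms(2) unfolding polyfun_eq_coeffs by blast
qed

lemma homf_mult_linear:
  "(A * \<alpha> + B * \<beta>) * homf m a \<alpha> \<beta> =
     homf (Suc m) (\<lambda>l. (if l \<le> m then A * a l else 0) + (if l = 0 then 0 else B * a (l - 1))) \<alpha> \<beta>"
proof -
  have 1: "homf (Suc m) (\<lambda>l. if l \<le> m then A * a l else 0) \<alpha> \<beta> = A * \<alpha> * homf m a \<alpha> \<beta>"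
    unfolding homf_def sum.atMost_Suc sum_distrib_left
    by (simp, intro sum.cong) (auto simp: Suc_diff_le)
  have 2: "homf (Suc m) (\<lambda>l. if l = 0 then 0 else B * a (l - 1)) \<alpha> \<beta> = B * \<beta> * homf m a \<alpha> \<beta>"
    unfolding homf_def sum.atMost_Suc_shift sum_distrib_left
    by (simp, intro sum.cong) auto
  show ?thesis unfolding homf_add[symmetric] 1 2 by (simp add: algebra_simps)
qed

definition form_near :: "nat \<Rightarrow> complex \<times> complex \<Rightarrow> (complex \<times> complex \<Rightarrow> complex \<Rightarrow> complex \<Rightarrow> complex) \<Rightarrow> bool" where
  "form_near m z \<Phi> \<longleftrightarrow> (\<exists>P Q. ev Q z \<noteq> 0 \<and>
     (\<forall>w. ev Q w \<noteq> 0 \<longrightarrow> (\<forall>\<alpha> \<beta>. \<Phi> w \<alpha> \<beta> = homf m (\<lambda>l. ev (P l) w / ev Q w) \<alpha> \<beta>)))"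

lemma form_nearI:
  "ev Q z \<noteq> 0 \<Longrightarrow> (\<And>w \<alpha> \<beta>. ev Q w \<noteq> 0 \<Longrightarrow> \<Phi> w \<alpha> \<beta> = homf m (\<lambda>l. ev (P l) w / ev Q w) \<alpha> \<beta>) \<Longrightarrow> form_near m z \<Phi>"
  unfolding form_near_def by (rule exI[of _ P], rule exI[of _ Q]) simp

lemma form_nearD:
  assumes "form_near m z \<Phi>"
  shows "\<exists>P Q. ev Q z \<noteq> 0 \<and> (\<forall>w \<alpha> \<beta>. ev Q w \<noteq> 0 \<longrightarrow> \<Phi> w \<alpha> \<beta> = homf m (\<lambda>l. ev (P l) w / ev Q w) \<alpha> \<beta>)"
  using assms unfolding form_near_def by meson

lemma form_near_zero: "form_near m z (\<lambda>w \<alpha> \<beta>. 0)"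
  by (rule form_nearI[of 1 _ _ _ "\<lambda>_. 0"]) (simp_all add: homf_def)

lemma form_near_add:
  assumes "form_near m z \<Phi>" "form_near m z \<Psi>"
  shows "form_near m z (\<lambda>w \<alpha> \<beta>. \<Phi> w \<alpha> \<beta> + \<Psi> w \<alpha> \<beta>)"
proof -
  from form_nearD[OF assms(1)] form_nearD[OF assms(2)] obtain P Q P' Q' where
    PQ: "ev Q z \<noteq> 0" "\<forall>w \<alpha> \<beta>. ev Q w \<noteq> 0 \<longrightarrow> \<Phi> w \<alpha> \<beta> = homf m (\<lambda>l. ev (P l) w / ev Q w) \<alpha> \<beta>"
    and PQ': "ev Q' z \<noteq> 0" "\<forall>w \<alpha> \<beta>. ev Q' w \<noteq> 0 \<longrightarrow> \<Psi> w \<alpha> \<beta> = homf m (\<lambda>l. ev (P' l) w / ev Q' w) \<alpha> \<beta>"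
    by (elim exE conjE)
  show ?thesis
  proof (rule form_nearI)
    show "ev (Q * Q') z \<noteq> 0" using PQ(1) PQ'(1) by simp
    fix w \<alpha> \<beta> assume "ev (Q * Q') w \<noteq> 0"
    then have nz: "ev Q w \<noteq> 0" "ev Q' w \<noteq> 0" by simp_all
    show "\<Phi> w \<alpha> \<beta> + \<Psi> w \<alpha> \<beta> = homf m (\<lambda>l. ev (P l * Q' + P' l * Q) w / ev (Q * Q') w) \<alpha> \<beta>"
      unfolding PQ(2)[rule_format, OF nz(1)] PQ'(2)[rule_format, OF nz(2)] homf_add
      by (rule homf_cong) (use nz in \<open>simp add: field_simps\<close>)
  qed
qed

lemma form_near_sum:
  "(\<And>i. i \<in> A \<Longrightarrow> form_near m z (\<Phi> i)) \<Longrightarrow> form_near m z (\<lambda>w \<alpha> \<beta>. \<Sum>i\<in>A. \<Phi> i w \<alpha> \<beta>)"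
  by (induction A rule: infinite_finite_induct) (simp_all add: form_near_zero form_near_add)

lemma form_near_mult_linear:
  assumes "form_near m z \<Phi>"
    and "ev R z \<noteq> 0" "\<And>w \<alpha> \<beta>. ev R w \<noteq> 0 \<Longrightarrow> \<Psi> w \<alpha> \<beta> = (ev A w * \<alpha> + ev B w * \<beta>) / ev R w"
  shows "form_near (Suc m) z (\<lambda>w \<alpha> \<beta>. \<Phi> w \<alpha> \<beta> * \<Psi> w \<alpha> \<beta>)"
proof -
  from form_nearD[OF assms(1)] obtain P Q where
    PQ: "ev Q z \<noteq> 0" "\<forall>w \<alpha> \<beta>. ev Q w \<noteq> 0 \<longrightarrow> \<Phi> w \<alpha> \<beta> = homf m (\<lambda>l. ev (P l) w / ev Q w) \<alpha> \<beta>"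
    by (elim exE conjE)
  show ?thesis
  proof (rule form_nearI)
    show "ev (Q * R) z \<noteq> 0" using PQ(1) assms(2) by simp
    fix w \<alpha> \<beta> assume "ev (Q * R) w \<noteq> 0"
    then have nz: "ev Q w \<noteq> 0" "ev R w \<noteq> 0" by simp_all
    have "\<Phi> w \<alpha> \<beta> * \<Psi> w \<alpha> \<beta> =
        (ev A w / ev R w * \<alpha> + ev B w / ev R w * \<beta>) * homf m (\<lambda>l. ev (P l) w / ev Q w) \<alpha> \<beta>"
      unfolding PQ(2)[rule_format, OF nz(1)] assms(3)[OF nz(2)] using nz by (simp add: field_simps)
    also have "\<dots> = homf (Suc m) (\<lambda>l. ev ((if l \<le> m then A * P l else 0) + (if l = 0 then 0 else B * P (l - 1))) w
        / ev (Q * R) w) \<alpha> \<beta>"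
      unfolding homf_mult_linear by (rule homf_cong) (use nz in \<open>simp add: field_simps\<close>)
    finally show "\<Phi> w \<alpha> \<beta> * \<Psi> w \<alpha> \<beta> = \<dots>" .
  qed
qed

text \<open>Replaces the sums of products of arbitrary differentials by coefficients in the frame
  \<open>du^(m-l) dv^l\<close>, written as fractions with one denominator on a principal
  neighbourhood.\<close>

definition form_at :: "nat \<Rightarrow> bool \<Rightarrow> ((complex^3) \<times> (complex^3) set) set \<Rightarrow>
    (((complex^3) \<times> (complex^3) set) \<times> (((complex^3) \<times> (complex^3) set \<Rightarrow> complex) \<Rightarrow> complex) \<Rightarrow> complex) \<Rightarrow>
    complex \<times> complex \<Rightarrow> bool" where
  "form_at m b V \<omega> z \<longleftrightarrow> (\<exists>P Q. ev Q z \<noteq> 0 \<and> (\<forall>w. ev Q w \<noteq> 0 \<longrightarrow> psi b w \<in> V \<and>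
     (\<forall>\<alpha> \<beta>. \<omega> (psi b w, tv b w \<alpha> \<beta>) = homf m (\<lambda>l. ev (P l) w / ev Q w) \<alpha> \<beta>)))"

abbreviation "F \<equiv> A1_sym_cotangent"

lemma F_off: "\<omega> \<in> F m V \<Longrightarrow> \<not> (q \<in> V \<and> tangent q D) \<Longrightarrow> \<omega> (q, D) = 0"
  unfolding A1_sym_cotangent_def symmetric_differentials_def by blast

text \<open>Each \<open>df\<close> is a linear form in \<open>(\<alpha>, \<beta>)\<close> with
  rational coefficients by \<open>O_has_derivative\<close>, so multiplying them one by one onto a
  regular function produces homogeneous forms; the induction is on the number \<open>k\<close> of
  factors used.\<close>

lemma F_form_at:
  assumes \<omega>: "\<omega> \<in> F m V" and z: "psi b z \<in> V"
  shows "form_at m b V \<omega> z"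
proof -
  have "\<forall>p\<in>V. \<exists>V' (n::nat) g f. openin A1_resolution V' \<and> p \<in> V' \<and> V' \<subseteq> V \<and>
        (\<forall>i<n. g i \<in> \<O> V' \<and> (\<forall>j<m. f i j \<in> \<O> V')) \<and>
        (\<forall>q\<in>V'. \<forall>D. tangent q D \<longrightarrow> \<omega> (q, D) = (\<Sum>i<n. g i q * (\<Prod>j<m. D (f i j))))"
    using \<omega> unfolding A1_sym_cotangent_def symmetric_differentials_def mem_Collect_eq by (rule conjunct2)
  from bspec[OF this z] obtain V' n g f where V': "openin A1_resolution V'" "psi b z \<in> V'" "V' \<subseteq> V"
    and gf: "\<And>i. i < (n::nat) \<Longrightarrow> g i \<in> \<O> V'" "\<And>i j. i < n \<Longrightarrow> j < m \<Longrightarrow> f i j \<in> \<O> V'"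
    and eq: "\<forall>q\<in>V'. \<forall>D. tangent q D \<longrightarrow> \<omega> (q, D) = (\<Sum>i<n. g i q * (\<Prod>j<m. D (f i j)))"
    by (elim exE conjE) blast
  have "form_near k z (\<lambda>w \<alpha> \<beta>. g i (psi b w) * (\<Prod>j<k. tv b w \<alpha> \<beta> (f i j)))" if i: "i < n" and "k \<le> m" for i k
    using \<open>k \<le> m\<close>
  proof (induction k)
    case 0
    have "regular_on (psi b -` V') (\<lambda>z. g i (psi b z))" "z \<in> psi b -` V'"
      using gf(1)[OF i] V'(2) by (simp_all add: regular_functions_A1_iff[OF V'(1)])
    from bspec[OF this(1)[unfolded regular_on_def] this(2)] obtain P Q where
      PQ: "ev Q z \<noteq> 0" "\<forall>w. ev Q w \<noteq> 0 \<longrightarrow> w \<in> psi b -` V' \<and> g i (psi b w) = ev P w / ev Q w" by (elim exE conjE)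
    show ?case
    proof (rule form_nearI[of Q _ _ _ "\<lambda>_. P"])
      fix w \<alpha> \<beta> assume "ev Q w \<noteq> 0"
      from PQ(2)[rule_format, OF this]
      show "g i (psi b w) * (\<Prod>j<0. tv b w \<alpha> \<beta> (f i j)) = homf 0 (\<lambda>l. ev P w / ev Q w) \<alpha> \<beta>"
        by (simp add: homf_def)
    qed (rule PQ(1))
  next
    case (Suc k)
    then have k: "k < m" by simp
    from O_has_derivative[OF V'(1,2) gf(2)[OF i k]] obtain A B Q where Q: "ev Q z \<noteq> 0" and
      D: "\<forall>w. ev Q w \<noteq> 0 \<longrightarrow> psi b w \<in> V' \<and> (\<forall>\<alpha> \<beta>.
       ((\<lambda>t. f i k (psi b (fst w + t * \<alpha>, snd w + t * \<beta>))) has_field_derivative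
       (ev A w * \<alpha> + ev B w * \<beta>) / ev Q w) (at 0))" by (elim exE conjE)
    have "tv b w \<alpha> \<beta> (f i k) = (ev A w * \<alpha> + ev B w * \<beta>) / ev Q w" if "ev Q w \<noteq> 0" for w \<alpha> \<beta>
      using D[rule_format, OF that, THEN conjunct2, rule_format] D[rule_format, OF that, THEN conjunct1]
      by (intro tv_eqI[OF V'(1) _ gf(2)[OF i k]])
    from form_near_mult_linear[OF Suc.IH Q this] k show ?case by (simp add: mult.assoc)
  qed
  then have "form_near m z (\<lambda>w \<alpha> \<beta>. g i (psi b w) * (\<Prod>j<m. tv b w \<alpha> \<beta> (f i j)))" if "i < n" for i
    using that by blast
  then have "form_near m z (\<lambda>w \<alpha> \<beta>. \<Sum>i<n. g i (psi b w) * (\<Prod>j<m. tv b w \<alpha> \<beta> (f i j)))"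
    by (intro form_near_sum) simp
  from form_nearD[OF this] obtain P Q where PQ: "ev Q z \<noteq> 0"
    "\<forall>w \<alpha> \<beta>. ev Q w \<noteq> 0 \<longrightarrow> (\<Sum>i<n. g i (psi b w) * (\<Prod>j<m. tv b w \<alpha> \<beta> (f i j))) =
       homf m (\<lambda>l. ev (P l) w / ev Q w) \<alpha> \<beta>" by (elim exE conjE)
  from zopenD[OF zopen_vimage_psi[OF V'(1)], of z b] V'(2) obtain R where
    R: "ev R z \<noteq> 0" "{w. ev R w \<noteq> 0} \<subseteq> psi b -` V'" by (metis vimageI2)
  show ?thesis
    unfolding form_at_def
  proof (rule exI[of _ "\<lambda>l. P l * R"], rule exI[of _ "Q * R"], intro conjI allI impI)
    show "ev (Q * R) z \<noteq> 0" using PQ R by simp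
    fix w assume "ev (Q * R) w \<noteq> 0"
    then have nz: "ev Q w \<noteq> 0" "ev R w \<noteq> 0" by simp_all
    then have w: "psi b w \<in> V'" using R(2) by blast
    then show "psi b w \<in> V" using V'(3) by blast
    fix \<alpha> \<beta>
    show "\<omega> (psi b w, tv b w \<alpha> \<beta>) = homf m (\<lambda>l. ev (P l * R) w / ev (Q * R) w) \<alpha> \<beta>"
      unfolding eq[rule_format, OF w tangent_tv] PQ(2)[rule_format, OF nz(1)]
      using nz by (intro homf_cong) simp
  qed
qed

text \<open>Writes \<open>du^(m-l) dv^l\<close> as a product over \<open>j < m\<close>, the shape
  required by the definition of symmetric differentials: the first \<open>m - l\<close> factors are
  \<open>du\<close>, the others \<open>dv\<close>.\<close>

lemma prod_threshold: "(\<Prod>j<m. if j < m - l then x else y) = x ^ (m - l) * y ^ l" if "l \<le> m" for x y :: complex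
proof -
  have "{..<m} \<inter> {j. j < m - l} = {..<m - l}" "{..<m} \<inter> - {j. j < m - l} = {m - l..<m}" by auto
  then have "(\<Prod>j<m. if j < m - l then x else y) = (\<Prod>j<m - l. x) * (\<Prod>j\<in>{m - l..<m}. y)"
    by (subst prod.If_cases) auto
  then show ?thesis using that by simp
qed

text \<open>The definition is met with \<open>m + 1\<close> summands: the functions
  \<open>P l / Q\<close> times products of coordinate differentials, all restricted to one principal
  neighbourhood.\<close>

lemma F_intro:
  assumes off: "\<And>q D. \<not> (q \<in> V \<and> tangent q D) \<Longrightarrow> \<omega> (q, D) = 0"
    and loc: "\<And>p. p \<in> V \<Longrightarrow> \<exists>b z. p = psi b z \<and> form_at m b V \<omega> z"
  shows "\<omega> \<in> F m V"
  unfolding A1_sym_cotangent_def symmetric_differentials_def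
proof (intro CollectI conjI allI impI ballI)
  show "\<not> (q \<in> V \<and> tangent q D) \<Longrightarrow> \<omega> (q, D) = 0" for q D by (rule off)
  fix p assume "p \<in> V"
  from loc[OF this] obtain b z where p: "p = psi b z" "form_at m b V \<omega> z" by blast
  from p(2)[unfolded form_at_def] obtain P Q where Q: "ev Q z \<noteq> 0" and
    PQ: "\<forall>w. ev Q w \<noteq> 0 \<longrightarrow> psi b w \<in> V \<and>
     (\<forall>\<alpha> \<beta>. \<omega> (psi b w, tv b w \<alpha> \<beta>) = homf m (\<lambda>l. ev (P l) w / ev Q w) \<alpha> \<beta>)" by (elim exE conjE)
  let ?W = "psi b ` {w. ev Q w \<noteq> 0}"
  have W: "openin A1_resolution ?W" "p \<in> ?W" "?W \<subseteq> V" "?W \<subseteq> range (psi b)"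
    using p Q openin_A1_image by (blast, blast, use PQ in blast, blast)
  define g where "g = (\<lambda>l q. restr ?W (crd b (P l)) q / restr ?W (crd b Q) q)"
  define f where "f = (\<lambda>(l::nat) j. restr ?W (crd b (if j < m - l then pU else pV)))"
  have rc: "restr ?W (crd b R) \<in> \<O> ?W" for R by (rule O_restr[OF openin_range_psi W(1,4) crd_regular])
  have A: "g l \<in> \<O> ?W" for l
    unfolding g_def by (intro O_divide[OF W(1)] rc) (auto simp: restr_def)
  have B: "f l j \<in> \<O> ?W" for l j unfolding f_def by (rule rc)
  have C: "\<omega> (q, D) = (\<Sum>i<Suc m. g i q * (\<Prod>j<m. D (f i j)))" if q: "q \<in> ?W" "tangent q D" for q D
  proof -
    obtain w where w: "q = psi b w" "ev Q w \<noteq> 0" using q(1) by blast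
    have Df: "D (f i j) = (if j < m - i then D (crd b pU) else D (crd b pV))" for i j
      unfolding f_def using tangent_restr[OF q(2) openin_range_psi crd_regular W(1) q(1) W(4)] by simp
    have gq: "g i q = ev (P i) w / ev Q w" for i
      using q(1) unfolding g_def restr_def w(1) by simp
    have "D = tv b w (D (crd b pU)) (D (crd b pV))" using q(2) tangent_unique unfolding w(1) by blast
    then have "\<omega> (q, D) = homf m (\<lambda>l. ev (P l) w / ev Q w) (D (crd b pU)) (D (crd b pV))"
      using PQ[rule_format, OF w(2)] unfolding w(1) by metis
    also have "\<dots> = (\<Sum>i<Suc m. g i q * (\<Prod>j<m. D (f i j)))"
      unfolding homf_def lessThan_Suc_atMost Df gq
      by (intro sum.cong) (simp_all add: prod_threshold)
    finally show ?thesis .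
  qed
  show "\<exists>V' (n::nat) g f. openin A1_resolution V' \<and> p \<in> V' \<and> V' \<subseteq> V \<and>
        (\<forall>i<n. g i \<in> \<O> V' \<and> (\<forall>j<m. f i j \<in> \<O> V')) \<and>
        (\<forall>q\<in>V'. \<forall>D. tangent q D \<longrightarrow> \<omega> (q, D) = (\<Sum>i<n. g i q * (\<Prod>j<m. D (f i j))))"
    by (rule exI[of _ ?W], rule exI[of _ "Suc m"], rule exI[of _ g], rule exI[of _ f],
        intro conjI allI impI ballI W(1-3) A B) (rule C)
qed

lemma F_eqI:
  assumes "\<omega> \<in> F m V" "\<omega>' \<in> F m V" "V \<subseteq> Y"
    "\<And>b z \<alpha> \<beta>. psi b z \<in> V \<Longrightarrow> \<omega> (psi b z, tv b z \<alpha> \<beta>) = \<omega>' (psi b z, tv b z \<alpha> \<beta>)"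
  shows "\<omega> = \<omega>'"
proof (rule ext)
  fix x
  show "\<omega> x = \<omega>' x"
  proof (cases x)
    case x: (Pair q D)
    show ?thesis
    proof (cases "q \<in> V \<and> tangent q D")
      case True
      then have "q \<in> Y" using assms(3) by blast
      then obtain b z where q: "q = psi b z" by (rule Y_cases)
      with True have "D = tv b z (D (crd b pU)) (D (crd b pV))" by (intro tangent_unique) simp
      then show ?thesis using assms(4)[of b z "D (crd b pU)" "D (crd b pV)"] True unfolding x q by simp
    next
      case False
      then show ?thesis unfolding x using F_off[OF assms(1) False] F_off[OF assms(2) False] by simp
    qed
  qed
qed

lemma form_at_cong:
  assumes "form_at m b V \<omega> z" "openin A1_resolution W" "psi b z \<in> W"
    "\<And>w \<alpha> \<beta>. psi b w \<in> W \<Longrightarrow> psi b w \<in> V \<Longrightarrow> psi b w \<in> V' \<and> \<omega>' (psi b w, tv b w \<alpha> \<beta>) = \<omega> (psi b w, tv b w \<alpha> \<beta>)"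
  shows "form_at m b V' \<omega>' z"
proof -
  from assms(1)[unfolded form_at_def] obtain P Q where Q: "ev Q z \<noteq> 0" and
    PQ: "\<forall>w. ev Q w \<noteq> 0 \<longrightarrow> psi b w \<in> V \<and>
     (\<forall>\<alpha> \<beta>. \<omega> (psi b w, tv b w \<alpha> \<beta>) = homf m (\<lambda>l. ev (P l) w / ev Q w) \<alpha> \<beta>)" by (elim exE conjE)
  from zopenD[OF zopen_vimage_psi[OF assms(2)], of z b] assms(3) obtain R where
    R: "ev R z \<noteq> 0" "{w. ev R w \<noteq> 0} \<subseteq> psi b -` W" by (metis vimageI2)
  show ?thesis
    unfolding form_at_def
  proof (rule exI[of _ "\<lambda>l. P l * R"], rule exI[of _ "Q * R"], intro conjI allI impI)
    show "ev (Q * R) z \<noteq> 0" using Q R by simp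
    fix w assume "ev (Q * R) w \<noteq> 0"
    then have nz: "ev Q w \<noteq> 0" "ev R w \<noteq> 0" by simp_all
    then have w: "psi b w \<in> W" using R(2) by blast
    have V: "psi b w \<in> V" using PQ[rule_format, OF nz(1)] by (rule conjunct1)
    show "psi b w \<in> V'" using assms(4)[OF w V] by blast
    fix \<alpha> \<beta>
    have "\<omega>' (psi b w, tv b w \<alpha> \<beta>) = homf m (\<lambda>l. ev (P l) w / ev Q w) \<alpha> \<beta>"
      using assms(4)[OF w V, of \<alpha> \<beta>] PQ[rule_format, OF nz(1)] by simp
    also have "\<dots> = homf m (\<lambda>l. ev (P l * R) w / ev (Q * R) w) \<alpha> \<beta>"
      using nz by (intro homf_cong) simp
    finally show "\<omega>' (psi b w, tv b w \<alpha> \<beta>) = homf m (\<lambda>l. ev (P l * R) w / ev (Q * R) w) \<alpha> \<beta>" .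
  qed
qed

lemma F_local:
  assumes off: "\<And>q D. \<not> (q \<in> V \<and> tangent q D) \<Longrightarrow> \<omega> (q, D) = 0" and V: "V \<subseteq> Y"
    and loc: "\<And>p. p \<in> V \<Longrightarrow> \<exists>W V' \<omega>'. openin A1_resolution W \<and> p \<in> W \<and> p \<in> V' \<and> \<omega>' \<in> F m V' \<and>
      (\<forall>q\<in>W \<inter> V'. q \<in> V \<and> (\<forall>D. tangent q D \<longrightarrow> \<omega> (q, D) = \<omega>' (q, D)))"
  shows "\<omega> \<in> F m V"
proof (rule F_intro)
  show "\<not> (q \<in> V \<and> tangent q D) \<Longrightarrow> \<omega> (q, D) = 0" for q D by (rule off)
  fix p assume p: "p \<in> V"
  from loc[OF this] obtain W V' \<omega>' where *: "openin A1_resolution W" "p \<in> W" "p \<in> V'" "\<omega>' \<in> F m V'"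
    "\<forall>q\<in>W \<inter> V'. q \<in> V \<and> (\<forall>D. tangent q D \<longrightarrow> \<omega> (q, D) = \<omega>' (q, D))" by (elim exE conjE)
  from p V have "p \<in> Y" by blast
  then obtain b z where z: "p = psi b z" by (rule Y_cases)
  have "form_at m b V \<omega> z"
  proof (rule form_at_cong[OF F_form_at[OF *(4)] *(1)])
    show "psi b z \<in> V'" "psi b z \<in> W" using * z by simp_all
    fix w \<alpha> \<beta> assume "psi b w \<in> W" "psi b w \<in> V'"
    then show "psi b w \<in> V \<and> \<omega> (psi b w, tv b w \<alpha> \<beta>) = \<omega>' (psi b w, tv b w \<alpha> \<beta>)"
      using *(5) tangent_tv[of b w \<alpha> \<beta>] by blast
  qed
  with z show "\<exists>b z. p = psi b z \<and> form_at m b V \<omega> z" by blast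
qed

lemma F_restrict:
  assumes "\<omega> \<in> F m V" "openin A1_resolution W" "W \<subseteq> V"
  shows "restrict_section W \<omega> \<in> F m W"
proof (rule F_local)
  show "W \<subseteq> Y" using assms(2) by (rule openin_subset)
  show "\<not> (q \<in> W \<and> tangent q D) \<Longrightarrow> restrict_section W \<omega> (q, D) = 0" for q D
    using F_off[OF assms(1), of q D] by (auto simp: restrict_section_def)
  fix p assume "p \<in> W"
  then show "\<exists>W' V' \<omega>'. openin A1_resolution W' \<and> p \<in> W' \<and> p \<in> V' \<and> \<omega>' \<in> F m V' \<and>
      (\<forall>q\<in>W' \<inter> V'. q \<in> W \<and> (\<forall>D. tangent q D \<longrightarrow> restrict_section W \<omega> (q, D) = \<omega>' (q, D)))"
    using assms by (intro exI[of _ W] exI[of _ V] exI[of _ \<omega>]) (auto simp: restrict_section_def)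
qed

section \<open>Coefficients of forms in a chart\<close>

text \<open>The values on all tangent vectors at a point determine the coefficients there by
  \<open>homf_unique\<close>. A pointwise choice therefore agrees with every local representation
  and is regular.\<close>

lemma F_coeffs:
  assumes \<omega>: "\<omega> \<in> F m V"
  shows "\<exists>a. (\<forall>l\<le>m. regular_on (psi b -` V) (a l)) \<and>
     (\<forall>z \<alpha> \<beta>. psi b z \<in> V \<longrightarrow> \<omega> (psi b z, tv b z \<alpha> \<beta>) = homf m (\<lambda>l. a l z) \<alpha> \<beta>)"
proof -
  have fa: "\<exists>P Q. ev Q z \<noteq> 0 \<and> (\<forall>w. ev Q w \<noteq> 0 \<longrightarrow> psi b w \<in> V \<and>
     (\<forall>\<alpha> \<beta>. \<omega> (psi b w, tv b w \<alpha> \<beta>) = homf m (\<lambda>l. ev (P l) w / ev Q w) \<alpha> \<beta>))" if "psi b z \<in> V" for z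
    using F_form_at[OF \<omega> that] unfolding form_at_def .
  have "\<exists>a. psi b z \<in> V \<longrightarrow> (\<forall>\<alpha> \<beta>. \<omega> (psi b z, tv b z \<alpha> \<beta>) = homf m a \<alpha> \<beta>)" for z
  proof (cases "psi b z \<in> V")
    case True
    from fa[OF this] obtain P Q where "ev Q z \<noteq> 0" "\<forall>w. ev Q w \<noteq> 0 \<longrightarrow> psi b w \<in> V \<and>
     (\<forall>\<alpha> \<beta>. \<omega> (psi b w, tv b w \<alpha> \<beta>) = homf m (\<lambda>l. ev (P l) w / ev Q w) \<alpha> \<beta>)" by (elim exE conjE)
    from this(2)[rule_format, OF this(1)] show ?thesis by (intro exI[of _ "\<lambda>l. ev (P l) z / ev Q z"]) simp
  qed simp
  then obtain a where a: "\<And>z \<alpha> \<beta>. psi b z \<in> V \<Longrightarrow> \<omega> (psi b z, tv b z \<alpha> \<beta>) = homf m (a z) \<alpha> \<beta>" by metis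
  have "regular_on (psi b -` V) (\<lambda>z. a z l)" if l: "l \<le> m" for l
    unfolding regular_on_def
  proof
    fix z assume "z \<in> psi b -` V"
    then have "psi b z \<in> V" by simp
    from fa[OF this] obtain P Q where Q: "ev Q z \<noteq> 0" and PQ: "\<forall>w. ev Q w \<noteq> 0 \<longrightarrow> psi b w \<in> V \<and>
     (\<forall>\<alpha> \<beta>. \<omega> (psi b w, tv b w \<alpha> \<beta>) = homf m (\<lambda>l. ev (P l) w / ev Q w) \<alpha> \<beta>)" by (elim exE conjE)
    have h: "w \<in> psi b -` V \<and> a w l = ev (P l) w / ev Q w" if w: "ev Q w \<noteq> 0" for w
    proof -
      note * = PQ[rule_format, OF w]
      then have V: "psi b w \<in> V" by blast
      have "homf m (a w) \<alpha> \<beta> = homf m (\<lambda>l. ev (P l) w / ev Q w) \<alpha> \<beta>" for \<alpha> \<beta>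
        using a[OF V, of \<alpha> \<beta>] * by simp
      from homf_unique[OF this l] V show ?thesis by simp
    qed
    show "\<exists>P Q. ev Q z \<noteq> 0 \<and> (\<forall>w. ev Q w \<noteq> 0 \<longrightarrow> w \<in> psi b -` V \<and> a w l = ev P w / ev Q w)"
      by (rule_tac exI[of _ "P l"], rule_tac exI[of _ Q], rule_tac conjI[OF Q], intro allI impI) (rule h)
  qed
  then show ?thesis using a by (intro exI[of _ "\<lambda>l z. a z l"]) simp
qed

text \<open>The inverse of \<open>F_coeffs\<close>: the components of \<open>D\<close> are recovered
  as its values on the two coordinate functions.\<close>

definition mkform :: "nat \<Rightarrow> bool \<Rightarrow> (complex \<times> complex) set \<Rightarrow> (nat \<Rightarrow> complex \<times> complex \<Rightarrow> complex) \<Rightarrow>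
    ((complex^3) \<times> (complex^3) set) \<times> (((complex^3) \<times> (complex^3) set \<Rightarrow> complex) \<Rightarrow> complex) \<Rightarrow> complex" where
  "mkform m b S a = (\<lambda>(q, D). if q \<in> psi b ` S \<and> tangent q D
     then homf m (\<lambda>l. a l (unpsi b q)) (D (crd b pU)) (D (crd b pV)) else 0)"

lemma mkform_psi: "z \<in> S \<Longrightarrow> mkform m b S a (psi b z, tv b z \<alpha> \<beta>) = homf m (\<lambda>l. a l z) \<alpha> \<beta>"
  by (simp add: mkform_def tangent_tv)

lemma regular_on_common_denominator:
  assumes "\<And>l. l \<le> (m::nat) \<Longrightarrow> regular_on S (a l)" "z \<in> S"
  shows "\<exists>P Q. ev Q z \<noteq> 0 \<and> (\<forall>w. ev Q w \<noteq> 0 \<longrightarrow> w \<in> S \<and> (\<forall>l\<le>m. a l w = ev (P l) w / ev Q w))"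
  using assms(1)
proof (induction m)
  case 0
  from bspec[OF 0[of 0, unfolded regular_on_def] assms(2)] obtain P Q where
    "ev Q z \<noteq> 0" "\<forall>w. ev Q w \<noteq> 0 \<longrightarrow> w \<in> S \<and> a 0 w = ev P w / ev Q w" by auto
  then show ?case by (intro exI[of _ "\<lambda>_. P"] exI[of _ Q]) simp
next
  case (Suc m)
  from Suc obtain P Q where PQ: "ev Q z \<noteq> 0" "\<forall>w. ev Q w \<noteq> 0 \<longrightarrow> w \<in> S \<and> (\<forall>l\<le>m. a l w = ev (P l) w / ev Q w)"
    by (metis le_Suc_eq)
  from bspec[OF Suc.prems[of "Suc m", unfolded regular_on_def] assms(2)] obtain P' Q' where
    PQ': "ev Q' z \<noteq> 0" "\<forall>w. ev Q' w \<noteq> 0 \<longrightarrow> w \<in> S \<and> a (Suc m) w = ev P' w / ev Q' w" by auto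
  show ?case
  proof (rule exI[of _ "\<lambda>l. if l \<le> m then P l * Q' else P' * Q"], rule exI[of _ "Q * Q'"], intro conjI allI impI)
    show "ev (Q * Q') z \<noteq> 0" using PQ(1) PQ'(1) by simp
    fix w assume "ev (Q * Q') w \<noteq> 0"
    then have nz: "ev Q w \<noteq> 0" "ev Q' w \<noteq> 0" by simp_all
    show "w \<in> S" using PQ(2)[rule_format, OF nz(1)] by blast
    fix l assume "l \<le> Suc m"
    then show "a l w = ev (if l \<le> m then P l * Q' else P' * Q) w / ev (Q * Q') w"
      using PQ(2)[rule_format, OF nz(1)] PQ'(2)[rule_format, OF nz(2)] nz by (auto simp: le_Suc_eq)
  qed
qed

lemma mkform_F:
  assumes "\<And>l. l \<le> m \<Longrightarrow> regular_on S (a l)"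
  shows "mkform m b S a \<in> F m (psi b ` S)"
proof (rule F_intro)
  show "\<not> (q \<in> psi b ` S \<and> tangent q D) \<Longrightarrow> mkform m b S a (q, D) = 0" for q D
    by (auto simp: mkform_def)
  fix p assume "p \<in> psi b ` S"
  then obtain z where z: "p = psi b z" "z \<in> S" by blast
  have "\<exists>P Q. ev Q z \<noteq> 0 \<and> (\<forall>w. ev Q w \<noteq> 0 \<longrightarrow> w \<in> S \<and> (\<forall>l\<le>m. a l w = ev (P l) w / ev Q w))"
    by (rule regular_on_common_denominator[OF assms z(2)])
  then obtain P Q where Q: "ev Q z \<noteq> 0" and
    PQ: "\<forall>w. ev Q w \<noteq> 0 \<longrightarrow> w \<in> S \<and> (\<forall>l\<le>m. a l w = ev (P l) w / ev Q w)" by (elim exE conjE)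
  have h: "psi b w \<in> psi b ` S \<and> (\<forall>\<alpha> \<beta>. mkform m b S a (psi b w, tv b w \<alpha> \<beta>) =
      homf m (\<lambda>l. ev (P l) w / ev Q w) \<alpha> \<beta>)" if w: "ev Q w \<noteq> 0" for w
  proof -
    have *: "w \<in> S" "\<And>l. l \<le> m \<Longrightarrow> a l w = ev (P l) w / ev Q w" using PQ[rule_format, OF w] by simp_all
    show ?thesis unfolding mkform_psi[OF *(1)] using *(1) by (auto intro: homf_cong *(2))
  qed
  have "form_at m b (psi b ` S) (mkform m b S a) z"
    unfolding form_at_def
    by (rule exI[of _ P], rule exI[of _ Q], rule conjI[OF Q], intro allI impI) (rule h)
  with z(1) show "\<exists>b' z. p = psi b' z \<and> form_at m b' (psi b ` S) (mkform m b S a) z" by blast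
qed

lemma F_linear:
  assumes "openin A1_resolution V" "\<omega> \<in> F m V" "\<omega>' \<in> F m V"
  shows "(\<lambda>x. c * \<omega> x + d * \<omega>' x) \<in> F m V"
proof (rule F_intro)
  show "\<not> (q \<in> V \<and> tangent q D) \<Longrightarrow> c * \<omega> (q, D) + d * \<omega>' (q, D) = 0" for q D
    using F_off[OF assms(2), of q D] F_off[OF assms(3), of q D] by simp
  fix p assume p: "p \<in> V"
  then have "p \<in> Y" using openin_subset[OF assms(1)] by blast
  then obtain b z where z: "p = psi b z" by (rule Y_cases)
  from F_coeffs[OF assms(2), of b] F_coeffs[OF assms(3), of b] obtain a a' where
    a: "\<forall>l\<le>m. regular_on (psi b -` V) (a l)"
      "\<forall>z \<alpha> \<beta>. psi b z \<in> V \<longrightarrow> \<omega> (psi b z, tv b z \<alpha> \<beta>) = homf m (\<lambda>l. a l z) \<alpha> \<beta>" and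
    a': "\<forall>l\<le>m. regular_on (psi b -` V) (a' l)"
      "\<forall>z \<alpha> \<beta>. psi b z \<in> V \<longrightarrow> \<omega>' (psi b z, tv b z \<alpha> \<beta>) = homf m (\<lambda>l. a' l z) \<alpha> \<beta>" by (elim exE conjE)
  have zo: "zopen (psi b -` V)" by (rule zopen_vimage_psi[OF assms(1)])
  have "regular_on (psi b -` V) (\<lambda>z. c * a l z + d * a' l z)" if "l \<le> m" for l
    using that a(1) a'(1) by (intro regular_on_add regular_on_mult regular_on_const zo) simp_all
  then have M: "mkform m b (psi b -` V) (\<lambda>l z. c * a l z + d * a' l z) \<in> F m (psi b ` (psi b -` V))"
    by (rule mkform_F)
  have "form_at m b V (\<lambda>x. c * \<omega> x + d * \<omega>' x) z"
  proof (rule form_at_cong[OF F_form_at[OF M] assms(1)])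
    show "psi b z \<in> psi b ` (psi b -` V)" "psi b z \<in> V" using p z by simp_all
    fix w \<alpha> \<beta> assume "psi b w \<in> V"
    then show "psi b w \<in> V \<and> c * \<omega> (psi b w, tv b w \<alpha> \<beta>) + d * \<omega>' (psi b w, tv b w \<alpha> \<beta>) =
       mkform m b (psi b -` V) (\<lambda>l z. c * a l z + d * a' l z) (psi b w, tv b w \<alpha> \<beta>)"
      by (simp add: mkform_psi a(2) a'(2) homf_add homf_scale)
  qed
  with z show "\<exists>b z. p = psi b z \<and> form_at m b V (\<lambda>x. c * \<omega> x + d * \<omega>' x) z" by blast
qed

lemma F_zero:
  assumes V: "openin A1_resolution V"
  shows "(\<lambda>_. 0) \<in> F m V"
proof (rule F_intro)
  fix p assume p: "p \<in> V"
  then have "p \<in> Y" using openin_subset[OF V] by blast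
  then obtain b z where z: "p = psi b z" by (rule Y_cases)
  with zopenD[OF zopen_vimage_psi[OF V], of z b] p obtain Q where
    Q: "ev Q z \<noteq> 0" "{w. ev Q w \<noteq> 0} \<subseteq> psi b -` V" by (metis vimageI2)
  have "form_at m b V (\<lambda>_. 0) z"
    unfolding form_at_def
  proof (rule exI[of _ "\<lambda>_. 0"], rule exI[of _ Q], intro conjI allI impI)
    show "ev Q z \<noteq> 0" by (rule Q(1))
    show "psi b w \<in> V" if "ev Q w \<noteq> 0" for w using Q(2) that by blast
  qed (simp add: homf_def)
  with z show "\<exists>b z. p = psi b z \<and> form_at m b V (\<lambda>_. 0) z" by blast
qed simp

section \<open>Weight decomposition on the torus\<close>

text \<open>On the torus \<open>u, v \<noteq> 0\<close> of chart \<open>False\<close> a form is evaluated at the tangent vectors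
  \<open>u (1 - y) \<partial>\<^sub>u + 2 v y \<partial>\<^sub>v\<close>. In the other chart they become \<open>- u (1 - y) \<partial>\<^sub>u + 2 v \<partial>\<^sub>v\<close>. In this
  parameter \<open>y\<close> the bases \<open>du\<^sup>m\<^sup>-\<^sup>l dv\<^sup>l\<close> of both charts and their regularity conditions become
  monomial conditions on polynomials in \<open>y\<close>.\<close>

definition vecA :: "bool \<Rightarrow> complex \<Rightarrow> complex \<Rightarrow> complex" where
  "vecA b u y = (if b then - u * (1 - y) else u * (1 - y))"

definition vecB :: "bool \<Rightarrow> complex \<Rightarrow> complex \<Rightarrow> complex" where
  "vecB b v y = (if b then 2 * v else 2 * v * y)"

definition tval where
  "tval b \<omega> u v y = \<omega> (psi b (u, v), tv b (u, v) (vecA b u y) (vecB b v y))"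

text \<open>The value on the test vectors of the logarithmic monomial
  \<open>(du/u)^(m-l) (dv/v)^l\<close> in the coordinates of chart \<open>b\<close>: the two factors
  are \<open>1 - y\<close> and \<open>2 y\<close> in chart \<open>False\<close>,
  \<open>y - 1\<close> and \<open>2\<close> in chart \<open>True\<close>.\<close>

definition bas :: "nat \<Rightarrow> bool \<Rightarrow> nat \<Rightarrow> complex poly" where
  "bas m b l = (if b then [:- 1, 1:] ^ (m - l) * [:2:] ^ l else [:1, - 1:] ^ (m - l) * [:0, 2:] ^ l)"

definition fsupp :: "(int \<times> int \<Rightarrow> complex poly) \<Rightarrow> bool" where
  "fsupp q \<longleftrightarrow> finite {p. q p \<noteq> 0}"

text \<open>A Laurent polynomial in \<open>u\<close> and \<open>v\<close> over the polynomials in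
  \<open>y\<close>; \<open>q (i, j)\<close> is the part of weight \<open>(i, j)\<close>, where
  \<open>du\<close> and \<open>dv\<close> have the weights of \<open>u\<close> and
  \<open>v\<close>.\<close>

definition gsum :: "(int \<times> int \<Rightarrow> complex poly) \<Rightarrow> complex \<Rightarrow> complex \<Rightarrow> complex \<Rightarrow> complex" where
  "gsum q u v y = (\<Sum>p | q p \<noteq> 0. poly (q p) y * u powi fst p * v powi snd p)"

definition gexp where
  "gexp b \<omega> q \<longleftrightarrow> fsupp q \<and> (\<forall>u v y. u \<noteq> 0 \<longrightarrow> v \<noteq> 0 \<longrightarrow> tval b \<omega> u v y = gsum q u v y)"

lemma homf_vec: "homf m a (vecA b u y) (vecB b v y) = (\<Sum>l\<le>m. a l * u ^ (m - l) * v ^ l * poly (bas m b l) y)"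
proof -
  define x w where "x = (if b then y - 1 else 1 - y)" and "w = (if b then 2 else 2 * y)"
  have "vecA b u y = u * x" "vecB b v y = v * w"
    by (cases b; simp add: vecA_def vecB_def x_def w_def algebra_simps)+
  moreover have "poly (bas m b l) y = x ^ (m - l) * w ^ l" for l
    by (cases b) (simp_all add: bas_def x_def w_def poly_power mult.commute)
  ultimately show ?thesis unfolding homf_def by (simp add: power_mult_distrib mult_ac)
qed

text \<open>Under \<open>tv_flip\<close> the test vectors of the two charts correspond to each other
  with the same \<open>y\<close>, so both charts describe a form by the same polynomials.\<close>

lemma tval_flip:
  assumes "u \<noteq> 0"
  shows "tval False \<omega> u v y = tval True \<omega> (1 / u) (u\<^sup>2 * v) y"
proof -
  have "- vecA False u y / u\<^sup>2 = vecA True (1 / u) y"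
    using assms by (simp add: vecA_def power2_eq_square field_simps)
  moreover have "2 * u * v * vecA False u y + u\<^sup>2 * vecB False v y = vecB True (u\<^sup>2 * v) y"
    by (simp add: vecA_def vecB_def power2_eq_square algebra_simps)
  ultimately show ?thesis
    using psi_flip[of "(u, v)" False] tv_flip[of "(u, v)" False "vecA False u y" "vecB False v y"] assms
    by (simp add: tval_def)
qed

lemma gsum_superset: "finite A \<Longrightarrow> {p. q p \<noteq> 0} \<subseteq> A \<Longrightarrow>
    gsum q u v y = (\<Sum>p\<in>A. poly (q p) y * u powi fst p * v powi snd p)"
  unfolding gsum_def by (rule sum.mono_neutral_left) auto

lemma fsupp_linear: "fsupp q \<Longrightarrow> fsupp q' \<Longrightarrow> fsupp (\<lambda>p. smult c (q p) + smult d (q' p))"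
  unfolding fsupp_def by (rule finite_subset[of _ "{p. q p \<noteq> 0} \<union> {p. q' p \<noteq> 0}"]) auto

lemma gsum_linear:
  assumes "fsupp q" "fsupp q'"
  shows "gsum (\<lambda>p. smult c (q p) + smult d (q' p)) u v y = c * gsum q u v y + d * gsum q' u v y"
proof -
  let ?A = "{p. q p \<noteq> 0} \<union> {p. q' p \<noteq> 0}"
  have fin: "finite ?A" using assms by (simp add: fsupp_def)
  have "gsum (\<lambda>p. smult c (q p) + smult d (q' p)) u v y =
      (\<Sum>p\<in>?A. poly (smult c (q p) + smult d (q' p)) y * u powi fst p * v powi snd p)"
    by (rule gsum_superset[OF fin]) auto
  moreover have "gsum q u v y = (\<Sum>p\<in>?A. poly (q p) y * u powi fst p * v powi snd p)"
    "gsum q' u v y = (\<Sum>p\<in>?A. poly (q' p) y * u powi fst p * v powi snd p)"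
    by (rule gsum_superset[OF fin]; auto)+
  ultimately show ?thesis by (simp add: sum_distrib_left sum.distrib[symmetric] algebra_simps)
qed

lemma gexp_linear:
  "gexp b \<omega> q \<Longrightarrow> gexp b \<omega>' q' \<Longrightarrow> gexp b (\<lambda>x. c * \<omega> x + d * \<omega>' x) (\<lambda>p. smult c (q p) + smult d (q' p))"
  unfolding gexp_def tval_def by (simp add: fsupp_linear gsum_linear)

lemma ev_monom: "ev (monom (monom c a) b) (u, v) = c * u ^ a * v ^ b"
  by (simp add: ev_def poly_monom poly_power)

text \<open>For fixed \<open>y\<close>, multiplication by \<open>(u v)^N\<close> turns the sum into
  a polynomial that vanishes off the axes and hence is zero. Distinct weights contribute distinct
  monomials to it.\<close>

lemma gsum_eq_0_imp:
  assumes q: "fsupp q" and z: "\<And>u v y. u \<noteq> 0 \<Longrightarrow> v \<noteq> 0 \<Longrightarrow> gsum q u v y = 0"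
  shows "q p = 0"
proof (cases "q p = 0")
  case False
  let ?A = "{p. q p \<noteq> 0}"
  have fin: "finite ?A" using q by (simp add: fsupp_def)
  obtain N :: int where N: "\<And>p. p \<in> ?A \<Longrightarrow> 0 \<le> fst p + N \<and> 0 \<le> snd p + N"
  proof
    fix p assume p: "p \<in> ?A"
    have "\<bar>fst p\<bar> + \<bar>snd p\<bar> \<le> (\<Sum>p\<in>?A. \<bar>fst p\<bar> + \<bar>snd p\<bar>)"
      by (rule member_le_sum[OF p _ fin]) simp
    then show "0 \<le> fst p + (\<Sum>p\<in>?A. \<bar>fst p\<bar> + \<bar>snd p\<bar>) \<and> 0 \<le> snd p + (\<Sum>p\<in>?A. \<bar>fst p\<bar> + \<bar>snd p\<bar>)"
      by linarith
  qed
  have "poly (q p) y = 0" for y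
  proof -
    define R where "R = (\<Sum>p\<in>?A. monom (monom (poly (q p) y) (nat (fst p + N))) (nat (snd p + N)))"
    have "R = 0"
    proof (rule ev_eq_on_dense)
      show "pU * pV \<noteq> 0" by (simp add: pU_def pV_def)
      fix z assume "ev (pU * pV) z \<noteq> 0"
      moreover obtain u v where uv: "z = (u, v)" by (cases z)
      ultimately have nz: "u \<noteq> 0" "v \<noteq> 0" by simp_all
      have "ev R z = (\<Sum>p\<in>?A. poly (q p) y * u powi (fst p + N) * v powi (snd p + N))"
        unfolding R_def uv ev_sum ev_monom
      proof (rule sum.cong[OF refl])
        fix p assume "p \<in> ?A"
        then have "0 \<le> fst p + N" "0 \<le> snd p + N" using N by blast+
        then show "poly (q p) y * u ^ nat (fst p + N) * v ^ nat (snd p + N) =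
            poly (q p) y * u powi (fst p + N) * v powi (snd p + N)"
          by (simp add: power_int_def)
      qed
      also have "\<dots> = gsum q u v y * u powi N * v powi N"
        unfolding gsum_def sum_distrib_right using nz by (intro sum.cong) (simp_all add: power_int_add)
      finally show "ev R z = ev 0 z" using z[OF nz] by simp
    qed
    have inj: "nat (fst p' + N) = nat (fst p + N) \<and> nat (snd p' + N) = nat (snd p + N) \<longleftrightarrow> p' = p"
      if "p' \<in> ?A" for p'
      using N[OF that] N[of p] False by (auto simp: prod_eq_iff)
    have "coeff (coeff R (nat (snd p + N))) (nat (fst p + N)) =
        (\<Sum>p'\<in>?A. if p' = p then poly (q p) y else 0)"
      unfolding R_def coeff_sum
    proof (rule sum.cong[OF refl])
      fix p' assume "p' \<in> ?A"
      from inj[OF this] show "coeff (coeff (monom (monom (poly (q p') y) (nat (fst p' + N))) (nat (snd p' + N)))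
          (nat (snd p + N))) (nat (fst p + N)) = (if p' = p then poly (q p) y else 0)"
        by (auto simp: coeff_monom)
    qed
    also have "\<dots> = poly (q p) y" using fin False by simp
    finally show ?thesis using \<open>R = 0\<close> by simp
  qed
  then show ?thesis by (simp add: poly_all_0_iff_0[symmetric])
qed

lemma gexp_zero_imp:
  assumes "gexp b \<omega> q" "\<And>u v y. u \<noteq> 0 \<Longrightarrow> v \<noteq> 0 \<Longrightarrow> tval b \<omega> u v y = 0"
  shows "q p = 0"
  by (rule gsum_eq_0_imp) (use assms in \<open>auto simp: gexp_def\<close>)

lemma gexp_unique:
  assumes "gexp b \<omega> q" "gexp b \<omega> q'"
  shows "q = q'"
proof
  fix p
  have "gexp b (\<lambda>x. 1 * \<omega> x + (- 1) * \<omega> x) (\<lambda>p. smult 1 (q p) + smult (- 1) (q' p))"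
    by (rule gexp_linear[OF assms])
  from gexp_zero_imp[OF this, of p] show "q p = q' p" by (simp add: tval_def)
qed

lemma gsum_regroup:
  fixes r :: "'k \<Rightarrow> complex poly" and h :: "'k \<Rightarrow> int \<times> int"
  assumes "finite K"
  defines "q \<equiv> \<lambda>p. \<Sum>k | k \<in> K \<and> h k = p. r k"
  shows "fsupp q" "gsum q u v y = (\<Sum>k\<in>K. poly (r k) y * u powi fst (h k) * v powi snd (h k))"
proof -
  have sub: "{p. q p \<noteq> 0} \<subseteq> h ` K"
  proof
    fix p assume "p \<in> {p. q p \<noteq> 0}"
    then have "{k \<in> K. h k = p} \<noteq> {}" unfolding q_def by force
    then show "p \<in> h ` K" by auto
  qed
  then show "fsupp q" unfolding fsupp_def using assms(1) finite_subset by blast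
  have "gsum q u v y = (\<Sum>p\<in>h ` K. poly (q p) y * u powi fst p * v powi snd p)"
    using sub assms(1) by (intro gsum_superset) auto
  also have "\<dots> = (\<Sum>p\<in>h ` K. \<Sum>k | k \<in> K \<and> h k = p. poly (r k) y * u powi fst (h k) * v powi snd (h k))"
    unfolding q_def poly_sum sum_distrib_right by (intro sum.cong) auto
  also have "\<dots> = (\<Sum>k\<in>K. poly (r k) y * u powi fst (h k) * v powi snd (h k))"
    by (rule sum.image_gen[OF assms(1), symmetric])
  finally show "gsum q u v y = (\<Sum>k\<in>K. poly (r k) y * u powi fst (h k) * v powi snd (h k))" .
qed

text \<open>The conditions on the weight \<open>(i, j)\<close> part that express regularity along \<open>u = 0\<close> in the chart
  \<open>b\<close>, and along the exceptional curve \<open>v = 0\<close>.\<close>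

definition condU :: "nat \<Rightarrow> bool \<Rightarrow> int \<Rightarrow> complex poly \<Rightarrow> bool" where
  "condU m b i r \<longleftrightarrow> (if b then \<forall>n. i < int n \<longrightarrow> coeff r n = 0 else [:0, 1:] ^ nat (int m - i) dvd r)"

definition condV :: "nat \<Rightarrow> int \<Rightarrow> complex poly \<Rightarrow> bool" where
  "condV m j r \<longleftrightarrow> [:1, - 1:] ^ nat (int m - j) dvd r"

lemma condU_zero [simp]: "condU m b i 0" and condV_zero [simp]: "condV m j 0"
  by (simp_all add: condU_def condV_def)

lemma condU_add: "condU m b i r \<Longrightarrow> condU m b i s \<Longrightarrow> condU m b i (r + s)"
  and condU_smult: "condU m b i r \<Longrightarrow> condU m b i (smult c r)"
  and condV_add: "condV m j r \<Longrightarrow> condV m j s \<Longrightarrow> condV m j (r + s)"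
  and condV_smult: "condV m j r \<Longrightarrow> condV m j (smult c r)"
  by (auto simp: condU_def condV_def intro: dvd_smult split: if_splits)

lemma condU_sum: "(\<And>k. k \<in> A \<Longrightarrow> condU m b i (r k)) \<Longrightarrow> condU m b i (sum r A)"
  by (induction A rule: infinite_finite_induct) (simp_all add: condU_add)

lemma condV_sum: "(\<And>k. k \<in> A \<Longrightarrow> condV m j (r k)) \<Longrightarrow> condV m j (sum r A)"
  by (induction A rule: infinite_finite_induct) (simp_all add: condV_add)

lemma degree_bas: "degree (bas m b l) \<le> m" if "l \<le> m"
proof (cases b)
  case True
  have "degree ([:- 1, 1:] ^ (m - l) * [:2:] ^ l :: complex poly) \<le> (m - l) + 0"
    by (rule order.trans[OF degree_mult_le], rule add_mono) (simp_all add: degree_linear_power degree_power_eq)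
  then show ?thesis using True by (simp add: bas_def)
next
  case False
  have "degree ([:1, - 1:] ^ (m - l) * [:0, 2:] ^ l :: complex poly) \<le> (m - l) + l"
    by (rule order.trans[OF degree_mult_le], rule add_mono) (simp_all add: degree_power_eq)
  then show ?thesis using False that by (simp add: bas_def)
qed

text \<open>In chart \<open>False\<close> the factor \<open>(dv/v)^l\<close> contributes
  \<open>y^l\<close>, and \<open>l\<close> is at least \<open>m - i\<close>. In chart
  \<open>True\<close> only \<open>(du/u)^(m-l)\<close> has positive degree, namely
  \<open>m - l\<close>, which is at most \<open>i\<close>.\<close>

lemma condU_bas:
  assumes "l \<le> m" "int (m - l) \<le> i"
  shows "condU m b i (bas m b l)"
proof (cases b)
  case True
  have "degree ([:- 1, 1:] ^ (m - l) * [:2:] ^ l :: complex poly) \<le> (m - l) + 0"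
    by (rule order.trans[OF degree_mult_le], rule add_mono) (simp_all add: degree_linear_power degree_power_eq)
  then show ?thesis using True assms by (auto simp: condU_def bas_def intro!: coeff_eq_0)
next
  case False
  have "[:0, 1:] ^ nat (int m - i) dvd ([:0, 1:] :: complex poly) ^ l"
    using assms by (intro le_imp_power_dvd) auto
  also have "([:0, 1:] :: complex poly) ^ l dvd [:0, 2:] ^ l"
  proof (rule dvd_power_same)
    have "[:0, 2:] = smult 2 [:0, 1 :: complex:]" by simp
    then show "[:0, 1:] dvd [:0, 2 :: complex:]" by (metis dvd_refl dvd_smult)
  qed
  finally show ?thesis using False by (simp add: condU_def bas_def)
qed

lemma condV_bas:
  assumes "l \<le> m" "int l \<le> j"
  shows "condV m j (bas m b l)"
proof -
  have 1: "[:1, - 1:] ^ nat (int m - j) dvd ([:1, - 1:] :: complex poly) ^ (m - l)"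
    using assms by (intro le_imp_power_dvd) auto
  have 2: "([:1, - 1:] :: complex poly) ^ (m - l) dvd [:- 1, 1:] ^ (m - l)"
  proof (rule dvd_power_same)
    have "[:- 1, 1 :: complex:] = smult (- 1) [:1, - 1:]" by simp
    then show "[:1, - 1:] dvd [:- 1, 1 :: complex:]" by (metis dvd_refl dvd_smult)
  qed
  show ?thesis unfolding condV_def bas_def using 1 dvd_trans[OF 1 2] by (cases b) (simp_all add: dvd_mult2)
qed

lemma ev_as_sum: "\<exists>d c. \<forall>u v. ev P (u, v) = (\<Sum>(s, t)\<in>{..d} \<times> {..d}. c s t * u ^ s * v ^ t)"
proof -
  obtain d where d: "\<forall>i j. coeff (coeff P j) i \<noteq> 0 \<longrightarrow> i \<le> d \<and> j \<le> d" using poly2_bounded by blast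
  let ?M = "\<Sum>(s, t)\<in>{..d} \<times> {..d}. monom (monom (coeff (coeff P t) s) s) t"
  have "P = ?M"
  proof (rule poly2_eqI)
    fix i j
    have "coeff (coeff ?M j) i = (\<Sum>p\<in>{..d} \<times> {..d}. if p = (i, j) then coeff (coeff P j) i else 0)"
      unfolding coeff_sum by (intro sum.cong) (auto simp: coeff_monom split: if_splits)
    also have "\<dots> = (if (i, j) \<in> {..d} \<times> {..d} then coeff (coeff P j) i else 0)"
      by (subst sum.delta) simp_all
    also have "\<dots> = coeff (coeff P j) i" using d[rule_format, of j i] by auto
    finally show "coeff (coeff P j) i = coeff (coeff ?M j) i" by simp
  qed
  then have "ev P (u, v) = ev ?M (u, v)" for u v by (rule arg_cong)
  then have "ev P (u, v) = (\<Sum>(s, t)\<in>{..d} \<times> {..d}. coeff (coeff P t) s * u ^ s * v ^ t)" for u v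
    unfolding ev_sum by (simp add: case_prod_beta ev_monom)
  then show ?thesis by (intro exI[of _ d] exI[of _ "\<lambda>s t. coeff (coeff P t) s"]) blast
qed

text \<open>\<open>e\<^sub>1, e\<^sub>2 \<in> {0, 1}\<close> say whether \<open>u = 0\<close>, respectively \<open>v = 0\<close>, is removed from the chart.\<close>

lemma F_expansion:
  assumes \<omega>: "\<omega> \<in> F m V" and S: "psi b -` V = {z. ev (pU ^ e1 * pV ^ e2) z \<noteq> 0}"
  shows "\<exists>q. gexp b \<omega> q \<and> (\<forall>p. degree (q p) \<le> m \<and> (e1 = 0 \<longrightarrow> condU m b (fst p) (q p)) \<and>
     (e2 = 0 \<longrightarrow> condV m (snd p) (q p)))"
proof -
  from F_coeffs[OF \<omega>, of b] obtain a where
    a: "\<forall>l\<le>m. regular_on (psi b -` V) (a l)"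
      "\<forall>z \<alpha> \<beta>. psi b z \<in> V \<longrightarrow> \<omega> (psi b z, tv b z \<alpha> \<beta>) = homf m (\<lambda>l. a l z) \<alpha> \<beta>" by (elim exE conjE)
  define R where "R = (\<lambda>l n (d::nat) c. \<forall>u v. u \<noteq> 0 \<longrightarrow> v \<noteq> 0 \<longrightarrow> a l (u, v) =
      (\<Sum>(s, t)\<in>{..d} \<times> {..d}. c s t * u powi (int s - int (e1 * n)) * v powi (int t - int (e2 * n))))"
  have "\<exists>n d c. R l n d c" if l: "l \<le> m" for l
  proof -
    \<comment> \<open>A coefficient is a polynomial divided by a power of \<open>u^e1 v^e2\<close>,
      that is a Laurent polynomial without negative exponents of a variable whose \<open>e\<close>
      is 0.\<close>
    from regular_on_principal[OF a(1)[rule_format, OF l, unfolded S]] obtain P n where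
      P: "\<forall>z. ev (pU ^ e1 * pV ^ e2) z \<noteq> 0 \<longrightarrow> a l z = ev P z / ev (pU ^ e1 * pV ^ e2) z ^ n" by (elim exE)
    from ev_as_sum[of P] obtain d c where
      dc: "\<forall>u v. ev P (u, v) = (\<Sum>(s, t)\<in>{..d} \<times> {..d}. c s t * u ^ s * v ^ t)" by (elim exE)
    have "a l (u, v) = (\<Sum>(s, t)\<in>{..d} \<times> {..d}. c s t * u powi (int s - int (e1 * n)) * v powi (int t - int (e2 * n)))"
      if nz: "u \<noteq> 0" "v \<noteq> 0" for u v
    proof -
      have "a l (u, v) = ev P (u, v) / (u ^ e1 * v ^ e2) ^ n" using P nz by simp
      also have "\<dots> = (\<Sum>(s, t)\<in>{..d} \<times> {..d}. c s t * u ^ s * v ^ t / (u ^ e1 * v ^ e2) ^ n)"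
        unfolding dc[rule_format] by (simp add: sum_divide_distrib case_prod_beta)
      also have "\<dots> = (\<Sum>(s, t)\<in>{..d} \<times> {..d}. c s t * u powi (int s - int (e1 * n)) * v powi (int t - int (e2 * n)))"
      proof (intro sum.cong refl, clarify)
        fix s t
        have "u powi (int s - int (e1 * n)) = u ^ s / (u ^ e1) ^ n" "v powi (int t - int (e2 * n)) = v ^ t / (v ^ e2) ^ n"
          using nz by (simp_all add: power_int_diff power_mult del: of_nat_mult)
        then show "c s t * u ^ s * v ^ t / (u ^ e1 * v ^ e2) ^ n =
            c s t * u powi (int s - int (e1 * n)) * v powi (int t - int (e2 * n))"
          by (simp add: power_mult_distrib)
      qed
      finally show ?thesis .
    qed
    then have "R l n d c" unfolding R_def by blast
    then show ?thesis by blast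
  qed
  then obtain n d c where "\<And>l. l \<le> m \<Longrightarrow> R l (n l) (d l) (c l)" by metis
  then have dc: "\<And>l u v. l \<le> m \<Longrightarrow> u \<noteq> 0 \<Longrightarrow> v \<noteq> 0 \<Longrightarrow> a l (u, v) =
      (\<Sum>(s, t)\<in>{..d l::nat} \<times> {..d l}. c l s t * u powi (int s - int (e1 * n l)) * v powi (int t - int (e2 * n l)))"
    unfolding R_def by blast
  define K where "K = (SIGMA l:{..m}. {..d l} \<times> {..d l})"
  \<comment> \<open>The weight of a term: the exponents of its coefficient plus \<open>m - l\<close>
    and \<open>l\<close> for the differentials. If \<open>e1 = 0\<close>, the first weight is thus
    at least \<open>m - l\<close>, and if \<open>e2 = 0\<close>, the second is at least
    \<open>l\<close>, as \<open>condU_bas\<close> and \<open>condV_bas\<close> require.\<close>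
  define h where "h = (\<lambda>(l, s, t). (int s - int (e1 * n l) + int (m - l), int t - int (e2 * n l) + int l))"
  define r where "r = (\<lambda>(l, s, t). smult (c l s t) (bas m b l))"
  define q where "q = (\<lambda>p. \<Sum>k | k \<in> K \<and> h k = p. r k)"
  have fin: "finite K" by (simp add: K_def)
  have "tval b \<omega> u v y = gsum q u v y" if nz: "u \<noteq> 0" "v \<noteq> 0" for u v y
  proof -
    have "(u, v) \<in> psi b -` V" unfolding S using nz by simp
    then have "tval b \<omega> u v y = (\<Sum>l\<le>m. a l (u, v) * u ^ (m - l) * v ^ l * poly (bas m b l) y)"
      unfolding tval_def using a(2) by (simp add: homf_vec)
    also have "\<dots> = (\<Sum>l\<le>m. \<Sum>(s, t)\<in>{..d l} \<times> {..d l}. poly (r (l, s, t)) y * u powi fst (h (l, s, t)) * v powi snd (h (l, s, t)))"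
    proof (rule sum.cong[OF refl])
      fix l assume "l \<in> {..m}"
      then have l: "l \<le> m" by simp
      show "a l (u, v) * u ^ (m - l) * v ^ l * poly (bas m b l) y =
        (\<Sum>(s, t)\<in>{..d l} \<times> {..d l}. poly (r (l, s, t)) y * u powi fst (h (l, s, t)) * v powi snd (h (l, s, t)))"
        unfolding dc[OF l nz] sum_distrib_right
      proof (intro sum.cong refl, clarify)
        fix s t
        have "u powi (int s - int (e1 * n l) + int (m - l)) = u powi (int s - int (e1 * n l)) * u ^ (m - l)"
          "v powi (int t - int (e2 * n l) + int l) = v powi (int t - int (e2 * n l)) * v ^ l"
          using nz by (simp_all add: power_int_add del: of_nat_mult of_nat_diff)
        then show "c l s t * u powi (int s - int (e1 * n l)) * v powi (int t - int (e2 * n l)) * u ^ (m - l) * v ^ l *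
            poly (bas m b l) y = poly (r (l, s, t)) y * u powi fst (h (l, s, t)) * v powi snd (h (l, s, t))"
          by (simp add: r_def h_def mult_ac)
      qed
    qed
    also have "\<dots> = (\<Sum>k\<in>K. poly (r k) y * u powi fst (h k) * v powi snd (h k))"
      unfolding K_def by (subst sum.Sigma) (auto simp: case_prod_beta)
    also have "\<dots> = gsum q u v y" unfolding q_def by (rule gsum_regroup(2)[OF fin, symmetric])
    finally show ?thesis .
  qed
  moreover have "fsupp q" unfolding q_def by (rule gsum_regroup(1)[OF fin])
  ultimately have "gexp b \<omega> q" by (simp add: gexp_def)
  moreover have "degree (q p) \<le> m" for p
    unfolding q_def
    by (rule degree_sum_le) (auto simp: fin K_def r_def intro: order.trans[OF degree_smult_le degree_bas])
  moreover have "condU m b (fst p) (q p)" if "e1 = 0" for p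
    unfolding q_def
    by (rule condU_sum) (auto simp: K_def h_def r_def that intro!: condU_smult condU_bas)
  moreover have "condV m (snd p) (q p)" if "e2 = 0" for p
    unfolding q_def
    by (rule condV_sum) (auto simp: K_def h_def r_def that intro!: condV_smult condV_bas)
  ultimately show ?thesis by blast
qed

section \<open>Polynomial bases adapted to the regularity conditions\<close>

text \<open>Subtracting a multiple of the pure power of \<open>1 - y\<close> makes the value at 0
  vanish, and the quotient by \<open>y\<close> is treated by induction. Up to constants these are
  the polynomials \<open>bas\<close> of chart \<open>False\<close>.\<close>

lemma bernstein:
  "degree (g :: complex poly) \<le> d \<Longrightarrow> \<exists>c. g = (\<Sum>l\<le>d. smult (c l) ([:0, 1:] ^ l * [:1, - 1:] ^ (d - l)))"
proof (induction d arbitrary: g)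
  case 0
  then obtain a where "g = [:a:]" by (metis degree_eq_zeroE le_zero_eq)
  then show ?case by (intro exI[of _ "\<lambda>_. a"]) simp
next
  case (Suc d)
  define h where "h = g - smult (poly g 0) ([:1, - 1:] ^ Suc d)"
  have "poly h 0 = 0" by (simp add: h_def poly_power)
  then obtain k where k: "h = [:0, 1:] * k" by (metis dvdE minus_zero poly_eq_0_iff_dvd)
  have "degree h \<le> Suc d"
    unfolding h_def using Suc.prems
    by (intro degree_diff_le order.trans[OF degree_smult_le]) (simp_all add: degree_power_eq del: power_Suc)
  then have "degree k \<le> d"
    unfolding k by (cases "k = 0") (simp_all add: degree_mult_eq)
  from Suc.IH[OF this] obtain c where c: "k = (\<Sum>l\<le>d. smult (c l) ([:0, 1:] ^ l * [:1, - 1:] ^ (d - l)))" by blast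
  have "g = smult (poly g 0) ([:1, - 1:] ^ Suc d) + [:0, 1:] * k" by (simp add: h_def k[symmetric] del: mult_pCons_left)
  also have "[:0, 1:] * k = (\<Sum>l\<le>d. smult (c l) ([:0, 1:] ^ Suc l * [:1, - 1:] ^ (d - l)))"
    unfolding c sum_distrib_left by (intro sum.cong) (simp_all add: mult_ac del: mult_pCons_left mult_pCons_right)
  finally show ?case
    by (intro exI[of _ "\<lambda>l. if l = 0 then poly g 0 else c (l - 1)"])
      (simp add: sum.atMost_Suc_shift del: sum.atMost_Suc mult_pCons_left mult_pCons_right)
qed

text \<open>The expansion at \<open>y = 1\<close>; up to constants its powers are the polynomials
  \<open>bas\<close> of chart \<open>True\<close>.\<close>

lemma taylor_1:
  assumes "degree (g :: complex poly) \<le> d"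
  shows "\<exists>c. g = (\<Sum>n\<le>d. smult (c n) ([:1, - 1:] ^ n))"
  using assms
proof (induction d arbitrary: g)
  case 0
  then obtain a where "g = [:a:]" by (metis degree_eq_zeroE le_zero_eq)
  then show ?case by (intro exI[of _ "\<lambda>_. a"]) simp
next
  case (Suc d)
  define h where "h = g - [:poly g 1:]"
  have "poly h 1 = 0" by (simp add: h_def)
  then obtain k where "h = [:- 1, 1:] * k" by (metis dvdE poly_eq_0_iff_dvd)
  then have k: "h = [:1, - 1:] * (- k)" by simp
  have "degree h \<le> Suc d" unfolding h_def using Suc.prems by (intro degree_diff_le) simp_all
  then have "degree (- k) \<le> d"
    unfolding k by (cases "k = 0") (simp_all add: degree_mult_eq del: mult_pCons_left mult_minus_right)
  from Suc.IH[OF this] obtain c where c: "- k = (\<Sum>n\<le>d. smult (c n) ([:1, - 1:] ^ n))" by blast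
  have "g = [:poly g 1:] + [:1, - 1:] * (- k)" by (simp add: h_def k[symmetric] del: mult_pCons_left mult_minus_right)
  also have "[:1, - 1:] * (- k) = (\<Sum>n\<le>d. smult (c n) ([:1, - 1:] ^ Suc n))"
    unfolding c sum_distrib_left by (intro sum.cong) (simp_all del: mult_pCons_left mult_pCons_right)
  finally show ?case
    by (intro exI[of _ "\<lambda>n. if n = 0 then poly g 1 else c (n - 1)"])
      (simp add: sum.atMost_Suc_shift del: sum.atMost_Suc mult_pCons_left mult_pCons_right)
qed

lemma regular_on_powi:
  assumes "zopen S"
  shows "0 \<le> i \<or> (\<forall>z\<in>S. fst z \<noteq> 0) \<Longrightarrow> regular_on S (\<lambda>z. fst z powi i)"
    and "0 \<le> i \<or> (\<forall>z\<in>S. snd z \<noteq> 0) \<Longrightarrow> regular_on S (\<lambda>z. snd z powi i)"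
proof -
  have *: "regular_on S (\<lambda>z. ev P z powi i)" if P: "0 \<le> i \<or> (\<forall>z\<in>S. ev P z \<noteq> 0)" for P
  proof (cases "0 \<le> i")
    case True
    then show ?thesis
      by (intro regular_on_rational[OF assms, of 1 _ "P ^ nat i"]) (simp_all add: power_int_def)
  next
    case False
    with P have nz: "ev P z \<noteq> 0" if "z \<in> S" for z using that by blast
    show ?thesis
      by (rule regular_on_rational[OF assms, of "P ^ nat (- i)" _ 1])
        (use False nz in \<open>simp_all add: power_int_def divide_inverse power_inverse\<close>)
  qed
  show "0 \<le> i \<or> (\<forall>z\<in>S. fst z \<noteq> 0) \<Longrightarrow> regular_on S (\<lambda>z. fst z powi i)"
    "0 \<le> i \<or> (\<forall>z\<in>S. snd z \<noteq> 0) \<Longrightarrow> regular_on S (\<lambda>z. snd z powi i)"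
    using *[of pU] *[of pV] by simp_all
qed

lemma bezout_power:
  fixes x z :: "'r::comm_ring_1"
  assumes xz: "x + z = 1"
  shows "\<exists>s t. x ^ a * s + z ^ e * t = 1"
proof -
  have one: "\<exists>s t. x * s + z ^ e * t = 1"
  proof (induction e)
    case 0
    show ?case by (intro exI[of _ 0] exI[of _ 1]) simp
  next
    case (Suc e)
    then obtain s t where st: "x * s + z ^ e * t = 1" by blast
    have "x * (s + z ^ e * t) + z ^ Suc e * t = x * s + z ^ e * t * (x + z)"
      by (simp add: algebra_simps)
    also have "\<dots> = 1" using st xz by simp
    finally show ?case by blast
  qed
  then obtain s t where st: "x * s + z ^ e * t = 1" by blast
  show ?thesis
  proof (induction a)
    case 0
    show ?case by (rule exI[of _ 1], rule exI[of _ 0]) simp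
  next
    case (Suc a)
    then obtain s' t' where st': "x ^ a * s' + z ^ e * t' = 1" by blast
    have "x ^ Suc a * (s' * s) + z ^ e * (t * x ^ a * s' + t' * (x * s + z ^ e * t)) =
        (x ^ a * s' + z ^ e * t') * (x * s + z ^ e * t)"
      by (simp add: algebra_simps)
    also have "\<dots> = 1" using st st' by simp
    finally show ?case by blast
  qed
qed

lemma bezout_dvd_mult:
  fixes p q :: "'r::comm_ring_1"
  assumes "p * s + q * t = 1"
  shows "p dvd q * h \<longleftrightarrow> p dvd h"
proof
  assume "p dvd q * h"
  then have "p dvd q * h * t" by (rule dvd_mult2)
  then have "p dvd p * (s * h) + q * h * t" by (rule dvd_add[OF dvd_triv_left])
  also have "p * (s * h) + q * h * t = (p * s + q * t) * h" by (simp add: algebra_simps)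
  finally show "p dvd h" using assms by simp
qed (rule dvd_mult)

text \<open>\<open>y\<close> and \<open>1 - y\<close> have sum 1, so their powers are comaximal, and
  a power of one may be cancelled when divisibility by a power of the other is tested.\<close>

lemma y_power_dvd_mult: "[:0, 1:] ^ a dvd [:1, - 1 :: complex:] ^ e * h \<longleftrightarrow> [:0, 1:] ^ a dvd h"
  and y1_power_dvd_mult: "[:1, - 1:] ^ e dvd [:0, 1 :: complex:] ^ a * h \<longleftrightarrow> [:1, - 1:] ^ e dvd h"
proof -
  have "[:0, 1:] + [:1, - 1:] = (1 :: complex poly)" by (simp add: one_pCons)
  from bezout_power[OF this, of a e] obtain s t where st: "[:0, 1:] ^ a * s + [:1, - 1 :: complex:] ^ e * t = 1"
    by blast
  show "[:0, 1:] ^ a dvd [:1, - 1:] ^ e * h \<longleftrightarrow> [:0, 1:] ^ a dvd h" by (rule bezout_dvd_mult[OF st])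
  show "[:1, - 1:] ^ e dvd [:0, 1:] ^ a * h \<longleftrightarrow> [:1, - 1:] ^ e dvd h"
    by (rule bezout_dvd_mult) (use st in \<open>simp only: add.commute\<close>)
qed

lemma bas_False: "bas m False l = smult (2 ^ l) ([:0, 1:] ^ l * [:1, - 1:] ^ (m - l))"
proof -
  have "[:0, 2 :: complex:] ^ l = smult (2 ^ l) ([:0, 1:] ^ l)" by (simp add: smult_power[symmetric])
  then show ?thesis unfolding bas_def by (simp add: mult.commute)
qed

lemma bas_True: "bas m True l = smult ((- 1) ^ (m - l) * 2 ^ l) ([:1, - 1:] ^ (m - l))"
proof -
  have "[:- 1, 1 :: complex:] ^ (m - l) = smult ((- 1) ^ (m - l)) ([:1, - 1:] ^ (m - l))"
  proof -
    have "[:- 1, 1 :: complex:] = smult (- 1) [:1, - 1:]" by simp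
    then show ?thesis by (simp only: smult_power)
  qed
  moreover have "[:2 :: complex:] ^ l = [:2 ^ l:]" by (induction l) (simp_all add: one_pCons)
  ultimately show ?thesis unfolding bas_def by (simp add: mult.commute)
qed

text \<open>After removal of both prescribed powers the quotient has degree at most
  \<open>m - a - e\<close>. Its Bernstein expansion, multiplied back, involves only indices
  \<open>l\<close> with \<open>a \<le> l\<close> and \<open>e \<le> m - l\<close>.\<close>

lemma bas_decomp_False:
  assumes r: "degree r \<le> m" and a: "[:0, 1:] ^ a dvd r" and e: "[:1, - 1:] ^ e dvd r"
  shows "\<exists>c. r = (\<Sum>l\<le>m. smult (c l) (bas m False l)) \<and> (\<forall>l\<le>m. c l \<noteq> 0 \<longrightarrow> a \<le> l \<and> e \<le> m - l)"
proof (cases "r = 0")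
  case True
  then show ?thesis by (intro exI[of _ "\<lambda>_. 0"]) simp
next
  case False
  from a obtain f where f: "r = [:0, 1:] ^ a * f" by (rule dvdE)
  with e have "[:1, - 1:] ^ e dvd f" by (simp only: y1_power_dvd_mult)
  then obtain g where "f = [:1, - 1:] ^ e * g" by (rule dvdE)
  with f have g: "r = [:0, 1:] ^ a * [:1, - 1:] ^ e * g" by (simp only: mult.assoc)
  with False have "g \<noteq> 0" by auto
  then have "degree r = a + e + degree g"
    unfolding g by (simp add: degree_mult_eq degree_power_eq)
  with r have d: "degree g \<le> m - a - e" "a + e \<le> m" by auto
  from bernstein[OF d(1)] obtain c where
    c: "g = (\<Sum>l\<le>m - a - e. smult (c l) ([:0, 1:] ^ l * [:1, - 1:] ^ (m - a - e - l)))" by blast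
  define c' where "c' = (\<lambda>l. if a \<le> l \<and> e \<le> m - l then c (l - a) / 2 ^ l else 0)"
  have "r = (\<Sum>l\<le>m - a - e. smult (c l) ([:0, 1:] ^ (l + a) * [:1, - 1:] ^ (m - (l + a))))"
    unfolding g c sum_distrib_left
  proof (intro sum.cong refl)
    fix l assume "l \<in> {..m - a - e}"
    then have "m - (l + a) = e + (m - a - e - l)" using d(2) by auto
    then have "[:1, - 1 :: complex:] ^ (m - (l + a)) = [:1, - 1:] ^ e * [:1, - 1:] ^ (m - a - e - l)"
      by (simp only: power_add)
    then show "[:0, 1:] ^ a * [:1, - 1:] ^ e * smult (c l) ([:0, 1:] ^ l * [:1, - 1:] ^ (m - a - e - l)) =
        smult (c l) ([:0, 1:] ^ (l + a) * [:1, - 1:] ^ (m - (l + a)))"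
      by (simp only: power_add mult_smult_right mult_smult_left mult_ac)
  qed
  also have "\<dots> = (\<Sum>l | l \<le> m \<and> a \<le> l \<and> e \<le> m - l. smult (c' l) (bas m False l))"
    by (rule sum.reindex_bij_witness[of _ "\<lambda>l. l - a" "\<lambda>l. l + a"])
      (use d(2) in \<open>auto simp: c'_def bas_False\<close>)
  also have "\<dots> = (\<Sum>l\<le>m. smult (c' l) (bas m False l))"
    by (rule sum.mono_neutral_left) (auto simp: c'_def)
  finally show ?thesis by (intro exI[of _ c']) (auto simp: c'_def)
qed

text \<open>The quotient by the power of \<open>1 - y\<close> is expanded at \<open>y = 1\<close>.
  The exponents that occur run from \<open>e\<close> to the degree of \<open>r\<close>, so a degree
  bound on \<open>r\<close> becomes a bound on \<open>m - l\<close>.\<close>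

lemma bas_decomp_True:
  assumes r: "degree r \<le> m" and e: "[:1, - 1:] ^ e dvd r"
  shows "\<exists>c. r = (\<Sum>l\<le>m. smult (c l) (bas m True l)) \<and>
     (\<forall>l\<le>m. c l \<noteq> 0 \<longrightarrow> r \<noteq> 0 \<and> m - l \<le> degree r \<and> e \<le> m - l)"
proof (cases "r = 0")
  case True
  then show ?thesis by (intro exI[of _ "\<lambda>_. 0"]) simp
next
  case False
  from e obtain g where g: "r = [:1, - 1:] ^ e * g" by (rule dvdE)
  with False have "g \<noteq> 0" by auto
  then have d: "degree r = e + degree g" unfolding g by (simp add: degree_mult_eq degree_power_eq)
  from taylor_1[OF order.refl, of g] obtain c where
    c: "g = (\<Sum>n\<le>degree g. smult (c n) ([:1, - 1:] ^ n))" by blast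
  define c' where "c' = (\<lambda>l. if e \<le> m - l \<and> m - l \<le> degree r then c (m - l - e) / ((- 1) ^ (m - l) * 2 ^ l) else 0)"
  have "r = (\<Sum>n\<le>degree g. smult (c n) ([:1, - 1:] ^ (e + n)))"
    by (subst g, subst c, simp only: sum_distrib_left power_add mult_smult_right)
  also have "\<dots> = (\<Sum>l | l \<le> m \<and> e \<le> m - l \<and> m - l \<le> degree r. smult (c' l) (bas m True l))"
    by (rule sum.reindex_bij_witness[of _ "\<lambda>l. m - l - e" "\<lambda>n. m - (e + n)"])
      (use d r in \<open>auto simp: c'_def bas_True\<close>)
  also have "\<dots> = (\<Sum>l\<le>m. smult (c' l) (bas m True l))"
    by (rule sum.mono_neutral_left) (auto simp: c'_def)
  finally show ?thesis using False by (intro exI[of _ c']) (auto simp: c'_def)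
qed

text \<open>In each chart the frame is compatible with both conditions of that chart: a weight part
  meeting them is a combination of frame elements that meet them one by one. \<open>hu\<close> and
  \<open>hv\<close> say which conditions are imposed.\<close>

lemma bas_decomp:
  assumes r: "degree r \<le> m" and hu: "hu \<Longrightarrow> condU m b i r" and hv: "hv \<Longrightarrow> condV m j r"
  shows "\<exists>c. r = (\<Sum>l\<le>m. smult (c l) (bas m b l)) \<and>
     (\<forall>l\<le>m. c l \<noteq> 0 \<longrightarrow> (hu \<longrightarrow> int (m - l) \<le> i) \<and> (hv \<longrightarrow> int l \<le> j))"
proof -
  define e where "e = (if hv then nat (int m - j) else 0)"
  have e: "[:1, - 1:] ^ e dvd r" using hv by (auto simp: e_def condV_def)
  have ej: "hv \<longrightarrow> int l \<le> j" if "l \<le> m" "e \<le> m - l" for l using that by (auto simp: e_def)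
  show ?thesis
  proof (cases b)
    case False
    define a where "a = (if hu then nat (int m - i) else 0)"
    have a: "[:0, 1:] ^ a dvd r" using hu False by (auto simp: a_def condU_def)
    have ai: "hu \<longrightarrow> int (m - l) \<le> i" if "l \<le> m" "a \<le> l" for l using that by (auto simp: a_def)
    from bas_decomp_False[OF r a e] obtain c where c: "r = (\<Sum>l\<le>m. smult (c l) (bas m False l))"
      "\<forall>l\<le>m. c l \<noteq> 0 \<longrightarrow> a \<le> l \<and> e \<le> m - l" by blast
    from c(2) have "\<forall>l\<le>m. c l \<noteq> 0 \<longrightarrow> (hu \<longrightarrow> int (m - l) \<le> i) \<and> (hv \<longrightarrow> int l \<le> j)"
      using ai ej by blast
    moreover have b: "b = False" using False by simp
    ultimately show ?thesis unfolding b using c(1) by (intro exI[of _ c] conjI)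
  next
    case True
    from bas_decomp_True[OF r e] obtain c where c: "r = (\<Sum>l\<le>m. smult (c l) (bas m True l))"
      "\<forall>l\<le>m. c l \<noteq> 0 \<longrightarrow> r \<noteq> 0 \<and> m - l \<le> degree r \<and> e \<le> m - l" by blast
    have di: "hu \<longrightarrow> int (degree r) \<le> i" if "r \<noteq> 0"
      using hu True that by (auto simp: condU_def leading_coeff_0_iff dest!: spec[of _ "degree r"] intro: leI)
    have "(hu \<longrightarrow> int (m - l) \<le> i) \<and> (hv \<longrightarrow> int l \<le> j)" if "l \<le> m" "c l \<noteq> 0" for l
      using c(2)[rule_format, OF that] di ej[OF that(1)] by force
    then have "\<forall>l\<le>m. c l \<noteq> 0 \<longrightarrow> (hu \<longrightarrow> int (m - l) \<le> i) \<and> (hv \<longrightarrow> int l \<le> j)" by blast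
    moreover have b: "b = True" using True by simp
    ultimately show ?thesis unfolding b using c(1) by (intro exI[of _ c] conjI)
  qed
qed

text \<open>The converse of \<open>F_expansion\<close>. The coefficient of the frame element
  \<open>l\<close> collects monomials \<open>u^(i-(m-l)) v^(j-l)\<close>, and by
  \<open>bas_decomp\<close> an exponent can be negative only if that variable has no zero on
  \<open>S\<close>.\<close>

lemma F_of_expansion:
  assumes S: "zopen S" and q: "fsupp q" "\<And>p. degree (q p) \<le> m"
    and hu: "(\<forall>z\<in>S. fst z \<noteq> 0) \<or> (\<forall>p. condU m b (fst p) (q p))"
    and hv: "(\<forall>z\<in>S. snd z \<noteq> 0) \<or> (\<forall>p. condV m (snd p) (q p))"
    and torus: "\<And>u v. u \<noteq> 0 \<Longrightarrow> v \<noteq> 0 \<Longrightarrow> (u, v) \<in> S"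
  shows "\<exists>\<omega>\<in>F m (psi b ` S). gexp b \<omega> q"
proof -
  let ?hu = "\<not> (\<forall>z\<in>S. fst z \<noteq> 0)" and ?hv = "\<not> (\<forall>z\<in>S. snd z \<noteq> 0)"
  have "\<exists>c. q p = (\<Sum>l\<le>m. smult (c l) (bas m b l)) \<and>
     (\<forall>l\<le>m. c l \<noteq> 0 \<longrightarrow> (?hu \<longrightarrow> int (m - l) \<le> fst p) \<and> (?hv \<longrightarrow> int l \<le> snd p))" for p
    by (rule bas_decomp[OF q(2)]) (use hu hv in blast)+
  then have "\<exists>c. \<forall>p. q p = (\<Sum>l\<le>m. smult (c p l) (bas m b l)) \<and>
     (\<forall>l\<le>m. c p l \<noteq> 0 \<longrightarrow> (?hu \<longrightarrow> int (m - l) \<le> fst p) \<and> (?hv \<longrightarrow> int l \<le> snd p))"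
    by (intro choice allI)
  then obtain c where c: "\<forall>p. q p = (\<Sum>l\<le>m. smult (c p l) (bas m b l)) \<and>
     (\<forall>l\<le>m. c p l \<noteq> 0 \<longrightarrow> (?hu \<longrightarrow> int (m - l) \<le> fst p) \<and> (?hv \<longrightarrow> int l \<le> snd p))" by (elim exE)
  let ?A = "{p. q p \<noteq> 0}"
  define a where "a = (\<lambda>l z. \<Sum>p\<in>?A. c p l * (fst z powi (fst p - int (m - l)) * snd z powi (snd p - int l)))"
  have reg: "regular_on S (a l)" if l: "l \<le> m" for l
    unfolding a_def
  proof (rule regular_on_sum[OF S])
    fix p :: "int \<times> int"
    show "regular_on S (\<lambda>z. c p l * (fst z powi (fst p - int (m - l)) * snd z powi (snd p - int l)))"
    proof (cases "c p l = 0")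
      case True
      then show ?thesis using regular_on_const[OF S, of 0] by simp
    next
      case False
      with c l have "(?hu \<longrightarrow> int (m - l) \<le> fst p) \<and> (?hv \<longrightarrow> int l \<le> snd p)" by blast
      then have "0 \<le> fst p - int (m - l) \<or> (\<forall>z\<in>S. fst z \<noteq> 0)" "0 \<le> snd p - int l \<or> (\<forall>z\<in>S. snd z \<noteq> 0)"
        unfolding diff_ge_0_iff_ge by (simp_all only: not_not imp_conv_disj disj_commute)
      then show ?thesis by (intro regular_on_mult regular_on_const S regular_on_powi)
    qed
  qed
  have "tval b (mkform m b S a) u v y = gsum q u v y" if nz: "u \<noteq> 0" "v \<noteq> 0" for u v y
  proof -
    have "tval b (mkform m b S a) u v y = (\<Sum>l\<le>m. a l (u, v) * u ^ (m - l) * v ^ l * poly (bas m b l) y)"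
      unfolding tval_def mkform_psi[OF torus[OF nz]] homf_vec ..
    also have "\<dots> = (\<Sum>l\<le>m. \<Sum>p\<in>?A. c p l * poly (bas m b l) y * u powi fst p * v powi snd p)"
    proof (rule sum.cong[OF refl])
      fix l
      have X: "u powi (i - int (m - l)) * u ^ (m - l) = u powi i" "v powi (j - int l) * v ^ l = v powi j" for i j
        using nz by (simp_all add: power_int_diff del: of_nat_diff)
      have "c p l * (u powi (fst p - int (m - l)) * v powi (snd p - int l)) * u ^ (m - l) * v ^ l *
         poly (bas m b l) y = c p l * poly (bas m b l) y * (u powi (fst p - int (m - l)) * u ^ (m - l)) *
         (v powi (snd p - int l) * v ^ l)" for p
        by (simp only: mult_ac)
      then have "c p l * (u powi (fst p - int (m - l)) * v powi (snd p - int l)) * u ^ (m - l) * v ^ l *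
         poly (bas m b l) y = c p l * poly (bas m b l) y * u powi fst p * v powi snd p" for p
        unfolding X .
      then show "a l (u, v) * u ^ (m - l) * v ^ l * poly (bas m b l) y =
          (\<Sum>p\<in>?A. c p l * poly (bas m b l) y * u powi fst p * v powi snd p)"
        unfolding a_def sum_distrib_right fst_conv snd_conv by (rule sum.cong[OF refl])
    qed
    also have "\<dots> = (\<Sum>p\<in>?A. \<Sum>l\<le>m. c p l * poly (bas m b l) y * u powi fst p * v powi snd p)"
      by (rule sum.swap)
    also have "\<dots> = gsum q u v y"
      unfolding gsum_def
    proof (rule sum.cong[OF refl])
      fix p
      have "poly (q p) y = (\<Sum>l\<le>m. c p l * poly (bas m b l) y)"
        by (subst c[rule_format, THEN conjunct1]) (simp add: poly_sum)
      then show "(\<Sum>l\<le>m. c p l * poly (bas m b l) y * u powi fst p * v powi snd p) =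
          poly (q p) y * u powi fst p * v powi snd p" by (simp add: sum_distrib_right)
    qed
    finally show ?thesis .
  qed
  then have "gexp b (mkform m b S a) q" using q(1) by (simp add: gexp_def)
  moreover have "mkform m b S a \<in> F m (psi b ` S)" by (rule mkform_F[OF reg])
  ultimately show ?thesis by blast
qed

section \<open>Change of charts for expansions and the identity principle\<close>

text \<open>The weight as seen from the other chart, since
  \<open>u^i v^j = (1/u)^(2j-i) (u^2 v)^j\<close>.\<close>

definition flipw :: "int \<times> int \<Rightarrow> int \<times> int" where "flipw p = (2 * snd p - fst p, snd p)"

lemma flipw_flipw [simp]: "flipw (flipw p) = p" "fst (flipw p) = 2 * snd p - fst p" "snd (flipw p) = snd p"
  by (simp_all add: flipw_def)

lemma image_flipw: "flipw ` A = {p. flipw p \<in> A}"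
proof (rule set_eqI)
  fix p
  show "p \<in> flipw ` A \<longleftrightarrow> p \<in> {p. flipw p \<in> A}"
  proof
    assume "p \<in> flipw ` A"
    then obtain r where "p = flipw r" "r \<in> A" by blast
    then show "p \<in> {p. flipw p \<in> A}" by simp
  next
    assume "p \<in> {p. flipw p \<in> A}"
    then have "flipw (flipw p) \<in> flipw ` A" by blast
    then show "p \<in> flipw ` A" by simp
  qed
qed

lemma gexp_flip: "gexp True \<omega> q \<longleftrightarrow> gexp False \<omega> (\<lambda>p. q (flipw p))"
proof -
  have supp: "{p. q (flipw p) \<noteq> 0} = flipw ` {p. q p \<noteq> 0}"
    by (simp add: image_flipw)
  have supp': "{p. q p \<noteq> 0} = flipw ` {p. q (flipw p) \<noteq> 0}"
    by (simp add: image_flipw)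
  have fs: "fsupp (\<lambda>p. q (flipw p)) \<longleftrightarrow> fsupp q"
    unfolding fsupp_def using supp supp' by (metis finite_imageI)
  have gs: "gsum (\<lambda>p. q (flipw p)) u v y = gsum q (1 / u) (u\<^sup>2 * v) y" if "u \<noteq> 0" for u v y
    unfolding gsum_def
  proof (rule sum.reindex_bij_witness[of _ flipw flipw])
    fix p assume "p \<in> {p. q (flipw p) \<noteq> 0}"
    have "(1 / u) powi (2 * snd p - fst p) * (u\<^sup>2 * v) powi snd p = u powi fst p * v powi snd p"
      using that by (simp add: power_int_mult_distrib power_int_divide_distrib power_int_diff power_int_mult)
    then show "poly (q (flipw p)) y * (1 / u) powi fst (flipw p) * (u\<^sup>2 * v) powi snd (flipw p) =
        poly (q (flipw p)) y * u powi fst p * v powi snd p" by (simp add: mult.assoc)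
  qed auto
  show ?thesis
    unfolding gexp_def fs
  proof (intro conj_cong refl iffI allI impI)
    fix u v y :: complex
    assume *: "\<forall>u v y. u \<noteq> 0 \<longrightarrow> v \<noteq> 0 \<longrightarrow> tval True \<omega> u v y = gsum q u v y" and nz: "u \<noteq> 0" "v \<noteq> 0"
    show "tval False \<omega> u v y = gsum (\<lambda>p. q (flipw p)) u v y"
      using *[rule_format, of "1 / u" "u\<^sup>2 * v" y] nz by (simp add: tval_flip gs)
  next
    fix u v y :: complex
    assume *: "\<forall>u v y. u \<noteq> 0 \<longrightarrow> v \<noteq> 0 \<longrightarrow> tval False \<omega> u v y = gsum (\<lambda>p. q (flipw p)) u v y"
      and nz: "u \<noteq> 0" "v \<noteq> 0"
    have e: "1 / (1 / u) = u" "(1 / u)\<^sup>2 * (u\<^sup>2 * v) = v" using nz by (simp_all add: power_divide)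
    have T: "tval False \<omega> (1 / u) (u\<^sup>2 * v) y = tval True \<omega> (1 / (1 / u)) ((1 / u)\<^sup>2 * (u\<^sup>2 * v)) y"
      by (rule tval_flip) (use nz in simp)
    have G: "gsum (\<lambda>p. q (flipw p)) (1 / u) (u\<^sup>2 * v) y = gsum q (1 / (1 / u)) ((1 / u)\<^sup>2 * (u\<^sup>2 * v)) y"
      by (rule gs) (use nz in simp)
    have "tval False \<omega> (1 / u) (u\<^sup>2 * v) y = gsum (\<lambda>p. q (flipw p)) (1 / u) (u\<^sup>2 * v) y"
      by (rule *[rule_format]) (use nz in simp_all)
    then show "tval True \<omega> u v y = gsum q u v y" unfolding T G e .
  qed
qed

text \<open>The test vectors at one point realise infinitely many directions, and a binary form that
  vanishes in infinitely many directions is zero.\<close>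

lemma homf_eq_of_torus:
  assumes nz: "u \<noteq> 0" "v \<noteq> 0"
    and eq: "\<And>y. homf m a (vecA False u y) (vecB False v y) = homf m a' (vecA False u y) (vecB False v y)"
    and l: "l \<le> m"
  shows "a l = a' l"
proof -
  define d where "d = (\<lambda>l. a l - a' l)"
  have scale: "homf m d (c * \<alpha>) (c * \<beta>) = c ^ m * homf m d \<alpha> \<beta>" for c \<alpha> \<beta>
  proof -
    have "d l * (c * \<alpha>) ^ (m - l) * (c * \<beta>) ^ l = c ^ m * (d l * \<alpha> ^ (m - l) * \<beta> ^ l)" if "l \<le> m" for l
    proof -
      have "c ^ m = c ^ (m - l) * c ^ l" using that by (simp flip: power_add)
      then show ?thesis by (simp add: power_mult_distrib)
    qed
    then show ?thesis unfolding homf_def sum_distrib_left by (intro sum.cong) auto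
  qed
  have zero: "homf m d 1 t = 0" if t: "2 * v + t * u \<noteq> 0" for t
  proof -
    \<comment> \<open>The slope of the test vector is \<open>2 v y / (u (1 - y))\<close>, and this
      \<open>y\<close> solves for slope \<open>t\<close>. Only the slope \<open>- 2 v / u\<close>,
      which belongs to y = infinity, is missed.\<close>
    define y where "y = t * u / (2 * v + t * u)"
    have A: "vecA False u y = u * (2 * v / (2 * v + t * u)) * 1" "vecB False v y = u * (2 * v / (2 * v + t * u)) * t"
      using t by (simp_all add: vecA_def vecB_def y_def field_simps)
    have "homf m d (vecA False u y) (vecB False v y) = 0"
      unfolding d_def homf_diff[symmetric] using eq by simp
    then have "(u * (2 * v / (2 * v + t * u))) ^ m * homf m d 1 t = 0" unfolding A scale .
    then show ?thesis using nz t by simp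
  qed
  have "d l = 0"
  proof (rule ccontr)
    assume "d l \<noteq> 0"
    then have "finite {t. (\<Sum>i\<le>m. d i * t ^ i) = 0}" using l by (rule polyfun_roots_finite)
    moreover have "- {- 2 * v / u} \<subseteq> {t. (\<Sum>i\<le>m. d i * t ^ i) = 0}"
    proof
      fix t assume "t \<in> - {- 2 * v / u}"
      then have "2 * v + t * u \<noteq> 0" using nz by (auto simp: field_simps add_eq_0_iff)
      from zero[OF this] show "t \<in> {t. (\<Sum>i\<le>m. d i * t ^ i) = 0}" by (simp add: homf_def)
    qed
    moreover have "infinite (- {- 2 * v / u} :: complex set)"
      using infinite_UNIV_char_0[where 'a = complex] by (simp add: Compl_eq_Diff_UNIV)
    ultimately show False by (meson finite_subset)
  qed
  then show ?thesis by (simp add: d_def)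
qed

text \<open>On the torus of chart \<open>False\<close> the coefficients agree by
  \<open>homf_eq_of_torus\<close>. In each chart the torus is the set where \<open>u v\<close> is
  nonzero, and regular coefficients that agree on it agree everywhere by
  \<open>regular_on_eq_0_dense\<close>.\<close>

theorem F_identity:
  assumes V: "openin A1_resolution V" and \<omega>: "\<omega> \<in> F m V" "\<omega>' \<in> F m V"
    and eq: "\<And>u v y. u \<noteq> 0 \<Longrightarrow> v \<noteq> 0 \<Longrightarrow> psi False (u, v) \<in> V \<Longrightarrow> tval False \<omega> u v y = tval False \<omega>' u v y"
  shows "\<omega> = \<omega>'"
proof (rule F_eqI[OF \<omega> openin_subset[OF V]])
  have False_torus: "\<omega> (psi False z, D) = \<omega>' (psi False z, D)" if nz: "fst z \<noteq> 0" "snd z \<noteq> 0" for z D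
  proof (cases "psi False z \<in> V \<and> tangent (psi False z) D")
    case False
    then show ?thesis using F_off[OF \<omega>(1) False] F_off[OF \<omega>(2) False] by simp
  next
    case True
    from F_coeffs[OF \<omega>(1), of False] F_coeffs[OF \<omega>(2), of False] obtain a a' where
      a: "\<forall>z \<alpha> \<beta>. psi False z \<in> V \<longrightarrow> \<omega> (psi False z, tv False z \<alpha> \<beta>) = homf m (\<lambda>l. a l z) \<alpha> \<beta>" and
      a': "\<forall>z \<alpha> \<beta>. psi False z \<in> V \<longrightarrow> \<omega>' (psi False z, tv False z \<alpha> \<beta>) = homf m (\<lambda>l. a' l z) \<alpha> \<beta>"
      by (elim exE conjE)
    obtain u v where uv: "z = (u, v)" by (cases z)
    have "a l z = a' l z" if "l \<le> m" for l
    proof (rule homf_eq_of_torus[of u v m "\<lambda>l. a l z" "\<lambda>l. a' l z", OF _ _ _ that])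
      show "u \<noteq> 0" "v \<noteq> 0" using nz uv by simp_all
      fix y
      show "homf m (\<lambda>l. a l z) (vecA False u y) (vecB False v y) = homf m (\<lambda>l. a' l z) (vecA False u y) (vecB False v y)"
        using eq[of u v y] a[rule_format, of z] a'[rule_format, of z] True nz uv by (simp add: tval_def)
    qed
    moreover have "D = tv False z (D (crd False pU)) (D (crd False pV))" using True by (intro tangent_unique) simp
    ultimately show ?thesis
      using a[rule_format, of z] a'[rule_format, of z] True homf_cong by metis
  qed
  fix b z \<alpha> \<beta> assume z: "psi b z \<in> V"
  have torus: "\<omega> (psi b w, D) = \<omega>' (psi b w, D)" if nz: "fst w \<noteq> 0" "snd w \<noteq> 0" for w D
  proof (cases b)
    case False
    then show ?thesis using False_torus[OF nz] by simp
  next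
    case True
    then have "psi b w = psi False (1 / fst w, (fst w)\<^sup>2 * snd w)" using psi_flip[OF nz(1), of b] by simp
    then show ?thesis using False_torus[of "(1 / fst w, (fst w)\<^sup>2 * snd w)" D] nz by simp
  qed
  from F_coeffs[OF \<omega>(1), of b] F_coeffs[OF \<omega>(2), of b] obtain a a' where
    a: "\<forall>l\<le>m. regular_on (psi b -` V) (a l)"
      "\<forall>z \<alpha> \<beta>. psi b z \<in> V \<longrightarrow> \<omega> (psi b z, tv b z \<alpha> \<beta>) = homf m (\<lambda>l. a l z) \<alpha> \<beta>" and
    a': "\<forall>l\<le>m. regular_on (psi b -` V) (a' l)"
      "\<forall>z \<alpha> \<beta>. psi b z \<in> V \<longrightarrow> \<omega>' (psi b z, tv b z \<alpha> \<beta>) = homf m (\<lambda>l. a' l z) \<alpha> \<beta>" by (elim exE conjE)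
  have "a l z - a' l z = 0" if l: "l \<le> m" for l
  proof (rule regular_on_eq_0_dense[where D = "pU * pV"])
    show "regular_on (psi b -` V) (\<lambda>z. a l z - a' l z)"
      using a(1) a'(1) l by (intro regular_on_diff) simp_all
    show "pU * pV \<noteq> 0" by (simp add: pU_def pV_def)
    show "z \<in> psi b -` V" using z by simp
    fix w assume w: "w \<in> psi b -` V" "ev (pU * pV) w \<noteq> 0"
    then have nz: "fst w \<noteq> 0" "snd w \<noteq> 0" by simp_all
    have "homf m (\<lambda>l. a l w) \<alpha> \<beta> = homf m (\<lambda>l. a' l w) \<alpha> \<beta>" for \<alpha> \<beta>
      using a(2)[rule_format, of w \<alpha> \<beta>] a'(2)[rule_format, of w \<alpha> \<beta>] torus[OF nz, of "tv b w \<alpha> \<beta>"] w(1) by simp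
    from homf_unique[OF this l] show "a l w - a' l w = 0" by simp
  qed
  then show "\<omega> (psi b z, tv b z \<alpha> \<beta>) = \<omega>' (psi b z, tv b z \<alpha> \<beta>)"
    using a(2)[rule_format, OF z] a'(2)[rule_format, OF z] by (auto intro!: homf_cong)
qed

section \<open>Sections over the relevant open sets\<close>

text \<open>\<open>c0\<close>, \<open>c1\<close> and \<open>cv\<close> impose regularity along
  \<open>u = 0\<close>, along \<open>1/u = 0\<close> and along the exceptional curve. All weights
  refer to chart \<open>False\<close>, so the condition of chart \<open>True\<close> is stated for
  its first weight \<open>2 j - i\<close>.\<close>

definition good :: "nat \<Rightarrow> bool \<Rightarrow> bool \<Rightarrow> bool \<Rightarrow> (int \<times> int \<Rightarrow> complex poly) \<Rightarrow> bool" where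
  "good m c0 c1 cv q \<longleftrightarrow> fsupp q \<and> (\<forall>p. degree (q p) \<le> m \<and> (c0 \<longrightarrow> condU m False (fst p) (q p)) \<and>
     (c1 \<longrightarrow> condU m True (2 * snd p - fst p) (q p)) \<and> (cv \<longrightarrow> condV m (snd p) (q p)))"

lemma goodD:
  assumes "good m c0 c1 cv q"
  shows "fsupp q" "degree (q p) \<le> m" "c0 \<Longrightarrow> condU m False (fst p) (q p)"
    "c1 \<Longrightarrow> condU m True (2 * snd p - fst p) (q p)" "cv \<Longrightarrow> condV m (snd p) (q p)"
  using assms[unfolded good_def, THEN conjunct1] assms[unfolded good_def, THEN conjunct2, THEN spec[of _ p]]
  by simp_all

lemma openin_psi_images:
  "openin A1_resolution (psi b ` UNIV)" "openin A1_resolution (psi b ` {z. fst z \<noteq> 0})"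
  "openin A1_resolution (psi b ` {z. snd z \<noteq> 0})"
  using openin_A1_image[of b 1] openin_A1_image[of b pU] openin_A1_image[of b pV] by simp_all

lemma range_psi_Int: "range (psi False) \<inter> range (psi True) = psi b ` {z. fst z \<noteq> 0}"
proof -
  have "range (psi b) \<inter> range (psi (\<not> b)) = psi b ` {z. fst z \<noteq> 0}"
  proof (rule set_eqI, rule iffI)
    fix p assume p: "p \<in> range (psi b) \<inter> range (psi (\<not> b))"
    then obtain z where z: "p = psi b z" by blast
    with p have "fst z \<noteq> 0" using psi_overlap[of b z] by simp
    with z show "p \<in> psi b ` {z. fst z \<noteq> 0}" by blast
  next
    fix p assume "p \<in> psi b ` {z. fst z \<noteq> 0}"
    then obtain z where "p = psi b z" "fst z \<noteq> 0" by blast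
    then show "p \<in> range (psi b) \<inter> range (psi (\<not> b))" using psi_overlap[of b z] by simp
  qed
  then show ?thesis by (cases b) (simp_all add: Int_commute)
qed

lemma Y_eq: "Y = range (psi False) \<union> range (psi True)"
proof
  show "Y \<subseteq> range (psi False) \<union> range (psi True)"
  proof
    fix p assume "p \<in> Y"
    then obtain b z where "p = psi b z" by (rule Y_cases)
    then show "p \<in> range (psi False) \<union> range (psi True)" by (cases b) simp_all
  qed
qed (use psi_in_Y in blast)

lemma psi_exceptional: "psi b z \<in> A1_exceptional \<longleftrightarrow> snd z = 0"
  unfolding A1_exceptional_def using psi_in_Y by (simp add: psi_def vector_mul_eq_0)

lemma Y_minus_E_eq: "Y - A1_exceptional = psi False ` {z. snd z \<noteq> 0} \<union> psi True ` {z. snd z \<noteq> 0}"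
proof (rule set_eqI)
  fix p
  show "p \<in> Y - A1_exceptional \<longleftrightarrow> p \<in> psi False ` {z. snd z \<noteq> 0} \<union> psi True ` {z. snd z \<noteq> 0}"
  proof
    assume p: "p \<in> Y - A1_exceptional"
    then obtain b z where z: "p = psi b z" using Y_cases by blast
    with p have "snd z \<noteq> 0" using psi_exceptional by simp
    with z show "p \<in> psi False ` {z. snd z \<noteq> 0} \<union> psi True ` {z. snd z \<noteq> 0}" by (cases b) simp_all
  next
    assume "p \<in> psi False ` {z. snd z \<noteq> 0} \<union> psi True ` {z. snd z \<noteq> 0}"
    then obtain b z where "p = psi b z" "snd z \<noteq> 0" by blast
    then show "p \<in> Y - A1_exceptional" using psi_exceptional psi_in_Y by simp
  qed
qed

lemma openin_Y_minus_E: "openin A1_resolution (Y - A1_exceptional)"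
  unfolding Y_minus_E_eq by (intro openin_Un openin_psi_images)

lemma gexp_restrict:
  assumes "\<And>u v. u \<noteq> 0 \<Longrightarrow> v \<noteq> 0 \<Longrightarrow> psi b (u, v) \<in> W"
  shows "gexp b (restrict_section W \<omega>) q \<longleftrightarrow> gexp b \<omega> q"
  unfolding gexp_def tval_def restrict_section_def using assms by simp

lemma F_image_expansion:
  assumes "\<omega> \<in> F m (psi b ` {z. ev (pU ^ e1 * pV ^ e2) z \<noteq> 0})"
  shows "\<exists>q. gexp False \<omega> q \<and> good m (\<not> b \<and> e1 = 0) (b \<and> e1 = 0) (e2 = 0) q"
proof -
  from F_expansion[OF assms vimage_psi_same] obtain q where
    q: "gexp b \<omega> q" "\<forall>p. degree (q p) \<le> m \<and> (e1 = 0 \<longrightarrow> condU m b (fst p) (q p)) \<and>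
     (e2 = 0 \<longrightarrow> condV m (snd p) (q p))" by (elim exE conjE)
  show ?thesis
  proof (cases b)
    case False
    then show ?thesis using q by (intro exI[of _ q]) (auto simp: good_def gexp_def)
  next
    case True
    then have "gexp False \<omega> (\<lambda>p. q (flipw p))" using q(1) by (simp add: gexp_flip)
    moreover from this have "fsupp (\<lambda>p. q (flipw p))" by (simp add: gexp_def)
    moreover have "degree (q (flipw p)) \<le> m \<and> (e1 = 0 \<longrightarrow> condU m True (2 * snd p - fst p) (q (flipw p))) \<and>
     (e2 = 0 \<longrightarrow> condV m (snd p) (q (flipw p)))" for p
      using q(2)[rule_format, of "flipw p"] True by simp
    ultimately show ?thesis using True by (intro exI[of _ "\<lambda>p. q (flipw p)"]) (simp add: good_def)
  qed
qed

lemma F_image_of_expansion: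
  assumes q: "good m (\<not> b \<and> e1 = 0) (b \<and> e1 = 0) (e2 = 0) q" and e: "e1 \<le> 1" "e2 \<le> 1"
  shows "\<exists>\<omega>\<in>F m (psi b ` {z. ev (pU ^ e1 * pV ^ e2) z \<noteq> 0}). gexp False \<omega> q"
proof -
  let ?S = "{z. ev (pU ^ e1 * pV ^ e2) z \<noteq> 0}"
  have *: "\<exists>\<omega>\<in>F m (psi b ` ?S). gexp b \<omega> q'" if q': "fsupp q'" "\<And>p. degree (q' p) \<le> m"
    and u: "\<And>p. e1 = 0 \<Longrightarrow> condU m b (fst p) (q' p)" and v: "\<And>p. e2 = 0 \<Longrightarrow> condV m (snd p) (q' p)" for q'
  proof (rule F_of_expansion[OF zopen_principal q'])
    show "(\<forall>z\<in>?S. fst z \<noteq> 0) \<or> (\<forall>p. condU m b (fst p) (q' p))"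
      using u by (cases "e1 = 0") auto
    show "(\<forall>z\<in>?S. snd z \<noteq> 0) \<or> (\<forall>p. condV m (snd p) (q' p))"
      using v by (cases "e2 = 0") auto
  qed simp
  show ?thesis
  proof (cases b)
    case False
    note g = q[unfolded good_def, THEN conjunct1] q[unfolded good_def, THEN conjunct2, THEN spec]
    have "degree (q p) \<le> m \<and> (e1 = 0 \<longrightarrow> condU m b (fst p) (q p)) \<and> (e2 = 0 \<longrightarrow> condV m (snd p) (q p))" for p
      using g(2)[of p] False by simp
    then have "\<exists>\<omega>\<in>F m (psi b ` ?S). gexp b \<omega> q" using *[OF g(1)] by blast
    then show ?thesis using False by simp
  next
    case True
    let ?q' = "\<lambda>p. q (flipw p)"
    have "{p. ?q' p \<noteq> 0} = flipw ` {p. q p \<noteq> 0}" by (simp add: image_flipw)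
    then have "fsupp ?q'" using q unfolding good_def fsupp_def by simp
    moreover have "degree (?q' p) \<le> m \<and> (e1 = 0 \<longrightarrow> condU m b (fst p) (?q' p)) \<and> (e2 = 0 \<longrightarrow> condV m (snd p) (?q' p))" for p
      using q[unfolded good_def, THEN conjunct2, rule_format, of "flipw p"] True by simp
    ultimately have "\<exists>\<omega>\<in>F m (psi b ` ?S). gexp b \<omega> ?q'" using * by blast
    then show ?thesis using True gexp_flip[of _ ?q'] by simp
  qed
qed

lemma F_expansion_chart:
  "\<omega> \<in> F m (range (psi b)) \<Longrightarrow> \<exists>q. gexp False \<omega> q \<and> good m (\<not> b) b True q"
  using F_image_expansion[of \<omega> m b 0 0] by simp

lemma F_of_expansion_chart:
  "good m (\<not> b) b True q \<Longrightarrow> \<exists>\<omega>\<in>F m (range (psi b)). gexp False \<omega> q"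
  using F_image_of_expansion[of m b 0 0 q] by simp

lemma F_expansion_overlap:
  "\<omega> \<in> F m (range (psi False) \<inter> range (psi True)) \<Longrightarrow> \<exists>q. gexp False \<omega> q \<and> good m False False True q"
  using F_image_expansion[of \<omega> m False 1 0] by (simp add: range_psi_Int[of False])

lemma F_of_expansion_overlap:
  "good m False False True q \<Longrightarrow> \<exists>\<omega>\<in>F m (range (psi False) \<inter> range (psi True)). gexp False \<omega> q"
  using F_image_of_expansion[of m False 1 0 q] by (simp add: range_psi_Int[of False])

text \<open>Two forms with the same expansion agree on the overlap by \<open>F_identity\<close>,
  hence glue.\<close>

lemma F_glue:
  assumes S: "S = UNIV \<or> S = {z. snd z \<noteq> 0}"
    and \<omega>0: "\<omega>0 \<in> F m (psi False ` S)" "gexp False \<omega>0 q"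
    and \<omega>1: "\<omega>1 \<in> F m (psi True ` S)" "gexp False \<omega>1 q"
  shows "\<exists>\<omega>\<in>F m (psi False ` S \<union> psi True ` S). gexp False \<omega> q"
proof -
  have op: "openin A1_resolution (psi b ` S)" for b using S openin_psi_images[of b] by auto
  let ?I = "psi False ` S \<inter> psi True ` S"
  have I: "openin A1_resolution ?I" by (intro openin_Int op)
  have "restrict_section ?I \<omega>0 = restrict_section ?I \<omega>1"
  proof (rule F_identity[OF I])
    show "restrict_section ?I \<omega>0 \<in> F m ?I" "restrict_section ?I \<omega>1 \<in> F m ?I"
      by (rule F_restrict[OF \<omega>0(1) I Int_lower1], rule F_restrict[OF \<omega>1(1) I Int_lower2])
    fix u v y assume "u \<noteq> 0" "v \<noteq> 0" and p: "psi False (u, v) \<in> ?I"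
    then have "tval False \<omega>0 u v y = tval False \<omega>1 u v y" using \<omega>0(2) \<omega>1(2) by (simp add: gexp_def)
    with p show "tval False (restrict_section ?I \<omega>0) u v y = tval False (restrict_section ?I \<omega>1) u v y"
      by (simp add: tval_def restrict_section_def)
  qed
  then have eq: "\<omega>0 (p, D) = \<omega>1 (p, D)" if "p \<in> ?I" for p D
    using that by (drule_tac fun_cong[of _ _ "(p, D)"]) (simp add: restrict_section_def)
  define \<omega> where "\<omega> = (\<lambda>(p, D). if p \<in> psi False ` S then \<omega>0 (p, D) else \<omega>1 (p, D))"
  have "\<omega> \<in> F m (psi False ` S \<union> psi True ` S)"
  proof (rule F_local)
    show "psi False ` S \<union> psi True ` S \<subseteq> Y" using psi_in_Y by blast
    show "\<omega> (p, D) = 0" if "\<not> (p \<in> psi False ` S \<union> psi True ` S \<and> tangent p D)" for p D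
      using that F_off[OF \<omega>0(1), of p D] F_off[OF \<omega>1(1), of p D] by (auto simp: \<omega>_def)
    fix p assume p: "p \<in> psi False ` S \<union> psi True ` S"
    show "\<exists>W V' \<omega>'. openin A1_resolution W \<and> p \<in> W \<and> p \<in> V' \<and> \<omega>' \<in> F m V' \<and>
      (\<forall>q\<in>W \<inter> V'. q \<in> psi False ` S \<union> psi True ` S \<and> (\<forall>D. tangent q D \<longrightarrow> \<omega> (q, D) = \<omega>' (q, D)))"
    proof (cases "p \<in> psi False ` S")
      case True
      then show ?thesis
        by (intro exI[of _ "psi False ` S"] exI[of _ \<omega>0] conjI op \<omega>0(1)) (auto simp: \<omega>_def)
    next
      case False
      with p have "p \<in> psi True ` S" by blast
      then show ?thesis
        by (intro exI[of _ "psi True ` S"] exI[of _ \<omega>1] conjI op \<omega>1(1) ballI allI impI)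
          (use eq in \<open>simp_all add: \<omega>_def\<close>)
    qed
  qed
  moreover have "gexp False \<omega> q"
  proof -
    have "psi False (u, v) \<in> psi False ` S" if "v \<noteq> 0" for u v using S that by auto
    then show ?thesis using \<omega>0(2) by (simp add: gexp_def tval_def \<omega>_def)
  qed
  ultimately show ?thesis by blast
qed

lemma good_weaken: "good m c0 c1 cv q \<Longrightarrow> (d0 \<Longrightarrow> c0) \<Longrightarrow> (d1 \<Longrightarrow> c1) \<Longrightarrow> (dv \<Longrightarrow> cv) \<Longrightarrow> good m d0 d1 dv q"
  unfolding good_def by blast

lemma good_join: "good m c0 c1 cv q \<Longrightarrow> good m d0 d1 dv q \<Longrightarrow> good m (c0 \<or> d0) (c1 \<or> d1) (cv \<or> dv) q"
  unfolding good_def by blast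

text \<open>The form is expanded on each chart separately. By \<open>gexp_unique\<close> both
  expansions are the same \<open>q\<close>, which therefore meets the conditions of both
  charts.\<close>

lemma F_expansion_Y: "\<omega> \<in> F m Y \<Longrightarrow> \<exists>q. gexp False \<omega> q \<and> good m True True True q"
  and F_expansion_Y_minus_E: "\<omega> \<in> F m (Y - A1_exceptional) \<Longrightarrow> \<exists>q. gexp False \<omega> q \<and> good m True True False q"
proof -
  have *: "\<exists>q. gexp False \<omega> q \<and> good m True True (e = 0) q"
    if \<omega>: "\<omega> \<in> F m V" and sub: "\<And>b. psi b ` {z. ev (pU ^ 0 * pV ^ e) z \<noteq> 0} \<subseteq> V" for V and e :: nat
  proof -
    let ?S = "{z. ev (pU ^ 0 * pV ^ e) z \<noteq> 0}"
    have ex: "\<exists>q. gexp False \<omega> q \<and> good m (\<not> b) b (e = 0) q" for b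
    proof -
      have "restrict_section (psi b ` ?S) \<omega> \<in> F m (psi b ` ?S)"
        by (rule F_restrict[OF \<omega> openin_A1_image sub])
      from F_image_expansion[OF this] obtain q where
        q: "gexp False (restrict_section (psi b ` ?S) \<omega>) q" "good m (\<not> b) b (e = 0) q" by auto
      have "psi False (u, v) \<in> psi b ` ?S" if nz: "u \<noteq> 0" "v \<noteq> 0" for u v
      proof (cases b)
        case True
        have "psi False (u, v) = psi True (1 / u, u\<^sup>2 * v)" using psi_flip[of "(u, v)" False] nz by simp
        then show ?thesis using True nz by auto
      qed (use nz in auto)
      with q show ?thesis by (auto simp: gexp_restrict)
    qed
    from ex[of False] ex[of True] obtain q q' where "gexp False \<omega> q" "good m True False (e = 0) q"
      "gexp False \<omega> q'" "good m False True (e = 0) q'" by auto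
    then show ?thesis using gexp_unique[of False \<omega> q q'] good_join[of m True False "e = 0" q False True "e = 0"] by auto
  qed
  show "\<omega> \<in> F m Y \<Longrightarrow> \<exists>q. gexp False \<omega> q \<and> good m True True True q"
    using *[of Y 0] psi_in_Y by (simp add: image_subset_iff)
  show "\<omega> \<in> F m (Y - A1_exceptional) \<Longrightarrow> \<exists>q. gexp False \<omega> q \<and> good m True True False q"
    using *[of "Y - A1_exceptional" 1] psi_in_Y psi_exceptional by (simp add: image_subset_iff)
qed

lemma F_of_expansion_Y: "good m True True True q \<Longrightarrow> \<exists>\<omega>\<in>F m Y. gexp False \<omega> q"
  and F_of_expansion_Y_minus_E: "good m True True False q \<Longrightarrow> \<exists>\<omega>\<in>F m (Y - A1_exceptional). gexp False \<omega> q"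
proof -
  have *: "\<exists>\<omega>\<in>F m (psi False ` S \<union> psi True ` S). gexp False \<omega> q"
    if q: "good m True True (e = 0) q" and e: "e \<le> 1" and S: "S = {z. ev (pU ^ 0 * pV ^ e) z \<noteq> 0}" for S and e :: nat
  proof -
    have S': "S = UNIV \<or> S = {z. snd z \<noteq> 0}" unfolding S using e by (cases "e = 0") auto
    have "\<exists>\<omega>\<in>F m (psi b ` S). gexp False \<omega> q" for b
      unfolding S by (rule F_image_of_expansion[OF good_weaken[OF q] _ e]) auto
    from this[of False] this[of True] F_glue[OF S'] show ?thesis by blast
  qed
  show "good m True True True q \<Longrightarrow> \<exists>\<omega>\<in>F m Y. gexp False \<omega> q"
    using *[of 0 UNIV] by (simp add: Y_eq)
  show "good m True True False q \<Longrightarrow> \<exists>\<omega>\<in>F m (Y - A1_exceptional). gexp False \<omega> q"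
    using *[of 1 "{z. snd z \<noteq> 0}"] by (simp add: Y_minus_E_eq)
qed


section \<open>Dimensions of quotients\<close>

text \<open>The linear map \<open>V / W \<rightarrow> \<complex>\<^sup>I\<close> is given by a relation, so that it may involve choices that only
  affect the values off \<open>I\<close>.\<close>

lemma quotient_dim_eqI:
  fixes R :: "('b \<Rightarrow> complex) \<Rightarrow> ('i \<Rightarrow> complex) \<Rightarrow> bool"
  assumes fin: "finite I"
    and total: "\<And>f. f \<in> V \<Longrightarrow> \<exists>a. R f a"
    and linear: "\<And>f g a b c d. R f a \<Longrightarrow> R g b \<Longrightarrow> R (\<lambda>x. c * f x + d * g x) (\<lambda>i. c * a i + d * b i)"
    and kernel: "\<And>f a. R f a \<Longrightarrow> f \<in> W \<longleftrightarrow> (\<forall>i\<in>I. a i = 0)"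
    and onto: "\<And>a. \<exists>f\<in>V. \<exists>a'. R f a' \<and> (\<forall>i\<in>I. a' i = a i)"
  shows "quotient_dim V W = enat (card I)"
proof -
  have R0: "R (\<lambda>_. 0) (\<lambda>_. 0)"
  proof -
    obtain f a where "R f a" using onto by blast
    from linear[OF this this, of 0 0] show ?thesis by simp
  qed
  have Rsum: "R (\<lambda>x. \<Sum>b\<in>B. c b * b x) (\<lambda>i. \<Sum>b\<in>B. c b * a b i)"
    if "finite B" "\<And>b. b \<in> B \<Longrightarrow> R b (a b)" for B c a
    using that
  proof (induction B rule: finite_induct)
    case (insert b B)
    from linear[of b "a b" "\<lambda>x. \<Sum>b\<in>B. c b * b x" "\<lambda>i. \<Sum>b\<in>B. c b * a b i" "c b" 1] insert
    show ?case by simp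
  qed (use R0 in simp)
  \<comment> \<open>The images of more than \<open>card I\<close> elements satisfy a nontrivial
    relation, and the corresponding combination lies in the kernel \<open>W\<close>.\<close>
  have upper: "card B \<le> card I" if B: "finite B" "B \<subseteq> V" "independent_modulo W B" for B
  proof (rule ccontr)
    assume "\<not> card B \<le> card I"
    then have less: "card I < card B" by simp
    have "\<forall>b. \<exists>a. b \<in> B \<longrightarrow> R b a" using total B(2) by blast
    then obtain a where a: "\<And>b. b \<in> B \<Longrightarrow> R b (a b)" by metis
    from nontrivial_relation[OF fin B(1) less, of a] obtain c where
      c: "\<exists>b\<in>B. c b \<noteq> 0" "\<forall>i\<in>I. (\<Sum>b\<in>B. c b * a b i) = 0" by blast
    have "(\<lambda>x. \<Sum>b\<in>B. c b * b x) \<in> W" using kernel[OF Rsum[OF B(1) a]] c(2) by blast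
    then show False using B(3) c(1) unfolding independent_modulo_def by blast
  qed
  \<comment> \<open>Preimages of the unit vectors: their classes attain the supremum in
    \<open>quotient_dim\<close>.\<close>
  have "\<exists>f. f \<in> V \<and> (\<exists>a'. R f a' \<and> (\<forall>k\<in>I. a' k = (if k = i then 1 else 0)))" for i
    using onto[of "\<lambda>k. if k = i then 1 else 0"] by blast
  then obtain e where e: "\<And>i. e i \<in> V" "\<And>i. \<exists>a'. R (e i) a' \<and> (\<forall>k\<in>I. a' k = (if k = i then 1 else 0))" by metis
  then obtain \<epsilon> where \<epsilon>: "\<And>i. R (e i) (\<epsilon> i)" "\<And>i k. k \<in> I \<Longrightarrow> \<epsilon> i k = (if k = i then 1 else 0)" by metis
  \<comment> \<open>The dimension is defined through sets of functions, so the preimages must be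
    shown to be distinct before they can be counted.\<close>
  have inj: "inj_on e I"
  proof (rule inj_onI, rule ccontr)
    fix i k assume ik: "i \<in> I" "k \<in> I" "e i = e k" "i \<noteq> k"
    have "R (\<lambda>_. 0) (\<lambda>l. 1 * \<epsilon> i l + (- 1) * \<epsilon> k l)"
      using linear[OF \<epsilon>(1)[of i] \<epsilon>(1)[of k], of 1 "- 1"] ik(3) by simp
    then have "\<forall>l\<in>I. 1 * \<epsilon> i l + (- 1) * \<epsilon> k l = 0" using kernel R0 by blast
    then show False using ik \<epsilon>(2)[of i i] \<epsilon>(2)[of i k] by auto
  qed
  have "independent_modulo W (e ` I)"
    unfolding independent_modulo_def
  proof (intro allI impI ballI)
    fix c b assume W: "(\<lambda>x. \<Sum>b\<in>e ` I. c b * b x) \<in> W" and "b \<in> e ` I"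
    then obtain k where k: "k \<in> I" "b = e k" by blast
    define a where "a = (\<lambda>b. \<epsilon> (the_inv_into I e b))"
    have a: "a (e i) = \<epsilon> i" if "i \<in> I" for i using that inj by (simp add: a_def the_inv_into_f_f)
    have "R (\<lambda>x. \<Sum>b\<in>e ` I. c b * b x) (\<lambda>i. \<Sum>b\<in>e ` I. c b * a b i)"
      by (rule Rsum) (use fin a \<epsilon>(1) in auto)
    from kernel[OF this] W k(1) have "(\<Sum>b\<in>e ` I. c b * a b k) = 0" by blast
    also have "(\<Sum>b\<in>e ` I. c b * a b k) = (\<Sum>i\<in>I. c (e i) * a (e i) k)" by (rule sum.reindex_cong[OF inj]) auto
    also have "\<dots> = (\<Sum>i\<in>I. if i = k then c (e k) else 0)"
      by (intro sum.cong) (use a \<epsilon>(2) k in auto)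
    also have "\<dots> = c (e k)" using fin k by simp
    finally show "c b = 0" using k by simp
  qed
  moreover have "card (e ` I) = card I" using inj by (rule card_image)
  ultimately show ?thesis
    unfolding quotient_dim_def
    by (intro antisym SUP_least SUP_upper2[of "e ` I"]) (use fin e(1) upper in auto)
qed


section \<open>The invariant \<open>\<chi>\<^sup>0\<close>\<close>

text \<open>The triple stands for \<open>y^max(0, m-i) (1-y)^n\<close> in weight
  \<open>(i, j)\<close>. The second inequality bounds its degree by \<open>m\<close> and by
  \<open>2 j - i\<close>, so that it is regular off the exceptional curve; the first says that it is
  not regular along the curve.\<close>

definition chi0_index :: "nat \<Rightarrow> ((int \<times> int) \<times> nat) set" where
  "chi0_index m = {((i, j), n). int n < int m - j \<and> int n + max 0 (int m - i) \<le> min (int m) (2 * j - i)}"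

lemma finite_chi0_index: "finite (chi0_index m)"
proof (rule finite_subset)
  show "chi0_index m \<subseteq> ({0..2 * int m} \<times> {0..int m}) \<times> {..m}" by (auto simp: chi0_index_def)
qed simp

abbreviation y1 :: "complex poly" where "y1 \<equiv> [:1, - 1:]"

lemma pcompose_y1_y1: "pcompose (pcompose h y1) y1 = h"
  by (simp add: pcompose_assoc[symmetric] pcompose_pCons)

text \<open>Substituting \<open>1 - y\<close> for \<open>y\<close> is an involution that exchanges
  \<open>y\<close> and \<open>1 - y\<close>, so divisibility by a power of \<open>1 - y\<close>
  turns into the vanishing of low coefficients.\<close>

lemma y1_power_dvd_pcompose: "y1 ^ n dvd pcompose h y1 \<longleftrightarrow> (\<forall>k<n. coeff h k = 0)"
proof -
  have y: "pcompose [:0, 1:] y1 = y1" "pcompose y1 y1 = [:0, 1:]" by (simp_all add: pcompose_pCons)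
  have p: "pcompose (f ^ n) y1 = (pcompose f y1) ^ n" for f :: "complex poly" and n
    by (induction n) (simp_all add: pcompose_mult pcompose_1)
  have "y1 ^ n dvd pcompose h y1 \<longleftrightarrow> [:0, 1:] ^ n dvd h"
  proof
    assume "y1 ^ n dvd pcompose h y1"
    then obtain g where "pcompose h y1 = y1 ^ n * g" by (rule dvdE)
    then have "pcompose (pcompose h y1) y1 = pcompose (y1 ^ n * g) y1" by simp
    then have "h = [:0, 1:] ^ n * pcompose g y1" by (simp only: pcompose_y1_y1 pcompose_mult p y)
    then show "[:0, 1:] ^ n dvd h" by simp
  next
    assume "[:0, 1:] ^ n dvd h"
    then obtain g where "h = [:0, 1:] ^ n * g" by (rule dvdE)
    then have "pcompose h y1 = y1 ^ n * pcompose g y1" by (simp only: pcompose_mult p y)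
    then show "y1 ^ n dvd pcompose h y1" by simp
  qed
  also have "\<dots> \<longleftrightarrow> (\<forall>k<n. coeff h k = 0)"
    using monom_1_dvd_iff'[of n h] by (simp add: monom_altdef)
  finally show ?thesis .
qed

text \<open>\<open>a\<close> lists the coefficients of each weight part in powers of
  \<open>1 - y\<close>, after the power of \<open>y\<close> forced by regularity along
  \<open>u = 0\<close> has been split off.\<close>

definition chi0_rel where
  "chi0_rel m \<omega> a \<longleftrightarrow> (\<exists>q h. \<omega> \<in> F m (Y - A1_exceptional) \<and> gexp False \<omega> q \<and>
     (\<forall>p. q p = [:0, 1:] ^ nat (int m - fst p) * pcompose (h p) y1) \<and> (\<forall>p n. a (p, n) = coeff (h p) n))"

lemma local_chi0_eq: "local_chi0 A1_resolution A1_exceptional (F m) = enat (card (chi0_index m))"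
  unfolding local_chi0_def
proof (rule quotient_dim_eqI[where R = "chi0_rel m", OF finite_chi0_index])
  fix \<omega> assume \<omega>: "\<omega> \<in> F m (Y - A1_exceptional)"
  from F_expansion_Y_minus_E[OF this] obtain q where q: "gexp False \<omega> q" "good m True True False q" by blast
  then have "\<exists>g. q p = [:0, 1:] ^ nat (int m - fst p) * g" for p
    using goodD(3)[OF q(2), of p] by (simp add: condU_def dvd_def)
  then obtain g where "\<And>p. q p = [:0, 1:] ^ nat (int m - fst p) * g p" by metis
  then have "\<And>p. q p = [:0, 1:] ^ nat (int m - fst p) * pcompose (pcompose (g p) y1) y1"
    by (simp only: pcompose_y1_y1)
  with \<omega> q(1) show "\<exists>a. chi0_rel m \<omega> a" unfolding chi0_rel_def
    by (intro exI[of _ "\<lambda>(p, n). coeff (pcompose (g p) y1) n"] exI[of _ q] exI[of _ "\<lambda>p. pcompose (g p) y1"]) simp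
next
  fix \<omega> \<omega>' a a' c d assume "chi0_rel m \<omega> a" "chi0_rel m \<omega>' a'"
  then obtain q h q' h' where
    1: "\<omega> \<in> F m (Y - A1_exceptional)" "gexp False \<omega> q"
     "\<forall>p. q p = [:0, 1:] ^ nat (int m - fst p) * pcompose (h p) y1" "\<forall>p n. a (p, n) = coeff (h p) n" and
    2: "\<omega>' \<in> F m (Y - A1_exceptional)" "gexp False \<omega>' q'"
     "\<forall>p. q' p = [:0, 1:] ^ nat (int m - fst p) * pcompose (h' p) y1" "\<forall>p n. a' (p, n) = coeff (h' p) n"
    unfolding chi0_rel_def by (elim exE conjE)
  show "chi0_rel m (\<lambda>x. c * \<omega> x + d * \<omega>' x) (\<lambda>i. c * a i + d * a' i)"
    unfolding chi0_rel_def
  proof (rule exI[of _ "\<lambda>p. smult c (q p) + smult d (q' p)"], rule exI[of _ "\<lambda>p. smult c (h p) + smult d (h' p)"], intro conjI allI)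
    show "(\<lambda>x. c * \<omega> x + d * \<omega>' x) \<in> F m (Y - A1_exceptional)"
      by (rule F_linear[OF openin_Y_minus_E 1(1) 2(1)])
    show "gexp False (\<lambda>x. c * \<omega> x + d * \<omega>' x) (\<lambda>p. smult c (q p) + smult d (q' p))"
      by (rule gexp_linear[OF 1(2) 2(2)])
    fix p :: "int \<times> int"
    show "smult c (q p) + smult d (q' p) =
        [:0, 1:] ^ nat (int m - fst p) * pcompose (smult c (h p) + smult d (h' p)) y1"
      unfolding 1(3)[rule_format, of p] 2(3)[rule_format, of p]
      by (simp only: pcompose_add pcompose_smult distrib_left mult_smult_right)
    show "c * a (p, n) + d * a' (p, n) = coeff (smult c (h p) + smult d (h' p)) n" for n
      by (simp add: 1(4) 2(4))
  qed
next
  fix \<omega> a assume "chi0_rel m \<omega> a"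
  then obtain q h where
    \<omega>: "\<omega> \<in> F m (Y - A1_exceptional)" "gexp False \<omega> q" and
    h: "\<forall>p. q p = [:0, 1:] ^ nat (int m - fst p) * pcompose (h p) y1" and a: "\<forall>p n. a (p, n) = coeff (h p) n"
    unfolding chi0_rel_def by (elim exE conjE)
  from F_expansion_Y_minus_E[OF \<omega>(1)] obtain q' where "gexp False \<omega> q'" "good m True True False q'" by blast
  with gexp_unique[OF \<omega>(2)] have g: "good m True True False q" by auto
  have condV: "condV m (snd p) (q p) \<longleftrightarrow> (\<forall>k<nat (int m - snd p). coeff (h p) k = 0)" for p
    unfolding condV_def h[rule_format, of p] y1_power_dvd_pcompose[symmetric]
    by (rule y1_power_dvd_mult)
  \<comment> \<open>Coefficients violating the second inequality of \<open>chi0_index\<close> vanish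
    for every form on the complement of the curve, by the two degree bounds on \<open>q p\<close>.
    Only those violating regularity along the curve remain to be tested.\<close>
  have deg: "coeff (h p) n = 0" if "\<not> int n + max 0 (int m - fst p) \<le> min (int m) (2 * snd p - fst p)" for p n
  proof (rule ccontr)
    assume nz: "coeff (h p) n \<noteq> 0"
    then have "h p \<noteq> 0" by auto
    then have nz': "pcompose (h p) y1 \<noteq> 0" by (metis pcompose_0 pcompose_y1_y1)
    then have "q p \<noteq> 0" unfolding h[rule_format, of p] by simp
    have "degree (pcompose (h p) y1) = degree (h p)" by (simp add: degree_pcompose)
    then have dq: "degree (q p) = nat (int m - fst p) + degree (h p)"
      unfolding h[rule_format, of p] using nz' by (simp add: degree_mult_eq degree_power_eq)
    have "n \<le> degree (h p)" using nz by (rule le_degree)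
    moreover have "degree (q p) \<le> m" by (rule goodD(2)[OF g])
    moreover have "int (degree (q p)) \<le> 2 * snd p - fst p"
      using goodD(4)[OF g, of p] \<open>q p \<noteq> 0\<close> by (metis condU_def leading_coeff_0_iff not_le)
    ultimately show False using that unfolding dq by linarith
  qed
  \<comment> \<open>Extension over the curve is decided by the expansion: the form on
    \<open>Y\<close> built from \<open>q\<close> restricts to \<open>\<omega>\<close> by
    \<open>F_identity\<close>.\<close>
  have "\<omega> \<in> restrict_section (Y - A1_exceptional) ` F m Y \<longleftrightarrow> good m True True True q"
  proof
    assume "\<omega> \<in> restrict_section (Y - A1_exceptional) ` F m Y"
    then obtain \<omega>' where \<omega>': "\<omega> = restrict_section (Y - A1_exceptional) \<omega>'" "\<omega>' \<in> F m Y" by blast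
    from F_expansion_Y[OF \<omega>'(2)] obtain q' where q': "gexp False \<omega>' q'" "good m True True True q'" by blast
    have "gexp False \<omega> q'"
      unfolding \<omega>'(1) by (subst gexp_restrict) (use q' psi_in_Y psi_exceptional in auto)
    with gexp_unique[OF \<omega>(2)] q'(2) show "good m True True True q" by auto
  next
    assume "good m True True True q"
    then obtain \<omega>' where \<omega>': "\<omega>' \<in> F m Y" "gexp False \<omega>' q" using F_of_expansion_Y by blast
    have "\<omega> = restrict_section (Y - A1_exceptional) \<omega>'"
    proof (rule F_identity[OF openin_Y_minus_E \<omega>(1)])
      show "restrict_section (Y - A1_exceptional) \<omega>' \<in> F m (Y - A1_exceptional)"
        by (rule F_restrict[OF \<omega>'(1) openin_Y_minus_E]) simp
      have "gexp False (restrict_section (Y - A1_exceptional) \<omega>') q"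
        by (subst gexp_restrict) (use \<omega>' psi_in_Y psi_exceptional in auto)
      then show "tval False \<omega> u v y = tval False (restrict_section (Y - A1_exceptional) \<omega>') u v y"
        if "u \<noteq> 0" "v \<noteq> 0" for u v y
        using \<omega>(2) that by (simp add: gexp_def)
    qed
    with \<omega>'(1) show "\<omega> \<in> restrict_section (Y - A1_exceptional) ` F m Y" by blast
  qed
  also have "\<dots> \<longleftrightarrow> (\<forall>p. condV m (snd p) (q p))" using g unfolding good_def by blast
  also have "\<dots> \<longleftrightarrow> (\<forall>i\<in>chi0_index m. a i = 0)"
  proof
    assume *: "\<forall>p. condV m (snd p) (q p)"
    show "\<forall>i\<in>chi0_index m. a i = 0"
    proof
      fix x assume "x \<in> chi0_index m"
      then obtain i j n where x: "x = ((i, j), n)" "int n < int m - j" by (auto simp: chi0_index_def)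
      then show "a x = 0" using *[rule_format, of "(i, j)"] condV[of "(i, j)"] a by simp
    qed
  next
    assume *: "\<forall>i\<in>chi0_index m. a i = 0"
    show "\<forall>p. condV m (snd p) (q p)"
      unfolding condV
    proof (intro allI impI)
      fix p :: "int \<times> int" and k assume k: "k < nat (int m - snd p)"
      show "coeff (h p) k = 0"
      proof (cases "int k + max 0 (int m - fst p) \<le> min (int m) (2 * snd p - fst p)")
        case True
        with k have "(p, k) \<in> chi0_index m" by (cases p) (auto simp: chi0_index_def)
        then show ?thesis using * a by metis
      qed (rule deg)
    qed
  qed
  finally show "\<omega> \<in> restrict_section (Y - A1_exceptional) ` F m Y \<longleftrightarrow> (\<forall>i\<in>chi0_index m. a i = 0)" .
next
  fix a :: "(int \<times> int) \<times> nat \<Rightarrow> complex"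
  \<comment> \<open>The prescribed values are used on the finite index set only, which gives finite
    support and the degree bounds.\<close>
  define h where "h = (\<lambda>p. \<Sum>n | (p, n) \<in> chi0_index m. monom (a (p, n)) n)"
  have finp: "finite {n. (p, n) \<in> chi0_index m}" for p
    by (rule finite_subset[of _ "snd ` chi0_index m"]) (force, simp add: finite_chi0_index)
  have ch: "coeff (h p) n = (if (p, n) \<in> chi0_index m then a (p, n) else 0)" for p n
  proof -
    have "coeff (h p) n = (\<Sum>k | (p, k) \<in> chi0_index m. if k = n then a (p, n) else 0)"
      unfolding h_def coeff_sum by (intro sum.cong) (auto simp: coeff_monom)
    then show ?thesis using finp[of p] by simp
  qed
  define q where "q = (\<lambda>p. [:0, 1:] ^ nat (int m - fst p) * pcompose (h p) y1)"
  have h0: "h p \<noteq> 0 \<longrightarrow> p \<in> fst ` chi0_index m" for p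
  proof
    assume "h p \<noteq> 0"
    then obtain n where "coeff (h p) n \<noteq> 0" by (metis leading_coeff_0_iff)
    then have "(p, n) \<in> chi0_index m" using ch by metis
    then show "p \<in> fst ` chi0_index m" by force
  qed
  have "{p. q p \<noteq> 0} \<subseteq> fst ` chi0_index m"
  proof
    fix p assume "p \<in> {p. q p \<noteq> 0}"
    then have "h p \<noteq> 0" by (auto simp: q_def)
    with h0 show "p \<in> fst ` chi0_index m" by blast
  qed
  then have "fsupp q" unfolding fsupp_def by (rule finite_subset) (simp add: finite_chi0_index)
  moreover have deg: "q p = 0 \<or> int (degree (q p)) \<le> min (int m) (2 * snd p - fst p)" for p
  proof (cases "h p = 0")
    case False
    then have "coeff (h p) (degree (h p)) \<noteq> 0" by simp
    then have "(p, degree (h p)) \<in> chi0_index m" using ch by metis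
    then have "int (degree (h p)) + max 0 (int m - fst p) \<le> min (int m) (2 * snd p - fst p)"
      by (cases p) (simp add: chi0_index_def)
    moreover have "degree (q p) \<le> nat (int m - fst p) + degree (h p)"
      unfolding q_def by (rule order.trans[OF degree_mult_le]) (simp add: degree_pcompose degree_power_eq)
    ultimately show ?thesis by auto
  qed (simp add: q_def)
  ultimately have "good m True True False q"
    unfolding good_def
  proof (intro conjI allI impI)
    fix p
    show "degree (q p) \<le> m" using deg[of p] by auto
    show "condU m False (fst p) (q p)" by (simp add: condU_def q_def)
    show "condU m True (2 * snd p - fst p) (q p)"
      using deg[of p] by (cases "q p = 0") (auto simp: condU_def intro!: coeff_eq_0)
  qed simp_all
  from F_of_expansion_Y_minus_E[OF this] obtain \<omega> where \<omega>: "\<omega> \<in> F m (Y - A1_exceptional)" "gexp False \<omega> q" by blast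
  have "chi0_rel m \<omega> (\<lambda>(p, n). coeff (h p) n)"
    unfolding chi0_rel_def by (intro exI[of _ q] exI[of _ h]) (use \<omega> in \<open>simp add: q_def\<close>)
  then show "\<exists>\<omega>\<in>F m (Y - A1_exceptional). \<exists>a'. chi0_rel m \<omega> a' \<and> (\<forall>i\<in>chi0_index m. a' i = a i)"
    using \<omega>(1) ch by (intro bexI[of _ \<omega>] exI[of _ "\<lambda>(p, n). coeff (h p) n"]) auto
qed

section \<open>The invariant \<open>\<chi>\<^sup>1\<close>\<close>

text \<open>By uniqueness of coefficients a cocycle of forms on the chart is a family of
  \<open>m + 1\<close> cocycles of functions on the plane. Each is split by
  \<open>cech_vanishing_plane\<close>, and \<open>mkform\<close> reassembles the solutions.\<close>

lemma chart_cech_vanishing: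
  assumes U: "point_cover A1_resolution U"
    and reg: "\<And>p q. p \<in> Y \<Longrightarrow> q \<in> Y \<Longrightarrow> restrict_section (U p \<inter> U q) (\<lambda>z. c (p, q, z)) \<in> F m (U p \<inter> U q)"
    and coc: "\<And>p q r x D. p \<in> Y \<Longrightarrow> q \<in> Y \<Longrightarrow> r \<in> Y \<Longrightarrow> x \<in> U p \<inter> U q \<inter> U r \<Longrightarrow>
       c (p, q, x, D) + c (q, r, x, D) = c (p, r, x, D)"
  shows "\<exists>\<beta>. (\<forall>p\<in>Y. \<beta> p \<in> F m (U p \<inter> range (psi b))) \<and>
     (\<forall>p\<in>Y. \<forall>q\<in>Y. \<forall>x\<in>U p \<inter> U q \<inter> range (psi b). \<forall>D. c (p, q, x, D) = \<beta> q (x, D) - \<beta> p (x, D))"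
proof -
  have op: "openin A1_resolution (U p)" "p \<in> U p" if "p \<in> Y" for p
    using U that unfolding point_cover_def by blast+
  define R where "R = (\<lambda>p q a. (\<forall>l\<le>m. regular_on (psi b -` (U p \<inter> U q)) (a l)) \<and>
     (\<forall>z \<alpha> \<beta>. psi b z \<in> U p \<inter> U q \<longrightarrow> c (p, q, psi b z, tv b z \<alpha> \<beta>) = homf m (\<lambda>l. a l z) \<alpha> \<beta>))"
  have "\<exists>a. R p q a" if "p \<in> Y" "q \<in> Y" for p q
    using F_coeffs[OF reg[OF that], of b] unfolding R_def by (simp add: restrict_section_def)
  then obtain A where A: "\<And>p q. p \<in> Y \<Longrightarrow> q \<in> Y \<Longrightarrow> R p q (A p q)" by metis
  have A1: "regular_on (psi b -` U p \<inter> psi b -` U q) (A p q l)" if "p \<in> Y" "q \<in> Y" "l \<le> m" for p q l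
    using A[OF that(1,2)] that(3) unfolding R_def by (simp add: vimage_Int)
  have A2: "c (p, q, psi b z, tv b z \<alpha> \<beta>) = homf m (\<lambda>l. A p q l z) \<alpha> \<beta>"
    if "p \<in> Y" "q \<in> Y" "psi b z \<in> U p" "psi b z \<in> U q" for p q z \<alpha> \<beta>
    using A[OF that(1,2), unfolded R_def, THEN conjunct2, THEN spec[of _ z]] that(3,4) by simp
  define Q where "Q = (\<lambda>l B. (\<forall>p\<in>Y. regular_on (psi b -` U p) (B p)) \<and>
     (\<forall>p\<in>Y. \<forall>q\<in>Y. \<forall>z\<in>psi b -` U p \<inter> psi b -` U q. A p q l z = B q z - B p z))"
  have "\<exists>B. Q l B" if l: "l \<le> m" for l
    unfolding Q_def
  proof (rule cech_vanishing_plane)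
    show "\<exists>p\<in>Y. z \<in> psi b -` U p" for z using op(2)[OF psi_in_Y, of b z] psi_in_Y by blast
    show "zopen (psi b -` U p)" if "p \<in> Y" for p by (rule zopen_vimage_psi[OF op(1)[OF that]])
    show "regular_on (psi b -` U p \<inter> psi b -` U q) (A p q l)" if "p \<in> Y" "q \<in> Y" for p q
      by (rule A1[OF that l])
    fix p q r z assume pqr: "p \<in> Y" "q \<in> Y" "r \<in> Y" and z: "z \<in> psi b -` U p \<inter> psi b -` U q \<inter> psi b -` U r"
    then have x: "psi b z \<in> U p" "psi b z \<in> U q" "psi b z \<in> U r" by simp_all
    have "homf m (\<lambda>l. A p q l z + A q r l z) \<alpha> \<beta> = homf m (\<lambda>l. A p r l z) \<alpha> \<beta>" for \<alpha> \<beta>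
      unfolding homf_add[symmetric]
      unfolding A2[OF pqr(1,2) x(1,2), symmetric] A2[OF pqr(2,3) x(2,3), symmetric] A2[OF pqr(1,3) x(1,3), symmetric]
      using x by (intro coc pqr IntI)
    from homf_unique[OF this l] show "A p q l z + A q r l z = A p r l z" .
  qed
  then obtain B where B: "\<And>l. l \<le> m \<Longrightarrow> Q l (B l)" by metis
  have B1: "regular_on (psi b -` U p) (B l p)" if "p \<in> Y" "l \<le> m" for p l
    using B[OF that(2)] that(1) unfolding Q_def by blast
  have B2: "A p q l z = B l q z - B l p z" if "p \<in> Y" "q \<in> Y" "l \<le> m" "psi b z \<in> U p" "psi b z \<in> U q" for p q l z
    using B[OF that(3), unfolded Q_def, THEN conjunct2] that(1,2,4,5) by blast
  define \<beta> where "\<beta> = (\<lambda>p. mkform m b (psi b -` U p) (\<lambda>l. B l p))"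
  have \<beta>: "\<beta> p \<in> F m (U p \<inter> range (psi b))" if "p \<in> Y" for p
    using mkform_F[of m "psi b -` U p" "\<lambda>l. B l p" b] B1[OF that] unfolding \<beta>_def image_vimage_eq by blast
  have "c (p, q, x, D) = \<beta> q (x, D) - \<beta> p (x, D)"
    if pq: "p \<in> Y" "q \<in> Y" and x: "x \<in> U p \<inter> U q \<inter> range (psi b)" for p q x D
  proof (cases "tangent x D")
    case False
    then have "restrict_section (U p \<inter> U q) (\<lambda>z. c (p, q, z)) (x, D) = 0"
      using F_off[OF reg[OF pq]] by blast
    then have "c (p, q, x, D) = 0" using x by (simp add: restrict_section_def)
    moreover have "\<beta> p (x, D) = 0" "\<beta> q (x, D) = 0" using F_off[OF \<beta>] pq False by blast+
    ultimately show ?thesis by simp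
  next
    case True
    from x obtain z where z: "x = psi b z" "psi b z \<in> U p" "psi b z \<in> U q" by blast
    define \<alpha>0 \<beta>0 where "\<alpha>0 = D (crd b pU)" "\<beta>0 = D (crd b pV)"
    have D: "D = tv b z \<alpha>0 \<beta>0" unfolding \<alpha>0_\<beta>0_def by (rule tangent_unique) (use True z in simp)
    have "c (p, q, x, D) = homf m (\<lambda>l. A p q l z) \<alpha>0 \<beta>0" unfolding D z(1) by (rule A2[OF pq z(2,3)])
    also have "\<dots> = homf m (\<lambda>l. B l q z - B l p z) \<alpha>0 \<beta>0"
      by (rule homf_cong) (rule B2[OF pq _ z(2,3)])
    also have "\<dots> = \<beta> q (x, D) - \<beta> p (x, D)"
      unfolding D z(1) \<beta>_def using z(2,3) by (simp add: mkform_psi homf_diff)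
    finally show ?thesis .
  qed
  with \<beta> show ?thesis by (intro exI[of _ \<beta>] conjI ballI allI)
qed

lemma F_glue_family:
  assumes op: "\<And>i. i \<in> I \<Longrightarrow> openin A1_resolution (W i)" and t: "\<And>i. i \<in> I \<Longrightarrow> t i \<in> F m (W i)"
    and agree: "\<And>i k x D. i \<in> I \<Longrightarrow> k \<in> I \<Longrightarrow> x \<in> W i \<Longrightarrow> x \<in> W k \<Longrightarrow> t i (x, D) = t k (x, D)"
    and V: "V = (\<Union>i\<in>I. W i)"
  shows "\<exists>\<tau>\<in>F m V. \<forall>i\<in>I. \<forall>x\<in>W i. \<forall>D. \<tau> (x, D) = t i (x, D)"
proof -
  define \<iota> where "\<iota> = (\<lambda>x. SOME i. i \<in> I \<and> x \<in> W i)"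
  have \<iota>: "\<iota> x \<in> I \<and> x \<in> W (\<iota> x)" if "x \<in> V" for x
    unfolding \<iota>_def by (rule someI_ex) (use that V in blast)
  define \<tau> where "\<tau> = (\<lambda>(x, D). if x \<in> V then t (\<iota> x) (x, D) else 0)"
  have eq: "\<tau> (x, D) = t i (x, D)" if "i \<in> I" "x \<in> W i" for i x D
  proof -
    have "x \<in> V" using that V by blast
    then show ?thesis using agree[of "\<iota> x" i x D] \<iota>[of x] that by (simp add: \<tau>_def)
  qed
  have "\<tau> \<in> F m V"
  proof (rule F_local)
    show "V \<subseteq> Y" unfolding V using openin_subset[OF op] by blast
    show "\<tau> (x, D) = 0" if "\<not> (x \<in> V \<and> tangent x D)" for x D
    proof (cases "x \<in> V")
      case True
      with that have "\<not> tangent x D" by simp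
      then show ?thesis using F_off[OF t, of "\<iota> x" x D] \<iota>[OF True] True by (simp add: \<tau>_def)
    qed (simp add: \<tau>_def)
    fix x assume x: "x \<in> V"
    note i = \<iota>[OF this]
    show "\<exists>W' V' \<omega>'. openin A1_resolution W' \<and> x \<in> W' \<and> x \<in> V' \<and> \<omega>' \<in> F m V' \<and>
        (\<forall>q\<in>W' \<inter> V'. q \<in> V \<and> (\<forall>D. tangent q D \<longrightarrow> \<tau> (q, D) = \<omega>' (q, D)))"
    proof (rule exI[of _ "W (\<iota> x)"], rule exI[of _ "W (\<iota> x)"], rule exI[of _ "t (\<iota> x)"], intro conjI ballI allI impI)
      show "openin A1_resolution (W (\<iota> x))" "t (\<iota> x) \<in> F m (W (\<iota> x))" using op t i by blast+
      show "x \<in> W (\<iota> x)" "x \<in> W (\<iota> x)" using i by blast+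
      fix q assume q: "q \<in> W (\<iota> x) \<inter> W (\<iota> x)"
      then show "q \<in> V" using i V by blast
      show "\<tau> (q, D) = t (\<iota> x) (q, D)" for D by (rule eq) (use i q in auto)
    qed
  qed
  then show ?thesis using eq by blast
qed

lemma F_scale: "openin A1_resolution V \<Longrightarrow> \<omega> \<in> F m V \<Longrightarrow> (\<lambda>x. c * \<omega> x) \<in> F m V"
  using F_linear[of V \<omega> m \<omega> c 0] by simp

lemma F_diff_restrict:
  assumes "\<omega> \<in> F m V" "\<omega>' \<in> F m V'" "openin A1_resolution W" "W \<subseteq> V" "W \<subseteq> V'"
  shows "(\<lambda>x. restrict_section W \<omega> x - restrict_section W \<omega>' x) \<in> F m W"
  using F_linear[OF assms(3) F_restrict[OF assms(1,3,4)] F_restrict[OF assms(2,3,5)], of 1 "- 1"] by simp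

text \<open>The triple stands for \<open>y^k (1-y)^(m-j)\<close> in weight \<open>(i, j)\<close>. It
  is not regular on chart \<open>False\<close> since \<open>k < m - i\<close>, nor on chart
  \<open>True\<close> since its degree \<open>m - j + k\<close> exceeds \<open>2 j - i\<close>;
  \<open>k \<le> j\<close> says that this degree is at most \<open>m\<close>.\<close>

definition chi1_index :: "nat \<Rightarrow> ((int \<times> int) \<times> nat) set" where
  "chi1_index m = {((i, j), k). 0 \<le> j \<and> j < int m \<and> int k \<le> j \<and> 3 * j - i - int m < int k \<and> int k < int m - i}"

lemma finite_chi1_index: "finite (chi1_index m)"
proof (rule finite_subset)
  show "chi1_index m \<subseteq> ({- 2 * int m..2 * int m} \<times> {0..int m}) \<times> {..m}" by (auto simp: chi1_index_def)
qed simp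

section \<open>Cech classes as forms on the overlap of the charts\<close>

abbreviation "V01 \<equiv> range (psi False) \<inter> range (psi True)"

lemma openin_V01: "openin A1_resolution V01"
  by (intro openin_Int openin_range_psi)

text \<open>On each chart the cocycle is trivialised by \<open>\<beta> b\<close>. The two
  trivialisations differ on the overlap by a single form \<open>s\<close>, and modulo forms on the
  charts \<open>s\<close> represents the class of \<open>c\<close>.\<close>

definition cech_data where
  "cech_data m c U \<beta> s \<longleftrightarrow> point_cover A1_resolution U \<and>
     (\<forall>b. \<forall>p\<in>Y. \<beta> b p \<in> F m (U p \<inter> range (psi b))) \<and>
     (\<forall>b. \<forall>p\<in>Y. \<forall>q\<in>Y. \<forall>x\<in>U p \<inter> U q \<inter> range (psi b). \<forall>D. c (p, q, x, D) = \<beta> b q (x, D) - \<beta> b p (x, D)) \<and>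
     s \<in> F m V01 \<and> (\<forall>p\<in>Y. \<forall>x\<in>U p \<inter> V01. \<forall>D. s (x, D) = \<beta> False p (x, D) - \<beta> True p (x, D))"

definition chi1_rel where
  "chi1_rel m c a \<longleftrightarrow> (\<exists>U \<beta> s q h. cech_data m c U \<beta> s \<and> gexp False s q \<and>
     (\<forall>p. q p = y1 ^ nat (int m - snd p) * h p) \<and> (\<forall>p n. a (p, n) = coeff (h p) n))"

lemma cech_dataD:
  assumes "cech_data m c U \<beta> s"
  shows "p \<in> Y \<Longrightarrow> openin A1_resolution (U p)" "p \<in> Y \<Longrightarrow> p \<in> U p"
    "p \<in> Y \<Longrightarrow> \<beta> b p \<in> F m (U p \<inter> range (psi b))"
    "p \<in> Y \<Longrightarrow> q \<in> Y \<Longrightarrow> x \<in> U p \<Longrightarrow> x \<in> U q \<Longrightarrow> x \<in> range (psi b) \<Longrightarrow> c (p, q, x, D) = \<beta> b q (x, D) - \<beta> b p (x, D)"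
    "s \<in> F m V01"
    "p \<in> Y \<Longrightarrow> x \<in> U p \<Longrightarrow> x \<in> V01 \<Longrightarrow> s (x, D) = \<beta> False p (x, D) - \<beta> True p (x, D)"
proof -
  note d = assms[unfolded cech_data_def point_cover_def]
  show "p \<in> Y \<Longrightarrow> openin A1_resolution (U p)" "p \<in> Y \<Longrightarrow> p \<in> U p"
    using d[THEN conjunct1] by blast+
  show "p \<in> Y \<Longrightarrow> \<beta> b p \<in> F m (U p \<inter> range (psi b))"
    using d[THEN conjunct2, THEN conjunct1, THEN spec[of _ b]] by blast
  show "p \<in> Y \<Longrightarrow> q \<in> Y \<Longrightarrow> x \<in> U p \<Longrightarrow> x \<in> U q \<Longrightarrow> x \<in> range (psi b) \<Longrightarrow> c (p, q, x, D) = \<beta> b q (x, D) - \<beta> b p (x, D)"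
    using d[THEN conjunct2, THEN conjunct2, THEN conjunct1, THEN spec[of _ b]] by blast
  show "s \<in> F m V01" using d[THEN conjunct2, THEN conjunct2, THEN conjunct2, THEN conjunct1] .
  show "p \<in> Y \<Longrightarrow> x \<in> U p \<Longrightarrow> x \<in> V01 \<Longrightarrow> s (x, D) = \<beta> False p (x, D) - \<beta> True p (x, D)"
    using d[THEN conjunct2, THEN conjunct2, THEN conjunct2, THEN conjunct2] by blast
qed

lemma cech_dataI:
  assumes "\<And>p. p \<in> Y \<Longrightarrow> openin A1_resolution (U p)" "\<And>p. p \<in> Y \<Longrightarrow> p \<in> U p"
    "\<And>b p. p \<in> Y \<Longrightarrow> \<beta> b p \<in> F m (U p \<inter> range (psi b))"
    "\<And>b p q x D. p \<in> Y \<Longrightarrow> q \<in> Y \<Longrightarrow> x \<in> U p \<Longrightarrow> x \<in> U q \<Longrightarrow> x \<in> range (psi b) \<Longrightarrow>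
       c (p, q, x, D) = \<beta> b q (x, D) - \<beta> b p (x, D)"
    "s \<in> F m V01"
    "\<And>p x D. p \<in> Y \<Longrightarrow> x \<in> U p \<Longrightarrow> x \<in> V01 \<Longrightarrow> s (x, D) = \<beta> False p (x, D) - \<beta> True p (x, D)"
  shows "cech_data m c U \<beta> s"
  unfolding cech_data_def point_cover_def
  using assms(5) by (intro conjI ballI allI assms(1,2,3)) (blast intro!: assms(4,6))+

text \<open>\<open>\<beta> False\<close> and \<open>\<beta> True\<close> both have coboundary
  \<open>c\<close>, so their difference at \<open>p\<close> does not depend on \<open>p\<close>, and
  these differences glue to a form on the overlap.\<close>

lemma cech_data_exists:
  assumes "c \<in> cech_cocycles A1_resolution (F m)"
  shows "\<exists>U \<beta> s. cech_data m c U \<beta> s"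
proof -
  from assms[unfolded cech_cocycles_def mem_Collect_eq] obtain U where U: "point_cover A1_resolution U"
    and reg: "\<forall>p\<in>Y. \<forall>q\<in>Y. restrict_section (U p \<inter> U q) (\<lambda>z. c (p, q, z)) \<in> F m (U p \<inter> U q)"
    and coc: "\<forall>p\<in>Y. \<forall>q\<in>Y. \<forall>r\<in>Y. \<forall>x \<in> U p \<inter> U q \<inter> U r. \<forall>v.
        c (p, q, x, v) + c (q, r, x, v) = c (p, r, x, v)" by (elim exE conjE)
  have op: "openin A1_resolution (U p)" "p \<in> U p" if "p \<in> Y" for p
    using U that unfolding point_cover_def by blast+
  define R where "R = (\<lambda>b \<beta>. (\<forall>p\<in>Y. \<beta> p \<in> F m (U p \<inter> range (psi b))) \<and>
     (\<forall>p\<in>Y. \<forall>q\<in>Y. \<forall>x\<in>U p \<inter> U q \<inter> range (psi b). \<forall>D. c (p, q, x, D) = \<beta> q (x, D) - \<beta> p (x, D)))"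
  have "\<exists>\<beta>. R b \<beta>" for b
    unfolding R_def by (rule chart_cech_vanishing[OF U]) (use reg coc in blast)+
  then obtain \<beta> where \<beta>: "\<And>b. R b (\<beta> b)" by metis
  have \<beta>1: "\<beta> b p \<in> F m (U p \<inter> range (psi b))" if "p \<in> Y" for b p
    using \<beta>[of b, unfolded R_def, THEN conjunct1] that by blast
  have \<beta>2: "c (p, q, x, D) = \<beta> b q (x, D) - \<beta> b p (x, D)"
    if "p \<in> Y" "q \<in> Y" "x \<in> U p" "x \<in> U q" "x \<in> range (psi b)" for b p q x D
    using \<beta>[of b, unfolded R_def, THEN conjunct2] that by blast
  let ?W = "\<lambda>p. U p \<inter> V01"
  let ?t = "\<lambda>p x. restrict_section (?W p) (\<beta> False p) x - restrict_section (?W p) (\<beta> True p) x"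
  have "\<exists>s\<in>F m V01. \<forall>p\<in>Y. \<forall>x\<in>?W p. \<forall>D. s (x, D) = ?t p (x, D)"
  proof (rule F_glue_family)
    show "openin A1_resolution (?W p)" if "p \<in> Y" for p by (intro openin_Int[OF op(1)[OF that]] openin_V01)
    then show "?t p \<in> F m (?W p)" if "p \<in> Y" for p
      using that by (intro F_diff_restrict[OF \<beta>1[OF that] \<beta>1[OF that]]) blast+
    show "V01 = (\<Union>p\<in>Y. ?W p)" using op(2) psi_in_Y by blast
    fix p q x D assume *: "p \<in> Y" "q \<in> Y" "x \<in> ?W p" "x \<in> ?W q"
    then have "\<beta> False q (x, D) - \<beta> False p (x, D) = \<beta> True q (x, D) - \<beta> True p (x, D)"
      using \<beta>2[of p q x False D] \<beta>2[of p q x True D] by simp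
    then show "?t p (x, D) = ?t q (x, D)" using * by (simp add: restrict_section_def algebra_simps)
  qed
  then obtain s where s: "s \<in> F m V01" "\<And>p x D. p \<in> Y \<Longrightarrow> x \<in> ?W p \<Longrightarrow> s (x, D) = ?t p (x, D)" by blast
  have "cech_data m c U \<beta> s"
    by (rule cech_dataI[OF op \<beta>1 \<beta>2 s(1)]) (simp_all add: s(2) restrict_section_def)
  then show ?thesis by blast
qed

text \<open>Sections are 0 off their open set, so both trivialisations are cut down to the common
  refinement before they are added.\<close>

lemma cech_data_linear:
  assumes 1: "cech_data m c U \<beta> s" and 2: "cech_data m c' U' \<beta>' s'"
  shows "cech_data m (\<lambda>x. k * c x + k' * c' x) (\<lambda>p. U p \<inter> U' p)
    (\<lambda>b p x. k * restrict_section (U p \<inter> U' p \<inter> range (psi b)) (\<beta> b p) x +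
       k' * restrict_section (U p \<inter> U' p \<inter> range (psi b)) (\<beta>' b p) x) (\<lambda>x. k * s x + k' * s' x)"
proof (rule cech_dataI)
  show "openin A1_resolution (U p \<inter> U' p)" "p \<in> U p \<inter> U' p" if "p \<in> Y" for p
    using cech_dataD(1,2)[OF 1 that] cech_dataD(1,2)[OF 2 that] by auto
  have op: "openin A1_resolution (U p \<inter> U' p \<inter> range (psi b))" if "p \<in> Y" for p b
    by (intro openin_Int openin_range_psi cech_dataD(1)[OF 1 that] cech_dataD(1)[OF 2 that])
  show "(\<lambda>x. k * restrict_section (U p \<inter> U' p \<inter> range (psi b)) (\<beta> b p) x +
       k' * restrict_section (U p \<inter> U' p \<inter> range (psi b)) (\<beta>' b p) x) \<in> F m (U p \<inter> U' p \<inter> range (psi b))"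
    if "p \<in> Y" for b p
    by (intro F_linear F_restrict[OF cech_dataD(3)[OF 1 that]] F_restrict[OF cech_dataD(3)[OF 2 that]] op that) auto
  show "(\<lambda>x. k * s x + k' * s' x) \<in> F m V01"
    by (rule F_linear[OF openin_V01 cech_dataD(5)[OF 1] cech_dataD(5)[OF 2]])
next
  fix b p q x D assume *: "p \<in> Y" "q \<in> Y" "x \<in> U p \<inter> U' p" "x \<in> U q \<inter> U' q" "x \<in> range (psi b)"
  then have e: "c (p, q, x, D) = \<beta> b q (x, D) - \<beta> b p (x, D)" "c' (p, q, x, D) = \<beta>' b q (x, D) - \<beta>' b p (x, D)"
    using cech_dataD(4)[OF 1, of p q x b D] cech_dataD(4)[OF 2, of p q x b D] by simp_all
  show "k * c (p, q, x, D) + k' * c' (p, q, x, D) =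
      (k * restrict_section (U q \<inter> U' q \<inter> range (psi b)) (\<beta> b q) (x, D) +
       k' * restrict_section (U q \<inter> U' q \<inter> range (psi b)) (\<beta>' b q) (x, D)) -
      (k * restrict_section (U p \<inter> U' p \<inter> range (psi b)) (\<beta> b p) (x, D) +
       k' * restrict_section (U p \<inter> U' p \<inter> range (psi b)) (\<beta>' b p) (x, D))"
    unfolding e using * by (simp add: restrict_section_def algebra_simps)
next
  fix p x D assume *: "p \<in> Y" "x \<in> U p \<inter> U' p" "x \<in> V01"
  then have e: "s (x, D) = \<beta> False p (x, D) - \<beta> True p (x, D)" "s' (x, D) = \<beta>' False p (x, D) - \<beta>' True p (x, D)"
    using cech_dataD(6)[OF 1, of p x D] cech_dataD(6)[OF 2, of p x D] by simp_all
  show "k * s (x, D) + k' * s' (x, D) =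
      (k * restrict_section (U p \<inter> U' p \<inter> range (psi False)) (\<beta> False p) (x, D) +
       k' * restrict_section (U p \<inter> U' p \<inter> range (psi False)) (\<beta>' False p) (x, D)) -
      (k * restrict_section (U p \<inter> U' p \<inter> range (psi True)) (\<beta> True p) (x, D) +
       k' * restrict_section (U p \<inter> U' p \<inter> range (psi True)) (\<beta>' True p) (x, D))"
    unfolding e using * by (simp add: restrict_section_def algebra_simps)
qed

text \<open>If \<open>c\<close> is the coboundary of \<open>g\<close>, then
  \<open>g p - \<beta> b p\<close> does not depend on \<open>p\<close> and glues to a form on chart
  \<open>b\<close>; the two forms differ by \<open>s\<close>. Conversely
  \<open>\<beta> b p + t b\<close> is the same for both charts on the overlap and glues to a section
  over \<open>U p\<close>, and these sections have coboundary \<open>c\<close>.\<close>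

lemma cech_coboundary_iff:
  assumes d: "cech_data m c U \<beta> s"
  shows "c \<in> cech_coboundaries A1_resolution (F m) \<longleftrightarrow>
     (\<exists>t0\<in>F m (range (psi False)). \<exists>t1\<in>F m (range (psi True)). \<forall>x\<in>V01. \<forall>D. s (x, D) = t1 (x, D) - t0 (x, D))"
proof
  assume "c \<in> cech_coboundaries A1_resolution (F m)"
  from this[unfolded cech_coboundaries_def mem_Collect_eq] obtain U' g where U': "point_cover A1_resolution U'"
    and g: "\<forall>p\<in>Y. g p \<in> F m (U' p)"
    and cg: "\<forall>p\<in>Y. \<forall>q\<in>Y. \<forall>x \<in> U' p \<inter> U' q. \<forall>v. c (p, q, x, v) = g q (x, v) - g p (x, v)" by (elim exE conjE)
  have op: "openin A1_resolution (U' p)" "p \<in> U' p" if "p \<in> Y" for p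
    using U' that unfolding point_cover_def by blast+
  let ?W = "\<lambda>b p. U p \<inter> U' p \<inter> range (psi b)"
  have opW: "openin A1_resolution (?W b p)" if "p \<in> Y" for b p
    by (intro openin_Int openin_range_psi op[OF that] cech_dataD(1)[OF d that])
  let ?t = "\<lambda>b p x. restrict_section (?W b p) (g p) x - restrict_section (?W b p) (\<beta> b p) x"
  have "\<exists>\<tau>\<in>F m (range (psi b)). \<forall>p\<in>Y. \<forall>x\<in>?W b p. \<forall>D. \<tau> (x, D) = ?t b p (x, D)" for b
  proof (rule F_glue_family[OF opW])
    show "?t b p \<in> F m (?W b p)" if "p \<in> Y" for p
      by (rule F_diff_restrict[OF _ cech_dataD(3)[OF d that, of b] opW[OF that]]) (use g that in auto)
    show "range (psi b) = (\<Union>p\<in>Y. ?W b p)" using op(2) cech_dataD(2)[OF d] psi_in_Y by blast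
    fix p q x D assume *: "p \<in> Y" "q \<in> Y" "x \<in> ?W b p" "x \<in> ?W b q"
    then have "c (p, q, x, D) = \<beta> b q (x, D) - \<beta> b p (x, D)" by (intro cech_dataD(4)[OF d]) auto
    moreover have "c (p, q, x, D) = g q (x, D) - g p (x, D)" using cg * by blast
    ultimately show "?t b p (x, D) = ?t b q (x, D)" using * by (simp add: restrict_section_def algebra_simps)
  qed
  then obtain \<tau> where \<tau>: "\<And>b. \<tau> b \<in> F m (range (psi b))"
    "\<And>b p x D. p \<in> Y \<Longrightarrow> x \<in> ?W b p \<Longrightarrow> \<tau> b (x, D) = ?t b p (x, D)" by metis
  have "s (x, D) = \<tau> True (x, D) - \<tau> False (x, D)" if x: "x \<in> V01" for x D
  proof -
    have "x \<in> Y" using x psi_in_Y by blast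
    with x have xW: "x \<in> ?W False x" "x \<in> ?W True x" using op(2) cech_dataD(2)[OF d] by blast+
    then show ?thesis
      using cech_dataD(6)[OF d \<open>x \<in> Y\<close> _ x, of D] \<tau>(2)[OF \<open>x \<in> Y\<close> xW(1), of D] \<tau>(2)[OF \<open>x \<in> Y\<close> xW(2), of D]
      by (simp add: restrict_section_def)
  qed
  then show "\<exists>t0\<in>F m (range (psi False)). \<exists>t1\<in>F m (range (psi True)). \<forall>x\<in>V01. \<forall>D. s (x, D) = t1 (x, D) - t0 (x, D)"
    using \<tau>(1) by blast
next
  assume "\<exists>t0\<in>F m (range (psi False)). \<exists>t1\<in>F m (range (psi True)). \<forall>x\<in>V01. \<forall>D. s (x, D) = t1 (x, D) - t0 (x, D)"
  then obtain t0 t1 where t: "t0 \<in> F m (range (psi False))" "t1 \<in> F m (range (psi True))"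
    and s: "\<And>x D. x \<in> V01 \<Longrightarrow> s (x, D) = t1 (x, D) - t0 (x, D)" by blast
  define t where "t = (\<lambda>b::bool. if b then t1 else t0)"
  have tF: "t b \<in> F m (range (psi b))" for b using t by (cases b) (simp_all add: t_def)
  let ?W = "\<lambda>p b. U p \<inter> range (psi b)"
  have opW: "openin A1_resolution (?W p b)" if "p \<in> Y" for b p
    by (intro openin_Int openin_range_psi cech_dataD(1)[OF d that])
  let ?g = "\<lambda>p b x. restrict_section (?W p b) (\<beta> b p) x + restrict_section (?W p b) (t b) x"
  have "\<exists>\<tau>\<in>F m (U p). \<forall>b\<in>UNIV. \<forall>x\<in>?W p b. \<forall>D. \<tau> (x, D) = ?g p b (x, D)" if p: "p \<in> Y" for p
  proof (rule F_glue_family[OF opW[OF p]])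
    show "?g p b \<in> F m (?W p b)" for b
      using F_linear[OF opW[OF p] F_restrict[OF cech_dataD(3)[OF d p] opW[OF p] subset_refl]
          F_restrict[OF tF opW[OF p] Int_lower2], where c = 1 and d = 1] by simp
    have "U p \<subseteq> Y" by (rule openin_subset[OF cech_dataD(1)[OF d p]])
    then show "U p = (\<Union>b\<in>UNIV. ?W p b)" unfolding Y_eq by (auto simp: UNIV_bool)
    fix b b' x D assume *: "x \<in> ?W p b" "x \<in> ?W p b'"
    have "\<beta> False p (x, D) + t0 (x, D) = \<beta> True p (x, D) + t1 (x, D)" if "x \<in> U p" "x \<in> V01"
      using cech_dataD(6)[OF d p that, of D] s[OF that(2), of D] by (simp add: algebra_simps)
    then show "?g p b (x, D) = ?g p b' (x, D)"
      using * by (cases b; cases b') (simp_all add: restrict_section_def t_def)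
  qed
  then obtain g where g: "\<And>p. p \<in> Y \<Longrightarrow> g p \<in> F m (U p)"
    "\<And>p b x D. p \<in> Y \<Longrightarrow> x \<in> ?W p b \<Longrightarrow> g p (x, D) = ?g p b (x, D)" by (metis UNIV_I)
  have "c (p, q, x, D) = g q (x, D) - g p (x, D)" if pq: "p \<in> Y" "q \<in> Y" "x \<in> U p \<inter> U q" for p q x D
  proof -
    have "x \<in> Y" using openin_subset[OF cech_dataD(1)[OF d pq(1)]] pq(3) by blast
    then obtain b z where "x = psi b z" by (rule Y_cases)
    then have x: "x \<in> range (psi b)" by blast
    then show ?thesis
      using cech_dataD(4)[OF d pq(1,2), of x b D] g(2)[OF pq(1), of x b D] g(2)[OF pq(2), of x b D] pq(3)
      by (simp add: restrict_section_def)
  qed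
  moreover have "point_cover A1_resolution U"
    unfolding point_cover_def using cech_dataD(1,2)[OF d] by blast
  ultimately show "c \<in> cech_coboundaries A1_resolution (F m)"
    unfolding cech_coboundaries_def
    by (intro CollectI exI[of _ U] exI[of _ g] conjI ballI allI g(1)) auto
qed

lemma cech_data_onto:
  assumes s: "s \<in> F m V01"
  shows "\<exists>c\<in>cech_cocycles A1_resolution (F m). \<exists>U \<beta>. cech_data m c U \<beta> s"
proof -
  define V where "V = (\<lambda>p. if p \<in> range (psi False) then range (psi False) else range (psi True))"
  \<comment> \<open>\<open>\<eta> p\<close> records which of the two charts serves as the
    neighbourhood \<open>V p\<close>.\<close>
  define \<eta> :: "_ \<Rightarrow> complex" where "\<eta> = (\<lambda>p. if p \<in> range (psi False) then 0 else 1)"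
  define c where "c = (\<lambda>(p, q, x). (\<eta> q - \<eta> p) * s x)"
  \<comment> \<open>\<open>\<beta> b p\<close> is 0 when \<open>V p\<close> is the chart
    \<open>b\<close> itself. Otherwise only the overlap is involved, where a multiple of
    \<open>s\<close> is a section.\<close>
  define \<beta> where "\<beta> = (\<lambda>b p x. (if b then \<eta> p - 1 else \<eta> p) * s x)"
  have op: "openin A1_resolution (V p)" for p unfolding V_def using openin_range_psi by simp
  have pV: "p \<in> V p" if "p \<in> Y" for p using that unfolding V_def Y_eq by auto
  have "cech_data m c V \<beta> s"
  proof (rule cech_dataI[OF op pV _ _ s])
    fix b p
    show "\<beta> b p \<in> F m (V p \<inter> range (psi b))"
    proof (cases "b = (p \<in> range (psi False))")
      case True
      then have "V p \<inter> range (psi b) = V01" by (auto simp: V_def)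
      then show ?thesis unfolding \<beta>_def using F_scale[OF openin_V01 s] by simp
    next
      case False
      then have "\<beta> b p = (\<lambda>_. 0)" by (auto simp: \<beta>_def \<eta>_def)
      then show ?thesis using F_zero[OF openin_Int[OF op openin_range_psi]] by simp
    qed
  qed (simp_all add: c_def \<beta>_def algebra_simps)
  moreover have "c \<in> cech_cocycles A1_resolution (F m)"
    unfolding cech_cocycles_def
  proof (intro CollectI exI[of _ V] conjI ballI allI)
    show "point_cover A1_resolution V" unfolding point_cover_def using op pV by blast
    show "c (p, q, x, v) + c (q, r, x, v) = c (p, r, x, v)" for p q r x v
      by (simp add: c_def algebra_simps)
    fix p q
    show "restrict_section (V p \<inter> V q) (\<lambda>z. c (p, q, z)) \<in> F m (V p \<inter> V q)"
    proof (cases "(p \<in> range (psi False)) = (q \<in> range (psi False))")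
      case True
      then have "restrict_section (V p \<inter> V q) (\<lambda>z. c (p, q, z)) = (\<lambda>_. 0)"
        by (auto simp: c_def \<eta>_def restrict_section_def)
      then show ?thesis using F_zero[OF openin_Int[OF op op]] by simp
    next
      case False
      then have V: "V p \<inter> V q = V01" by (auto simp: V_def)
      have "(\<lambda>z. c (p, q, z)) \<in> F m V01" using F_scale[OF openin_V01 s] by (simp add: c_def)
      then show ?thesis unfolding V by (rule F_restrict[OF _ openin_V01 subset_refl])
    qed
  qed
  ultimately show ?thesis by blast
qed

lemma coeff_eq_0_iff_dvd: "[:0, 1:] ^ n dvd (h :: complex poly) \<longleftrightarrow> (\<forall>k<n. coeff h k = 0)"
  using monom_1_dvd_iff'[of n h] by (simp add: monom_altdef)

text \<open>After removal of the common power of \<open>1 - y\<close>, chart \<open>False\<close>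
  provides the multiples of \<open>y^(m-i)\<close> and chart \<open>True\<close> the polynomials of
  bounded degree. Both spaces are spanned by powers of \<open>y\<close>, so splitting means that the
  coefficients at the powers missing from both vanish.\<close>

lemma split_iff:
  assumes s: "s \<in> F m V01" and q: "gexp False s q" "\<And>p. q p = y1 ^ nat (int m - snd p) * h p"
  shows "(\<exists>t0\<in>F m (range (psi False)). \<exists>t1\<in>F m (range (psi True)). \<forall>x\<in>V01. \<forall>D. s (x, D) = t1 (x, D) - t0 (x, D))
     \<longleftrightarrow> (\<forall>(p, n)\<in>chi1_index m. coeff (h p) n = 0)"
proof
  assume "\<exists>t0\<in>F m (range (psi False)). \<exists>t1\<in>F m (range (psi True)). \<forall>x\<in>V01. \<forall>D. s (x, D) = t1 (x, D) - t0 (x, D)"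
  then obtain t0 t1 where t: "t0 \<in> F m (range (psi False))" "t1 \<in> F m (range (psi True))"
    and st: "\<And>x D. x \<in> V01 \<Longrightarrow> s (x, D) = t1 (x, D) - t0 (x, D)" by blast
  from F_expansion_chart[OF t(1)] F_expansion_chart[OF t(2)] obtain q0 q1 where
    q0: "gexp False t0 q0" "good m True False True q0" and q1: "gexp False t1 q1" "good m False True True q1" by auto
  have torus: "psi False (u, v) \<in> V01" if "u \<noteq> 0" for u v
    using that psi_overlap[of False "(u, v)"] by simp
  have "gexp False (\<lambda>x. 1 * t1 x + (- 1) * t0 x) (\<lambda>p. smult 1 (q1 p) + smult (- 1) (q0 p))"
    by (rule gexp_linear[OF q1(1) q0(1)])
  then have "gexp False s (\<lambda>p. smult 1 (q1 p) + smult (- 1) (q0 p))"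
    unfolding gexp_def tval_def using st[OF torus] by simp
  with gexp_unique[OF q(1)] have qeq: "q = (\<lambda>p. smult 1 (q1 p) + smult (- 1) (q0 p))" by blast
  have "coeff (h p) n = 0" if pn: "(p, n) \<in> chi1_index m" for p n
  proof -
    let ?e = "nat (int m - snd p)"
    obtain h0 h1 where h01: "q0 p = y1 ^ ?e * h0" "q1 p = y1 ^ ?e * h1"
      using goodD(5)[OF q0(2), of p] goodD(5)[OF q1(2), of p] unfolding condV_def by (auto elim!: dvdE)
    have "y1 ^ ?e * h p = y1 ^ ?e * (h1 - h0)"
      using fun_cong[OF qeq, of p] unfolding q(2)[of p] h01 by (simp add: algebra_simps)
    then have h: "h p = h1 - h0" by simp
    have "[:0, 1:] ^ nat (int m - fst p) dvd y1 ^ ?e * h0"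
      using goodD(3)[OF q0(2), of p] by (simp add: condU_def h01)
    then have "[:0, 1:] ^ nat (int m - fst p) dvd h0"
      by (simp only: y_power_dvd_mult)
    then have "coeff h0 n = 0"
      using pn unfolding coeff_eq_0_iff_dvd by (cases p) (auto simp: chi1_index_def)
    moreover have "coeff h1 n = 0"
    proof (cases "h1 = 0")
      case False
      then have "degree (q1 p) = ?e + degree h1" unfolding h01 by (simp add: degree_mult_eq degree_power_eq)
      moreover have "q1 p \<noteq> 0" using False h01 by simp
      then have "int (degree (q1 p)) \<le> 2 * snd p - fst p"
        using goodD(4)[OF q1(2), of p] by (metis condU_def leading_coeff_0_iff not_le)
      ultimately have "degree h1 < n" using pn by (cases p) (auto simp: chi1_index_def)
      then show ?thesis by (rule coeff_eq_0)
    qed simp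
    ultimately show ?thesis by (simp add: h)
  qed
  then show "\<forall>(p, n)\<in>chi1_index m. coeff (h p) n = 0" by blast
next
  assume *: "\<forall>(p, n)\<in>chi1_index m. coeff (h p) n = 0"
  from F_expansion_overlap[OF s] obtain q' where q': "gexp False s q'" "good m False False True q'" by blast
  have g: "good m False False True q" using gexp_unique[OF q(1) q'(1)] q'(2) by simp
  \<comment> \<open>Powers below \<open>y^(m-i)\<close> must come from chart \<open>True\<close>;
    all others are assigned to chart \<open>False\<close>. \<open>h0\<close> is the negative of the
    tail because \<open>s = t1 - t0\<close>.\<close>
  define h1 where "h1 = (\<lambda>p. poly_cutoff (nat (int m - fst p)) (h p))"
  define h0 where "h0 = (\<lambda>p. h1 p - h p)"
  define q0 where "q0 = (\<lambda>p. y1 ^ nat (int m - snd p) * h0 p)"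
  define q1 where "q1 = (\<lambda>p. y1 ^ nat (int m - snd p) * h1 p)"
  have zero: "h p = 0" if "q p = 0" for p using that q(2)[of p] by simp
  have supp: "fsupp (\<lambda>p. y1 ^ nat (int m - snd p) * k p)" if "\<And>p. h p = 0 \<Longrightarrow> k p = 0" for k
    unfolding fsupp_def
  proof (rule finite_subset)
    show "{p. y1 ^ nat (int m - snd p) * k p \<noteq> 0} \<subseteq> {p. q p \<noteq> 0}"
    proof
      fix p assume "p \<in> {p. y1 ^ nat (int m - snd p) * k p \<noteq> 0}"
      then show "p \<in> {p. q p \<noteq> 0}" using that[of p] zero[of p] by fastforce
    qed
    show "finite {p. q p \<noteq> 0}" using goodD(1)[OF g] by (simp add: fsupp_def)
  qed
  have deg: "nat (int m - snd p) + n \<le> m" if "coeff (h p) n \<noteq> 0" for p n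
  proof -
    have "h p \<noteq> 0" using that by auto
    then have "degree (q p) = nat (int m - snd p) + degree (h p)"
      unfolding q(2)[of p] by (simp add: degree_mult_eq degree_power_eq)
    moreover have "n \<le> degree (h p)" using that by (rule le_degree)
    ultimately show ?thesis using goodD(2)[OF g, of p] by simp
  qed
  have degk: "degree (y1 ^ nat (int m - snd p) * k) \<le> m" if "\<And>n. coeff k n \<noteq> 0 \<Longrightarrow> coeff (h p) n \<noteq> 0" for p k
  proof (cases "k = 0")
    case False
    then have "nat (int m - snd p) + degree k \<le> m" using that[of "degree k"] deg by simp
    with False show ?thesis by (simp add: degree_mult_eq degree_power_eq)
  qed simp
  have c1: "coeff (h1 p) n = (if n < nat (int m - fst p) then coeff (h p) n else 0)" for p n
    by (simp add: h1_def coeff_poly_cutoff)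
  have c0: "coeff (h0 p) n = (if n < nat (int m - fst p) then 0 else - coeff (h p) n)" for p n
    by (simp add: h0_def c1)
  have "good m True False True q0"
    unfolding good_def
  proof (intro conjI allI impI)
    show "fsupp q0" unfolding q0_def by (rule supp) (rule poly_eqI, simp add: c0)
    fix p
    show "degree (q0 p) \<le> m" unfolding q0_def by (rule degk) (simp add: c0 split: if_splits)
    show "condU m False (fst p) (q0 p)"
      unfolding condU_def q0_def using coeff_eq_0_iff_dvd[of "nat (int m - fst p)" "h0 p"] c0 by simp
    show "condV m (snd p) (q0 p)" by (simp add: condV_def q0_def)
  qed simp_all
  moreover have "good m False True True q1"
    unfolding good_def
  proof (intro conjI allI impI)
    show "fsupp q1" unfolding q1_def by (rule supp) (rule poly_eqI, simp add: c1)
    fix p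
    show "degree (q1 p) \<le> m" unfolding q1_def by (rule degk) (simp add: c1 split: if_splits)
    show "condV m (snd p) (q1 p)" by (simp add: condV_def q1_def)
    show "condU m True (2 * snd p - fst p) (q1 p)"
    proof (cases "h1 p = 0")
      case True
      then show ?thesis by (simp add: q1_def)
    next
      case False
      let ?n = "degree (h1 p)"
      have "coeff (h1 p) ?n \<noteq> 0" using False by simp
      then have n: "?n < nat (int m - fst p)" "coeff (h p) ?n \<noteq> 0" by (simp_all add: c1 split: if_splits)
      \<comment> \<open>The top coefficient of \<open>h1 p\<close> is nonzero, so its index is not
        in \<open>chi1_index\<close>, and the degree bound of chart \<open>True\<close>
        follows.\<close>
      then have "(p, ?n) \<notin> chi1_index m" using * by blast
      then have "int (nat (int m - snd p) + ?n) \<le> 2 * snd p - fst p"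
        using n(1) deg[OF n(2)] by (cases p) (simp add: chi1_index_def, linarith)
      moreover have "degree (q1 p) = nat (int m - snd p) + ?n"
        unfolding q1_def using False by (simp add: degree_mult_eq degree_power_eq)
      ultimately have "int (degree (q1 p)) \<le> 2 * snd p - fst p" by (simp only:)
      then show ?thesis by (auto simp: condU_def intro!: coeff_eq_0)
    qed
  qed simp_all
  ultimately obtain t0 t1 where t: "t0 \<in> F m (range (psi False))" "gexp False t0 q0"
    "t1 \<in> F m (range (psi True))" "gexp False t1 q1"
    using F_of_expansion_chart[of m False q0] F_of_expansion_chart[of m True q1] by auto
  let ?t = "\<lambda>x. restrict_section V01 t1 x - restrict_section V01 t0 x"
  have "s = ?t"
  proof (rule F_identity[OF openin_V01 s])
    show "?t \<in> F m V01" by (rule F_diff_restrict[OF t(3,1) openin_V01]) auto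
    fix u v y assume nz: "u \<noteq> 0" "v \<noteq> 0" and x: "psi False (u, v) \<in> V01"
    have "gexp False (\<lambda>x. 1 * t1 x + (- 1) * t0 x) (\<lambda>p. smult 1 (q1 p) + smult (- 1) (q0 p))"
      by (rule gexp_linear[OF t(4,2)])
    moreover have "(\<lambda>p. smult 1 (q1 p) + smult (- 1) (q0 p)) = q"
      by (rule ext) (simp add: q(2) q0_def q1_def h0_def algebra_simps)
    ultimately have "tval False (\<lambda>x. 1 * t1 x + (- 1) * t0 x) u v y = tval False s u v y"
      using q(1) nz by (simp add: gexp_def)
    then show "tval False s u v y = tval False ?t u v y"
      using x by (simp add: tval_def restrict_section_def)
  qed
  then have "\<forall>x\<in>V01. \<forall>D. s (x, D) = t1 (x, D) - t0 (x, D)" by (simp add: restrict_section_def)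
  with t show "\<exists>t0\<in>F m (range (psi False)). \<exists>t1\<in>F m (range (psi True)). \<forall>x\<in>V01. \<forall>D. s (x, D) = t1 (x, D) - t0 (x, D)"
    by blast
qed

lemma local_chi1_eq: "local_chi1 A1_resolution A1_exceptional (F m) = enat (card (chi1_index m))"
  unfolding local_chi1_def h1_def
proof (rule quotient_dim_eqI[where R = "chi1_rel m", OF finite_chi1_index])
  fix c assume "c \<in> cech_cocycles A1_resolution (F m)"
  then obtain U \<beta> s where d: "cech_data m c U \<beta> s" using cech_data_exists by blast
  from F_expansion_overlap[OF cech_dataD(5)[OF d]] obtain q where
    q: "gexp False s q" "good m False False True q" by blast
  have "\<exists>g. q p = y1 ^ nat (int m - snd p) * g" for p
    using goodD(5)[OF q(2), of p] by (simp add: condV_def dvd_def)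
  then obtain h where "\<forall>p. q p = y1 ^ nat (int m - snd p) * h p" by metis
  with d q(1) have "chi1_rel m c (\<lambda>(p, n). coeff (h p) n)"
    unfolding chi1_rel_def
    by (rule_tac exI[of _ U], rule_tac exI[of _ \<beta>], rule_tac exI[of _ s], rule_tac exI[of _ q], rule_tac exI[of _ h]) simp
  then show "\<exists>a. chi1_rel m c a" by blast
next
  fix c c' a a' k k' assume "chi1_rel m c a" "chi1_rel m c' a'"
  then obtain U \<beta> s q h U' \<beta>' s' q' h' where
    1: "cech_data m c U \<beta> s" "gexp False s q" "\<forall>p. q p = y1 ^ nat (int m - snd p) * h p" "\<forall>p n. a (p, n) = coeff (h p) n" and
    2: "cech_data m c' U' \<beta>' s'" "gexp False s' q'" "\<forall>p. q' p = y1 ^ nat (int m - snd p) * h' p" "\<forall>p n. a' (p, n) = coeff (h' p) n"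
    unfolding chi1_rel_def by (elim exE conjE)
  show "chi1_rel m (\<lambda>x. k * c x + k' * c' x) (\<lambda>i. k * a i + k' * a' i)"
    unfolding chi1_rel_def
  proof ((rule exI)+, intro conjI allI)
    show "cech_data m (\<lambda>x. k * c x + k' * c' x) (\<lambda>p. U p \<inter> U' p)
      (\<lambda>b p x. k * restrict_section (U p \<inter> U' p \<inter> range (psi b)) (\<beta> b p) x +
       k' * restrict_section (U p \<inter> U' p \<inter> range (psi b)) (\<beta>' b p) x) (\<lambda>x. k * s x + k' * s' x)"
      by (rule cech_data_linear[OF 1(1) 2(1)])
    show "gexp False (\<lambda>x. k * s x + k' * s' x) (\<lambda>p. smult k (q p) + smult k' (q' p))"
      by (rule gexp_linear[OF 1(2) 2(2)])
    fix p :: "int \<times> int"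
    show "smult k (q p) + smult k' (q' p) = y1 ^ nat (int m - snd p) * (smult k (h p) + smult k' (h' p))"
      unfolding 1(3)[rule_format, of p] 2(3)[rule_format, of p]
      by (simp only: distrib_left mult_smult_right)
    show "k * a (p, n) + k' * a' (p, n) = coeff (smult k (h p) + smult k' (h' p)) n" for n
      by (simp add: 1(4) 2(4))
  qed
next
  fix c a assume "chi1_rel m c a"
  then obtain U \<beta> s q h where
    1: "cech_data m c U \<beta> s" "gexp False s q" "\<forall>p. q p = y1 ^ nat (int m - snd p) * h p" "\<forall>p n. a (p, n) = coeff (h p) n"
    unfolding chi1_rel_def by (elim exE conjE)
  have "c \<in> cech_coboundaries A1_resolution (F m) \<longleftrightarrow> (\<forall>(p, n)\<in>chi1_index m. coeff (h p) n = 0)"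
    using cech_coboundary_iff[OF 1(1)] split_iff[OF cech_dataD(5)[OF 1(1)] 1(2) 1(3)[rule_format]] by simp
  also have "\<dots> \<longleftrightarrow> (\<forall>i\<in>chi1_index m. a i = 0)"
  proof (rule ball_cong[OF refl])
    fix i :: "(int \<times> int) \<times> nat"
    obtain p n where i: "i = (p, n)" by (cases i)
    show "(case i of (p, n) \<Rightarrow> coeff (h p) n = 0) \<longleftrightarrow> a i = 0"
      unfolding i prod.case using 1(4)[rule_format, of p n] by simp
  qed
  finally show "c \<in> cech_coboundaries A1_resolution (F m) \<longleftrightarrow> (\<forall>i\<in>chi1_index m. a i = 0)" .
next
  fix a :: "(int \<times> int) \<times> nat \<Rightarrow> complex"
  define h where "h = (\<lambda>p. \<Sum>n | (p, n) \<in> chi1_index m. monom (a (p, n)) n)"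
  have finp: "finite {n. (p, n) \<in> chi1_index m}" for p
    by (rule finite_subset[of _ "snd ` chi1_index m"]) (force, simp add: finite_chi1_index)
  have ch: "coeff (h p) n = (if (p, n) \<in> chi1_index m then a (p, n) else 0)" for p n
  proof -
    have "coeff (h p) n = (\<Sum>k | (p, k) \<in> chi1_index m. if k = n then a (p, n) else 0)"
      unfolding h_def coeff_sum by (intro sum.cong) (auto simp: coeff_monom)
    then show ?thesis using finp[of p] by simp
  qed
  define q where "q = (\<lambda>p. y1 ^ nat (int m - snd p) * h p)"
  have top: "(p, degree (h p)) \<in> chi1_index m" if "h p \<noteq> 0" for p
    using that ch[of p "degree (h p)"] by (metis leading_coeff_0_iff)
  have "{p. q p \<noteq> 0} \<subseteq> fst ` chi1_index m"
  proof
    fix p assume "p \<in> {p. q p \<noteq> 0}"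
    then have "h p \<noteq> 0" by (auto simp: q_def)
    from top[OF this] show "p \<in> fst ` chi1_index m" by force
  qed
  then have "fsupp q" unfolding fsupp_def by (rule finite_subset) (simp add: finite_chi1_index)
  moreover have "degree (q p) \<le> m" for p
  proof (cases "h p = 0")
    case False
    from top[OF this] have "nat (int m - snd p) + degree (h p) \<le> m" by (cases p) (auto simp: chi1_index_def)
    then show ?thesis
      unfolding q_def by (intro order.trans[OF degree_mult_le]) (simp add: degree_power_eq)
  qed (simp add: q_def)
  moreover have "condV m (snd p) (q p)" for p by (simp add: condV_def q_def)
  ultimately have "good m False False True q" unfolding good_def by blast
  then obtain s where s: "s \<in> F m V01" "gexp False s q" using F_of_expansion_overlap by blast
  from cech_data_onto[OF s(1)] obtain c U \<beta> where
    c: "c \<in> cech_cocycles A1_resolution (F m)" "cech_data m c U \<beta> s" by blast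
  have "chi1_rel m c (\<lambda>(p, n). coeff (h p) n)"
    unfolding chi1_rel_def using c(2) s(2)
    by (rule_tac exI[of _ U], rule_tac exI[of _ \<beta>], rule_tac exI[of _ s], rule_tac exI[of _ q], rule_tac exI[of _ h])
      (simp add: q_def)
  then show "\<exists>c\<in>cech_cocycles A1_resolution (F m). \<exists>a'. chi1_rel m c a' \<and> (\<forall>i\<in>chi1_index m. a' i = a i)"
    using c(1) ch by (intro bexI[of _ c] exI[of _ "\<lambda>(p, n). coeff (h p) n"]) auto
qed

section \<open>Counting\<close>

text \<open>For fixed \<open>j\<close> and \<open>k \<le> j\<close> the admissible \<open>i\<close>
  lie strictly between \<open>3 j - m - k\<close> and \<open>m - k\<close>. These are
  \<open>2 m - (3 j + 1)\<close> values, counted downwards by the third component; truncated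
  subtraction gives 0 when there are none.\<close>

lemma card_chi1_index: "card (chi1_index m) = (\<Sum>j<m. (j + 1) * (2 * m - (3 * j + 1)))"
proof -
  let ?S = "SIGMA j:{..<m}. {..j} \<times> {..<2 * m - (3 * j + 1)}"
  have "bij_betw (\<lambda>((i, j), k). (nat j, k, nat (int m - 1 - int k - i))) (chi1_index m) ?S"
    by (rule bij_betw_byWitness[where f' = "\<lambda>(j, k, e). ((int m - 1 - int k - int e, int j), k)"])
      (auto simp: chi1_index_def)
  from bij_betw_same_card[OF this] have "card (chi1_index m) = card ?S" .
  also have "\<dots> = (\<Sum>j<m. (j + 1) * (2 * m - (3 * j + 1)))"
    by (subst card_SigmaI) (auto simp: card_cartesian_product)
  finally show ?thesis .
qed

text \<open>The indices are those of \<open>N\<close>, where only the degree bounds and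
  \<open>j < m\<close> are imposed, without those of \<open>N'\<close>, where also
  \<open>n \<ge> m - j\<close>. The additive form avoids truncated subtraction of the two
  counts.\<close>

lemma card_chi0_index:
  "card (chi0_index m) + (\<Sum>j<m. (j + 1) * (3 * j + 1 - 2 * m)) = (\<Sum>j<m. (m + 1) * (2 * j + 1 - m))"
proof -
  define N where "N = {((i, j), n::nat). j < int m \<and> int n + max 0 (int m - i) \<le> min (int m) (2 * j - i)}"
  define N' where "N' = {((i, j), n::nat). j < int m \<and> int m - j \<le> int n \<and>
      int n + max 0 (int m - i) \<le> min (int m) (2 * j - i)}"
  let ?S = "SIGMA j:{..<m}. {..m} \<times> {..<2 * j + 1 - m}"
  let ?S' = "SIGMA j:{..<m}. {..j} \<times> {..<3 * j + 1 - 2 * m}"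
  \<comment> \<open>With \<open>k = n + max 0 (m - i)\<close> and \<open>e = k + i - m\<close> the
    bounds become \<open>0 \<le> k \<le> m\<close> and \<open>0 \<le> e \<le> 2 j - m\<close>. For
    \<open>N'\<close> the same substitution is made after lowering \<open>n\<close> by
    \<open>m - j\<close>.\<close>
  have "bij_betw (\<lambda>((i, j), n). (nat j, nat (int n + max 0 (int m - i)), nat (int n + max 0 (int m - i) + i - int m))) N ?S"
    by (rule bij_betw_byWitness[where f' = "\<lambda>(j, k, e). ((int m - int k + int e, int j), nat (int k - max 0 (int k - int e)))"])
      (auto simp: N_def)
  from bij_betw_same_card[OF this] have N: "card N = (\<Sum>j<m. (m + 1) * (2 * j + 1 - m))"
    by (simp add: card_cartesian_product)
  have "bij_betw (\<lambda>((i, j), n). (nat j, nat (int n - (int m - j) + max 0 (int m - i)),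
      nat (int n - (int m - j) + max 0 (int m - i) + i - int m))) N' ?S'"
    by (rule bij_betw_byWitness[where f' = "\<lambda>(j, k, e). ((int m - int k + int e, int j),
        nat (int k - max 0 (int k - int e) + (int m - int j)))"])
      (auto simp: N'_def)
  from bij_betw_same_card[OF this] have N': "card N' = (\<Sum>j<m. (j + 1) * (3 * j + 1 - 2 * m))"
    by (simp add: card_cartesian_product)
  have "N = chi0_index m \<union> N'" "chi0_index m \<inter> N' = {}"
    by (auto simp: N_def N'_def chi0_index_def)
  moreover have "finite N'"
    by (rule finite_subset[of _ "({0..2 * int m} \<times> {0..int m}) \<times> {..m}"]) (auto simp: N'_def)
  ultimately have "card N = card (chi0_index m) + card N'"
    using card_Un_disjoint[OF finite_chi0_index] by simp
  then show ?thesis unfolding N N' by simp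
qed

text \<open>The summand without truncation; it serves with \<open>n = m\<close> for the total and
  with a cutoff for \<open>local_chi1\<close>.\<close>

lemma sum_weights: "(\<Sum>j<n. (real j + 1) * (2 * real m - (3 * real j + 1))) =
    real n * (real n + 1) * (2 * real m + 1 - 2 * real n) / 2"
  by (induction n) (simp_all add: field_simps)

text \<open>The sum of the positive numbers among \<open>m-1\<close>, \<open>m-3\<close>, and so on.
  Passing from \<open>m - 2\<close> to \<open>m\<close> adds the term \<open>m - 1\<close>, which
  explains the induction in steps of 2.\<close>

lemma sum_parity: "4 * (\<Sum>t<m. m - 1 - 2 * t) = (if even m then m\<^sup>2 else m\<^sup>2 - (1::nat))"
proof (induction m rule: nat_less_induct)
  case (1 m)
  show ?case
  proof (cases "m < 2")
    case True
    then have "m = 0 \<or> m = 1" by auto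
    then show ?thesis by auto
  next
    case False
    then obtain k where k: "m = Suc (Suc k)" by (metis add_2_eq_Suc le_Suc_ex not_le)
    have "(\<Sum>t<m. m - 1 - 2 * t) = (k + 1) + (\<Sum>t<Suc k. k - 1 - 2 * t)"
      unfolding k sum.lessThan_Suc_shift[of _ "Suc k"] by (simp del: sum.lessThan_Suc)
    \<comment> \<open>The last term \<open>k - 1 - 2 * k\<close> is 0 by truncation.\<close>
    then have "(\<Sum>t<m. m - 1 - 2 * t) = (k + 1) + (\<Sum>t<k. k - 1 - 2 * t)" by simp
    moreover have "4 * (\<Sum>t<k. k - 1 - 2 * t) = (if even k then k\<^sup>2 else k\<^sup>2 - 1)" using 1 k by simp
    moreover have "k\<^sup>2 \<ge> 1" if "odd k" using that by (cases k) (auto simp: power2_eq_square)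
    ultimately show ?thesis by (auto simp: k power2_eq_square algebra_simps)
  qed
qed

lemma sum_truncated: "(\<Sum>j<m. 2 * j + 1 - m) = (\<Sum>t<m. m - 1 - 2 * t)" for m :: nat
  by (rule sum.reindex_bij_witness[of _ "\<lambda>t. m - 1 - t" "\<lambda>t. m - 1 - t"]) auto

text \<open>The truncated factors in the two counts are the positive and the negative part of
  \<open>2 m - (3 j + 1)\<close>. In the total they combine to a polynomial sum, so the dependence
  on \<open>m mod 3\<close> disappears and only the parity from \<open>sum_parity\<close>
  remains.\<close>

lemma chi_total: "real (card (chi0_index m) + card (chi1_index m)) =
   (if m mod 2 = 0 then 1/4 * real m * (real m + 1) * (real m + 2)
    else 1/4 * (real m + 1) * ((real m)^2 + 2 * real m - 1))"
proof -
  have "real (\<Sum>j<m. (j + 1) * (2 * m - (3 * j + 1))) - real (\<Sum>j<m. (j + 1) * (3 * j + 1 - 2 * m)) =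
      (\<Sum>j<m. (real j + 1) * (2 * real m - (3 * real j + 1)))"
    unfolding of_nat_sum sum_subtractf[symmetric]
  proof (rule sum.cong[OF refl])
    fix j
    have e: "real (2 * m - (3 * j + 1)) - real (3 * j + 1 - 2 * m) = 2 * real m - (3 * real j + 1)" by linarith
    show "real ((j + 1) * (2 * m - (3 * j + 1))) - real ((j + 1) * (3 * j + 1 - 2 * m)) =
        (real j + 1) * (2 * real m - (3 * real j + 1))"
      unfolding of_nat_mult right_diff_distrib[symmetric] e by (simp only: of_nat_add of_nat_1)
  qed
  also have "\<dots> = real m * (real m + 1) / 2" unfolding sum_weights by simp
  finally have diff: "real (\<Sum>j<m. (j + 1) * (2 * m - (3 * j + 1))) - real (\<Sum>j<m. (j + 1) * (3 * j + 1 - 2 * m)) =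
      real m * (real m + 1) / 2" .
  have "4 * (\<Sum>j<m. 2 * j + 1 - m) = (if even m then m\<^sup>2 else m\<^sup>2 - 1)"
    unfolding sum_truncated by (rule sum_parity)
  then have "real (4 * (\<Sum>j<m. 2 * j + 1 - m)) = real (if even m then m\<^sup>2 else m\<^sup>2 - 1)" by (simp only:)
  also have "\<dots> = (if even m then (real m)\<^sup>2 else (real m)\<^sup>2 - 1)"
  proof -
    have "1 \<le> m\<^sup>2" if "odd m" using that by (cases m) (auto simp: power2_eq_square)
    then show ?thesis by (auto simp: of_nat_diff)
  qed
  finally have par: "real (\<Sum>j<m. 2 * j + 1 - m) = (if even m then (real m)\<^sup>2 else (real m)\<^sup>2 - 1) / 4" by simp
  have "card (chi0_index m) + (\<Sum>j<m. (j + 1) * (3 * j + 1 - 2 * m)) = (m + 1) * (\<Sum>j<m. 2 * j + 1 - m)"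
    unfolding card_chi0_index by (rule sum_distrib_left[symmetric])
  from arg_cong[OF this, of real]
  have "real (card (chi0_index m)) + real (\<Sum>j<m. (j + 1) * (3 * j + 1 - 2 * m)) = (real m + 1) * real (\<Sum>j<m. 2 * j + 1 - m)"
    by (simp only: of_nat_add of_nat_mult of_nat_1)
  then have "real (card (chi0_index m) + card (chi1_index m)) =
      (real m + 1) * real (\<Sum>j<m. 2 * j + 1 - m) + real m * (real m + 1) / 2"
    using diff unfolding card_chi1_index of_nat_add by linarith
  then show ?thesis unfolding par even_iff_mod_2_eq_zero by (auto simp: power2_eq_square field_simps)
qed

text \<open>From \<open>n\<close> on the summands are 0 by truncation, and before it truncation has
  no effect, so \<open>sum_weights\<close> applies.\<close>

lemma chi1_cutoff:
  assumes "n \<le> m" "\<And>j. j < n \<Longrightarrow> 3 * j + 1 \<le> 2 * m" "2 * m \<le> 3 * n + 1"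
  shows "real (card (chi1_index m)) = real n * (real n + 1) * (2 * real m + 1 - 2 * real n) / 2"
proof -
  have "card (chi1_index m) = (\<Sum>j<n. (j + 1) * (2 * m - (3 * j + 1)))"
    unfolding card_chi1_index using assms(1,3) by (intro sum.mono_neutral_right) auto
  also have "real \<dots> = (\<Sum>j<n. (real j + 1) * (2 * real m - (3 * real j + 1)))"
    unfolding of_nat_sum
  proof (rule sum.cong[OF refl])
    fix j assume "j \<in> {..<n}"
    then have "3 * j + 1 \<le> 2 * m" by (intro assms(2)) simp
    then have e: "real (2 * m - (3 * j + 1)) = 2 * real m - (3 * real j + 1)" by linarith
    show "real ((j + 1) * (2 * m - (3 * j + 1))) = (real j + 1) * (2 * real m - (3 * real j + 1))"
      unfolding of_nat_mult e by (simp only: of_nat_add of_nat_1)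
  qed
  finally show ?thesis unfolding sum_weights .
qed

lemma chi1_total: "real (card (chi1_index m)) =
   (if m mod 3 = 0 then 4/27 * (real m)^3 + 4/9 * (real m)^2 + 1/3 * real m
    else if m mod 3 = 1 then 4/27 * (real m)^3 + 4/9 * (real m)^2 + 1/3 * real m + 2/27
    else 4/27 * (real m)^3 + 4/9 * (real m)^2 + 1/9 * real m - 5/27)"
proof -
  obtain s r where m: "m = 3 * s + r" "r < 3"
    by (rule that[of "m div 3" "m mod 3"]) simp_all
  then have mod: "m mod 3 = r" by simp
  consider "r = 0" | "r = 1" | "r = 2" using m(2) by linarith
  then show ?thesis
  proof cases
    case 1
    \<comment> \<open>The nonzero summands are those with \<open>3 j + 1 < 2 m\<close>. For
      \<open>m = 3 s\<close> this means \<open>j < 2 s\<close>; in the other two residue classes it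
      means \<open>j \<le> 2 s\<close>, hence the cutoff \<open>2 s + 1\<close> there.\<close>
    have "real (card (chi1_index m)) = real (2 * s) * (real (2 * s) + 1) * (2 * real m + 1 - 2 * real (2 * s)) / 2"
      by (rule chi1_cutoff) (simp_all add: m(1) 1)
    also have "\<dots> = 4/27 * (real m)^3 + 4/9 * (real m)^2 + 1/3 * real m"
      unfolding m(1) 1
      by (simp add: power2_eq_square power3_eq_cube algebra_simps add_divide_distrib)
    finally show ?thesis using mod 1 by simp
  next
    case 2
    have "real (card (chi1_index m)) = real (2 * s + 1) * (real (2 * s + 1) + 1) * (2 * real m + 1 - 2 * real (2 * s + 1)) / 2"
      by (rule chi1_cutoff) (simp_all add: m(1) 2)
    also have "\<dots> = 4/27 * (real m)^3 + 4/9 * (real m)^2 + 1/3 * real m + 2/27"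
      unfolding m(1) 2
      by (simp add: power2_eq_square power3_eq_cube algebra_simps add_divide_distrib)
    finally show ?thesis using mod 2 by simp
  next
    case 3
    have "real (card (chi1_index m)) = real (2 * s + 1) * (real (2 * s + 1) + 1) * (2 * real m + 1 - 2 * real (2 * s + 1)) / 2"
      by (rule chi1_cutoff) (simp_all add: m(1) 3)
    also have "\<dots> = 4/27 * (real m)^3 + 4/9 * (real m)^2 + 1/9 * real m - 5/27"
      unfolding m(1) 3
      by (simp add: power2_eq_square power3_eq_cube algebra_simps add_divide_distrib)
    finally show ?thesis using mod 3 by simp
  qed
qed

theorem proposition3p7:
  fixes m :: nat
  assumes "m \<ge> 1"
  shows "ereal_of_enat (local_chi A1_resolution A1_exceptional (A1_sym_cotangent m)) =
      ereal (if m mod 2 = 0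
        then 1/4 * real m * (real m + 1) * (real m + 2)
        else 1/4 * (real m + 1) * ((real m)^2 + 2 * real m - 1))
    \<and> ereal_of_enat (local_chi1 A1_resolution A1_exceptional (A1_sym_cotangent m)) =
      ereal (if m mod 3 = 0
        then 4/27 * (real m)^3 + 4/9 * (real m)^2 + 1/3 * real m
        else if m mod 3 = 1
        then 4/27 * (real m)^3 + 4/9 * (real m)^2 + 1/3 * real m + 2/27
        else 4/27 * (real m)^3 + 4/9 * (real m)^2 + 1/9 * real m - 5/27)"
  unfolding local_chi_def local_chi0_eq local_chi1_eq plus_enat_simps(1) ereal_of_enat_simps(1)
    chi_total chi1_total by (rule conjI; rule refl)

end
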